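(* Let $0<s<1$, $n\ge2$, let $\Omega$ be a bounded Lipschitz domain in $\mathbb{R}^n$, $\Omega_e:=\mathbb{R}^n\setminus\overline\Omega$, and let $A\in C^s_c(\mathbb{R}^n\times\mathbb{R}^n,\mathbb{R}^n)$ satisfy $$A_{s\|}\in H^s(\mathbb{R}^{2n}),\qquad A_{a\|}(x,y)\cdot(y-x)\ge0\ \text{ in }\mathbb{R}^n\times\mathbb{R}^n,$$ and $$(\nabla\cdot)^sA_{s\|}+\int_{\mathbb{R}^n}|A(x,y)|^2\,dy\ge0\quad\text{for }x\in\Omega.$$ Suppose $u\in H^s(\Omega)$ is a weak solution of $$(-\Delta)^s_Au=F\ \text{ in }\Omega,\qquad u=g\ \text{ in }\Omega_e.$$ If $0\le F\in L^\infty(\Omega)$ and $0\le g\in L^\infty(\Omega_e)$, then $u\ge0$ in $\Omega$, hence in $\mathbb{R}^n$.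
   Context: All functions are real valued. $C^s_c$: Hölder functions of exponent $s$ with compact support. $H^s(\mathbb{R}^n)$ is the $L^2$-based Sobolev space, $H^s(\Omega)=\{w|_\Omega: w\in H^s(\mathbb{R}^n)\}$, and $H^s_0(\Omega)$ is the closure of $C_c^\infty(\Omega)$ in $H^s(\Omega)$. Parts of $A$: $A_s(x,y)=\frac{A(x,y)+A(y,x)}2$, $A_a(x,y)=\frac{A(x,y)-A(y,x)}2$; $A_{\|}(x,y)=\frac{A(x,y)\cdot(x-y)}{|x-y|^2}(x-y)$ if $x\ne y$ and $A_{\|}(x,x)=A(x,x)$; $A_{s\|}=(A_s)_{\|}$, $A_{a\|}=(A_a)_{\|}$. Operators: $C_{n,s}>0$ is the standard constant in $(-\Delta)^su(x)=C_{n,s}\,\mathrm{p.v.}\int_{\mathbb{R}^n}\frac{u(x)-u(y)}{|x-y|^{n+2s}}dy$. The fractional gradient $\nabla^s:H^s(\mathbb{R}^n)\to L^2(\mathbb{R}^{2n})$ extends the formula $\nabla^su(x,y)=\sqrt{\frac{C_{n,s}}2}\,\frac{u(x)-u(y)}{|y-x|^{n/2+s+1}}(y-x)$. The fractional divergence $(\nabla\cdot)^s:L^2(\mathbb{R}^{2n})\to H^{-s}(\mathbb{R}^n)$ is its adjoint: $\langle(\nabla\cdot)^sw,v\rangle=\langle w,\nabla^sv\rangle$ for $v\in H^s(\mathbb{R}^n)$. The magnetic fractional gradient is $\nabla^s_Au(x,y)=\nabla^su(x,y)+A(x,y)u(x)$, and $(-\Delta)^s_A:H^s(\mathbb{R}^n)\to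 H^{-s}(\mathbb{R}^n)$ is defined by $\langle(-\Delta)^s_Au,v\rangle=\langle\nabla^s_Au,\nabla^s_Av\rangle=\int_{\mathbb{R}^n}\int_{\mathbb{R}^n}\nabla^s_Au\cdot\nabla^s_Av\,dy\,dx$. Weak solution: $u$ is regarded as a function on $\mathbb{R}^n$ with $u|_\Omega\in H^s(\Omega)$ and $u=g$ in $\Omega_e$, and $\langle\nabla^s_Au,\nabla^s_A\phi\rangle=\int_\Omega F\phi\,dx$ for all $\phi\in H^s_0(\Omega)$ (with $\phi$ taken to be zero outside $\Omega$), where the pairing is the double integral above with $\nabla^s_Au$ given by the displayed formula. *)

theory Defs
  imports "HOL-Analysis.Analysis"
begin

section \<open>Function spaces\<close>

text \<open>Hoelder continuous functions of exponent \<open>s\<close> with compact support.\<close>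

definition Holder_c :: "real \<Rightarrow> ('a::euclidean_space \<Rightarrow> 'b::euclidean_space) set" where
  "Holder_c s = {f. (\<exists>C. \<forall>p q. norm (f p - f q) \<le> C * norm (p - q) powr s)
                  \<and> compact (closure {p. f p \<noteq> 0})}"

fun C_k :: "nat \<Rightarrow> ('a::euclidean_space \<Rightarrow> real) \<Rightarrow> bool" where
  "C_k 0 f \<longleftrightarrow> continuous_on UNIV f"
| "C_k (Suc k) f \<longleftrightarrow> (\<forall>x. f differentiable (at x))
     \<and> (\<forall>b\<in>Basis. C_k k (\<lambda>x. frechet_derivative f (at x) b))"

definition test_functions :: "'a::euclidean_space set \<Rightarrow> ('a \<Rightarrow> real) set" where
  "test_functions \<Omega> = {\<phi>. (\<forall>k. C_k k \<phi>) \<and> compact (closure {x. \<phi> x \<noteq> 0})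
                        \<and> closure {x. \<phi> x \<noteq> 0} \<subseteq> \<Omega>}"

text \<open>
  For \<open>0 < s < 1\<close> the \<open>L\<^sup>2\<close>-based Sobolev space \<open>H\<^sup>s\<close> of the whole space is taken in its
  Gagliardo--Slobodeckij form. Elements are honest functions; all notions below depend only on
  their classes modulo Lebesgue null sets.
\<close>

definition gagliardo :: "real \<Rightarrow> ('a::euclidean_space \<Rightarrow> 'b::euclidean_space) \<Rightarrow> 'a \<times> 'a \<Rightarrow> real" where
  "gagliardo s f = (\<lambda>(x, y). (norm (f x - f y))\<^sup>2 / norm (x - y) powr (real DIM('a) + 2 * s))"

definition Hs :: "real \<Rightarrow> ('a::euclidean_space \<Rightarrow> 'b::euclidean_space) set" where
  "Hs s = {f \<in> borel_measurable lebesgue.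
             integrable lebesgue (\<lambda>x. (norm (f x))\<^sup>2) \<and> integrable lebesgue (gagliardo s f)}"

definition Hs_norm :: "real \<Rightarrow> ('a::euclidean_space \<Rightarrow> 'b::euclidean_space) \<Rightarrow> real" where
  "Hs_norm s f = sqrt (integral\<^sup>L lebesgue (\<lambda>x. (norm (f x))\<^sup>2) + integral\<^sup>L lebesgue (gagliardo s f))"

text \<open>
  \<open>H\<^sup>s(\<Omega>)\<close> consists of restrictions, with the quotient norm. A function on \<open>\<Omega>\<close> is represented
  by a function on the whole space whose values outside \<open>\<Omega>\<close> are irrelevant.
\<close>

definition Hs_extensions :: "real \<Rightarrow> 'a::euclidean_space set \<Rightarrow> ('a \<Rightarrow> real) \<Rightarrow> ('a \<Rightarrow> real) set" where
  "Hs_extensions s \<Omega> w = {W \<in> Hs s. AE x in lebesgue. x \<in> \<Omega> \<longrightarrow> W x = w x}"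

definition Hs_on :: "real \<Rightarrow> 'a::euclidean_space set \<Rightarrow> ('a \<Rightarrow> real) set" where
  "Hs_on s \<Omega> = {w. Hs_extensions s \<Omega> w \<noteq> {}}"

definition Hs_on_norm :: "real \<Rightarrow> 'a::euclidean_space set \<Rightarrow> ('a \<Rightarrow> real) \<Rightarrow> real" where
  "Hs_on_norm s \<Omega> w = (INF W \<in> Hs_extensions s \<Omega> w. Hs_norm s W)"

definition Hs0_on :: "real \<Rightarrow> 'a::euclidean_space set \<Rightarrow> ('a \<Rightarrow> real) set" where
  "Hs0_on s \<Omega> = {w \<in> Hs_on s \<Omega>.
     \<forall>\<epsilon>>0. \<exists>\<psi> \<in> test_functions \<Omega>. Hs_on_norm s \<Omega> (\<lambda>x. w x - \<psi> x) < \<epsilon>}"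

definition Linfty_on :: "'a::euclidean_space set \<Rightarrow> ('a \<Rightarrow> real) set" where
  "Linfty_on S = {f \<in> borel_measurable (lebesgue_on S). \<exists>C. AE x in lebesgue_on S. \<bar>f x\<bar> \<le> C}"

section \<open>Lipschitz domains\<close>

text \<open>
  Near each boundary point, \<open>\<Omega>\<close> is the strict epigraph of a Lipschitz function in some
  direction \<open>\<nu>\<close>. The function \<open>\<gamma>\<close> is evaluated only at points of the hyperplane orthogonal
  to \<open>\<nu>\<close>, so asking for it to be Lipschitz on the whole space is no restriction.
\<close>

definition bounded_Lipschitz_domain :: "'a::euclidean_space set \<Rightarrow> bool" where
  "bounded_Lipschitz_domain \<Omega> \<longleftrightarrow> open \<Omega> \<and> connected \<Omega> \<and> \<Omega> \<noteq> {} \<and> bounded \<Omega> \<and>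
     (\<forall>p \<in> frontier \<Omega>. \<exists>r \<nu> \<gamma> L. 0 < r \<and> norm \<nu> = 1 \<and> L-lipschitz_on UNIV (\<gamma> :: 'a \<Rightarrow> real) \<and>
        \<Omega> \<inter> ball p r = {x \<in> ball p r. \<gamma> (x - (x \<bullet> \<nu>) *\<^sub>R \<nu>) < x \<bullet> \<nu>})"

definition exterior :: "'a::euclidean_space set \<Rightarrow> 'a set" where
  "exterior \<Omega> = - closure \<Omega>"

section \<open>Parts of a vector potential\<close>

definition sym_part :: "('a \<times> 'a \<Rightarrow> 'a::euclidean_space) \<Rightarrow> 'a \<times> 'a \<Rightarrow> 'a" where
  "sym_part A = (\<lambda>(x, y). (1 / 2) *\<^sub>R (A (x, y) + A (y, x)))"

definition antisym_part :: "('a \<times> 'a \<Rightarrow> 'a::euclidean_space) \<Rightarrow> 'a \<times> 'a \<Rightarrow> 'a" where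
  "antisym_part A = (\<lambda>(x, y). (1 / 2) *\<^sub>R (A (x, y) - A (y, x)))"

definition par_part :: "('a \<times> 'a \<Rightarrow> 'a::euclidean_space) \<Rightarrow> 'a \<times> 'a \<Rightarrow> 'a" where
  "par_part A = (\<lambda>(x, y). if x = y then A (x, x)
                  else ((A (x, y) \<bullet> (x - y)) / (norm (x - y))\<^sup>2) *\<^sub>R (x - y))"

section \<open>Fractional operators\<close>

text \<open>
  The normalising constant for which the singular integral representation of \<open>(-\<Delta>)\<^sup>s\<close> in
  dimension \<open>n\<close> has Fourier symbol \<open>\<bar>\<xi>\<bar>\<close> to the power \<open>2s\<close>.
\<close>

definition frac_const :: "nat \<Rightarrow> real \<Rightarrow> real" where
  "frac_const n s = 4 powr s * Gamma (real n / 2 + s) / (pi powr (real n / 2) * \<bar>Gamma (- s)\<bar>)"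

definition frac_grad :: "real \<Rightarrow> ('a::euclidean_space \<Rightarrow> real) \<Rightarrow> 'a \<times> 'a \<Rightarrow> 'a" where
  "frac_grad s u = (\<lambda>(x, y). (sqrt (frac_const DIM('a) s / 2) * (u x - u y)
                      / norm (y - x) powr (real DIM('a) / 2 + s + 1)) *\<^sub>R (y - x))"

text \<open>
  The fractional divergence of an \<open>L\<^sup>2\<close> field is an element of the dual of \<open>H\<^sup>s\<close>, i.e. a
  functional on \<open>H\<^sup>s\<close>, and not a function.
\<close>

definition frac_div :: "real \<Rightarrow> ('a \<times> 'a \<Rightarrow> 'a::euclidean_space) \<Rightarrow> ('a \<Rightarrow> real) \<Rightarrow> real" where
  "frac_div s w v = integral\<^sup>L lebesgue (\<lambda>p. w p \<bullet> frac_grad s v p)"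

text \<open>
  Nonnegativity on \<open>\<Omega>\<close> of a distribution (for instance an element of the dual of \<open>H\<^sup>s\<close>), and
  the distribution given by a locally integrable function.
\<close>

definition nonneg_distr_on :: "'a::euclidean_space set \<Rightarrow> (('a \<Rightarrow> real) \<Rightarrow> real) \<Rightarrow> bool" where
  "nonneg_distr_on \<Omega> T \<longleftrightarrow> (\<forall>\<phi> \<in> test_functions \<Omega>. (\<forall>x. 0 \<le> \<phi> x) \<longrightarrow> 0 \<le> T \<phi>)"

definition fun_distr :: "('a::euclidean_space \<Rightarrow> real) \<Rightarrow> ('a \<Rightarrow> real) \<Rightarrow> real" where
  "fun_distr f \<phi> = integral\<^sup>L lebesgue (\<lambda>x. f x * \<phi> x)"

definition mag_grad ::
  "real \<Rightarrow> ('a \<times> 'a \<Rightarrow> 'a) \<Rightarrow> ('a::euclidean_space \<Rightarrow> real) \<Rightarrow> 'a \<times> 'a \<Rightarrow> 'a" where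
  "mag_grad s A u = (\<lambda>(x, y). frac_grad s u (x, y) + u x *\<^sub>R A (x, y))"

text \<open>
  The functional \<open>(-\<Delta>)\<^sup>s\<^sub>A u\<close>, given by the bilinear pairing of magnetic gradients.
\<close>

definition mag_laplacian ::
  "real \<Rightarrow> ('a \<times> 'a \<Rightarrow> 'a) \<Rightarrow> ('a::euclidean_space \<Rightarrow> real) \<Rightarrow> ('a \<Rightarrow> real) \<Rightarrow> real" where
  "mag_laplacian s A u v = integral\<^sup>L lebesgue (\<lambda>p. mag_grad s A u p \<bullet> mag_grad s A v p)"

text \<open>
  Weak solutions of \<open>(-\<Delta>)\<^sup>s\<^sub>A u = F\<close> in \<open>\<Omega>\<close>, \<open>u = g\<close> in the exterior. The exterior datum is
  merely bounded, so \<open>mag_grad s A u\<close> need not be square integrable; that the pairing with each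
  test function makes sense as a (Lebesgue) double integral is part of being a weak solution.
\<close>

definition weak_solution ::
  "real \<Rightarrow> 'a::euclidean_space set \<Rightarrow> ('a \<times> 'a \<Rightarrow> 'a) \<Rightarrow> ('a \<Rightarrow> real) \<Rightarrow> ('a \<Rightarrow> real) \<Rightarrow> ('a \<Rightarrow> real) \<Rightarrow> bool"
where
  "weak_solution s \<Omega> A F g u \<longleftrightarrow>
     u \<in> Hs_on s \<Omega> \<and> (AE x in lebesgue. x \<in> exterior \<Omega> \<longrightarrow> u x = g x) \<and>
     (\<forall>\<phi> \<in> Hs0_on s \<Omega>.
        let \<phi>0 = (\<lambda>x. if x \<in> \<Omega> then \<phi> x else 0)
        in integrable lebesgue (\<lambda>p. mag_grad s A u p \<bullet> mag_grad s A \<phi>0 p) \<and>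
           mag_laplacian s A u \<phi>0 = (LINT x:\<Omega>|lebesgue. F x * \<phi> x))"

end

theory Submission imports Defs begin

text \<open>
  Let \<open>a\<close> be the negative part of \<open>u\<close> in \<open>\<Omega>\<close>, extended by zero, let \<open>\<eta>\<close> be a cutoff vanishing near
  the boundary, and test the equation with \<open>a \<eta>\<^sup>2\<close>, which is admissible because it has compact
  support in \<open>\<Omega>\<close>. Symmetrising the pairing under the swap of \<open>x\<close> and \<open>y\<close> splits it into three
  parts. The antisymmetric part of \<open>A\<close> only enlarges the positive kernel \<open>k\<close> of the Dirichlet form;
  the symmetric part pairs its divergence with \<open>u a \<eta>\<^sup>2 = - (a \<eta>)\<^sup>2\<close> and, together with
  the potential, has a sign. What remains is
  \<open>\<integral>\<integral> k (a(x) - a(y)) (a(x) \<eta>(x)\<^sup>2 - a(y) \<eta>(y)\<^sup>2) \<le> 0\<close>.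

  For \<open>s \<ge> 1/2\<close> the cutoff cannot simply be dropped, since \<open>a\<close> might a priori have a nonzero trace.
  The interaction of \<open>\<Omega>\<close> with its complement contributes at least a multiple of
  \<open>\<integral> (a \<eta>)\<^sup>2 d\<^sup>-\<^sup>2\<^sup>s\<close>, where \<open>d\<close> is the distance to the boundary (exterior balls exist at every
  scale); the remaining part is at most of the order of its square root, so
  \<open>a\<^sup>2 d\<^sup>-\<^sup>2\<^sup>s\<close> is integrable. This furnishes a dominating function for the error terms
  caused by \<open>\<eta>\<close>, which therefore vanish as \<open>\<eta>\<close> tends to one, and \<open>a = 0\<close> follows.
\<close>

section \<open>Geometry of Lipschitz domains\<close>

text \<open>Three obstacles shape the details. The sign condition on the divergence can only be
  tested with smooth functions, while \<open>(a \<eta>)^2\<close> need not lie in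
  \<open>H^s\<close>. Therefore \<open>a \<eta>\<close> itself is mollified and the square of the
  smooth approximation is tested; the resulting quadratic form is continuous in the
  \<open>H^s\<close> norm, so the sign survives the limit. Secondly, the terms containing the
  positive part of \<open>u\<close> are not integrated on their own: the symmetrised pairing is
  bounded almost everywhere by a single integrable function that no longer contains
  \<open>u\<close>. Thirdly, the energy inequality is used twice. Young's inequality with a large
  weight first bounds the weighted norm of \<open>w = a \<eta>\<close> uniformly; there the
  increments of \<eta> must come with the factor \<open>w\<close>, since the weighted norm of
  \<open>a\<close> is not yet known to be finite. Afterwards the exact identity \<open>(a(x) - a(y))
  (a(x) \<eta>(x)^2 - a(y) \<eta>(y)^2) = (w(x) - w(y))^2 - a(x) a(y) (\<eta>(x) -
  \<eta>(y))^2\<close> leaves just one error term, and this one tends to zero.\<close>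

lemma bounded_Lipschitz_domain_exterior_balls:
  fixes \<Omega> :: "'a::euclidean_space set"
  assumes "bounded_Lipschitz_domain \<Omega>"
  obtains \<rho> \<theta> where "0 < \<rho>" "0 < \<theta>" "\<theta> < 1"
    "\<And>p t. p \<in> frontier \<Omega> \<Longrightarrow> 0 < t \<Longrightarrow> t \<le> \<rho> \<Longrightarrow> \<exists>q. ball q (\<theta> * t) \<subseteq> ball p t - \<Omega>"
proof -
  have op: "open \<Omega>" and bd: "bounded \<Omega>"
    and loc: "\<And>p. p \<in> frontier \<Omega> \<Longrightarrow> \<exists>r \<nu> \<gamma> L. 0 < r \<and> norm \<nu> = 1 \<and> L-lipschitz_on UNIV (\<gamma> :: 'a \<Rightarrow> real) \<and>
        \<Omega> \<inter> ball p r = {x \<in> ball p r. \<gamma> (x - (x \<bullet> \<nu>) *\<^sub>R \<nu>) < x \<bullet> \<nu>}"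
    using assms by (auto simp: bounded_Lipschitz_domain_def)
  have local: "\<exists>r \<theta>. 0 < r \<and> 0 < \<theta> \<and> \<theta> < 1 \<and> (\<forall>p \<in> frontier \<Omega> \<inter> ball p0 r. \<forall>t. 0 < t \<longrightarrow> t \<le> r \<longrightarrow>
      (\<exists>q. ball q (\<theta> * t) \<subseteq> ball p t - \<Omega>))" if p0: "p0 \<in> frontier \<Omega>" for p0
  proof -
    obtain r \<nu> \<gamma> L where r: "0 < r" and \<nu>: "norm \<nu> = 1" and L: "L-lipschitz_on UNIV (\<gamma> :: 'a \<Rightarrow> real)"
      and eq: "\<Omega> \<inter> ball p0 r = {x \<in> ball p0 r. \<gamma> (x - (x \<bullet> \<nu>) *\<^sub>R \<nu>) < x \<bullet> \<nu>}"
      using loc[OF p0] by blast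
    have eq1: "x \<in> \<Omega> \<longleftrightarrow> \<gamma> (x - (x \<bullet> \<nu>) *\<^sub>R \<nu>) < x \<bullet> \<nu>" if "x \<in> ball p0 r" for x
      using that eq by blast
    have L0: "0 \<le> L" using L by (rule lipschitz_on_nonneg)
    \<comment> \<open>Over the ball of radius \<open>\<theta> t\<close> the graph drops by at most
      \<open>L \<theta> t\<close>, while the height exceeds that of the centre by at most
      \<open>\<theta> t\<close>. Moving the centre down by \<open>t/2\<close> pays for both exactly
      when \<open>\<theta> (1 + L) = 1/2\<close>.\<close>
    define \<theta> where "\<theta> = 1 / (2 * (1 + L))"
    have \<theta>: "0 < \<theta>" "\<theta> \<le> 1 / 2" "\<theta> * (1 + L) = 1 / 2" using L0 by (auto simp: \<theta>_def field_simps)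
    \<comment> \<open>Halving the radius keeps \<open>ball p t\<close> inside
      \<open>ball p0 r\<close>, where the graph description is valid.\<close>
    have "\<exists>q. ball q (\<theta> * t) \<subseteq> ball p t - \<Omega>"
      if p: "p \<in> frontier \<Omega>" "p \<in> ball p0 (r / 2)" and t: "0 < t" "t \<le> r / 2" for p t
    proof -
      have "p \<notin> \<Omega>" using p(1) op by (simp add: frontier_def interior_open)
      moreover have "p \<in> ball p0 r" using p(2) r by auto
      ultimately have g: "p \<bullet> \<nu> \<le> \<gamma> (p - (p \<bullet> \<nu>) *\<^sub>R \<nu>)" using eq1[of p] by simp
      have "ball (p - (t / 2) *\<^sub>R \<nu>) (\<theta> * t) \<subseteq> ball p t - \<Omega>"
      proof
        fix y assume y: "y \<in> ball (p - (t / 2) *\<^sub>R \<nu>) (\<theta> * t)"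
        define z where "z = y - (p - (t / 2) *\<^sub>R \<nu>)"
        have z: "norm z < \<theta> * t" using y by (simp add: z_def dist_norm norm_minus_commute)
        have yz: "y = p - (t / 2) *\<^sub>R \<nu> + z" by (simp add: z_def)
        have "dist p y \<le> norm ((t / 2) *\<^sub>R \<nu>) + norm z"
          unfolding yz dist_norm using norm_triangle_ineq4[of "(t / 2) *\<^sub>R \<nu>" z] by (simp add: algebra_simps)
        also have "\<dots> < t / 2 + \<theta> * t" using z \<nu> t by simp
        also have "\<dots> \<le> t" using t mult_right_mono[OF \<theta>(2), of t] by linarith
        finally have pt: "y \<in> ball p t" by simp
        then have yr: "y \<in> ball p0 r" using p(2) t dist_triangle[of p0 y p] by auto
        have nn: "\<nu> \<bullet> \<nu> = 1" using \<nu> by (simp add: norm_eq_1)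
        have yn: "y \<bullet> \<nu> = p \<bullet> \<nu> - t / 2 + z \<bullet> \<nu>" by (simp add: yz inner_simps nn)
        have proj: "y - (y \<bullet> \<nu>) *\<^sub>R \<nu> - (p - (p \<bullet> \<nu>) *\<^sub>R \<nu>) = z - (z \<bullet> \<nu>) *\<^sub>R \<nu>"
          unfolding yn unfolding yz by (simp add: algebra_simps)
        have "(norm (z - (z \<bullet> \<nu>) *\<^sub>R \<nu>))\<^sup>2 = (norm z)\<^sup>2 - (z \<bullet> \<nu>)\<^sup>2"
          unfolding power2_norm_eq_inner by (simp add: inner_simps nn inner_commute power2_eq_square algebra_simps)
        then have nz: "norm (z - (z \<bullet> \<nu>) *\<^sub>R \<nu>) \<le> norm z"
          using zero_le_power2[of "z \<bullet> \<nu>"] power2_le_imp_le[of "norm (z - (z \<bullet> \<nu>) *\<^sub>R \<nu>)" "norm z"] by simp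
        have "\<bar>\<gamma> (y - (y \<bullet> \<nu>) *\<^sub>R \<nu>) - \<gamma> (p - (p \<bullet> \<nu>) *\<^sub>R \<nu>)\<bar> \<le> L * norm (z - (z \<bullet> \<nu>) *\<^sub>R \<nu>)"
          using lipschitz_onD[OF L, of "y - (y \<bullet> \<nu>) *\<^sub>R \<nu>" "p - (p \<bullet> \<nu>) *\<^sub>R \<nu>"]
          by (simp add: dist_norm proj)
        also have "\<dots> \<le> L * (\<theta> * t)" using nz z L0 by (intro mult_left_mono) auto
        finally have "\<gamma> (y - (y \<bullet> \<nu>) *\<^sub>R \<nu>) \<ge> p \<bullet> \<nu> - L * (\<theta> * t)" using g by linarith
        moreover have "z \<bullet> \<nu> \<le> \<theta> * t" using Cauchy_Schwarz_ineq2[of z \<nu>] \<nu> z by simp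
        moreover have "t / 2 = \<theta> * t + L * (\<theta> * t)"
        proof -
          have "t / 2 = t * (\<theta> * (1 + L))" by (simp add: \<theta>(3))
          then show ?thesis by (simp add: algebra_simps)
        qed
        ultimately have "\<not> \<gamma> (y - (y \<bullet> \<nu>) *\<^sub>R \<nu>) < y \<bullet> \<nu>" using yn by linarith
        then show "y \<in> ball p t - \<Omega>" using eq1[OF yr] pt by simp
      qed
      then show ?thesis ..
    qed
    then show ?thesis using r \<theta> by (intro exI[of _ "r / 2"] exI[of _ \<theta>]) auto
  qed
  then obtain R T where RT: "\<And>p0. p0 \<in> frontier \<Omega> \<Longrightarrow> 0 < R p0 \<and> 0 < T p0 \<and> T p0 < 1 \<and>
      (\<forall>p \<in> frontier \<Omega> \<inter> ball p0 (R p0). \<forall>t. 0 < t \<longrightarrow> t \<le> R p0 \<longrightarrow> (\<exists>q. ball q (T p0 * t) \<subseteq> ball p t - \<Omega>))"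
    by metis
  have cpt: "compact (frontier \<Omega>)" using bd by (rule compact_frontier_bounded)
  have cov: "frontier \<Omega> \<subseteq> (\<Union>p\<in>frontier \<Omega>. ball p (R p))"
    using RT by (meson UN_I centre_in_ball subsetI)
  obtain D where D: "D \<subseteq> frontier \<Omega>" "finite D" "frontier \<Omega> \<subseteq> (\<Union>p\<in>D. ball p (R p))"
    using compactE_image[OF cpt _ cov] by (metis open_ball)
  \<comment> \<open>The inserted values keep \<open>Min\<close> meaningful for an empty
    \<open>D\<close>; the 1/2 in \<theta> also secures \<open>\<theta> < 1\<close>.\<close>
  define \<rho> where "\<rho> = Min (insert 1 (R ` D))"
  define \<theta> where "\<theta> = Min (insert (1/2) (T ` D))"
  show ?thesis
  proof
 show "0 < \<rho>" "0 < \<theta>" using D(2) RT by (auto simp: \<rho>_def \<theta>_def dest!: subsetD[OF D(1)])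
    have "\<theta> \<le> 1/2" unfolding \<theta>_def using D by (intro Min_le) auto
    then show "\<theta> < 1" by simp
    fix p t assume p: "p \<in> frontier \<Omega>" and t: "0 < t" "t \<le> \<rho>"
    obtain p0 where p0: "p0 \<in> D" "p \<in> ball p0 (R p0)" using D p by auto
    have "\<rho> \<le> R p0" "\<theta> \<le> T p0" unfolding \<rho>_def \<theta>_def using D p0 by (auto intro!: Min_le)
    moreover obtain q where "ball q (T p0 * t) \<subseteq> ball p t - \<Omega>"
      using RT[of p0] D p0 p t \<open>\<rho> \<le> R p0\<close> by (meson IntI in_mono order_trans)
    ultimately show "\<exists>q. ball q (\<theta> * t) \<subseteq> ball p t - \<Omega>"
      using t mult_right_mono[of \<theta> "T p0" t] subset_ball[of "\<theta> * t" "T p0 * t" q] by (intro exI[of _ q]) (meson less_imp_le order_trans)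
  qed
qed

text \<open>Data are prescribed only off the closure of \<Omega>, so a sign of \<open>u\<close>
  almost everywhere outside \<Omega> requires a null frontier. Locally the frontier lies on a graph,
  that is, in the image of a hyperplane under a Lipschitz map.\<close>

lemma bounded_Lipschitz_domain_negligible_frontier:
  fixes \<Omega> :: "'a::euclidean_space set"
  assumes "bounded_Lipschitz_domain \<Omega>"
  shows "negligible (frontier \<Omega>)"
proof -
  have op: "open \<Omega>" and bd: "bounded \<Omega>"
    and loc: "\<And>p. p \<in> frontier \<Omega> \<Longrightarrow> \<exists>r \<nu> \<gamma> L. 0 < r \<and> norm \<nu> = 1 \<and> L-lipschitz_on UNIV (\<gamma> :: 'a \<Rightarrow> real) \<and>
        \<Omega> \<inter> ball p r = {x \<in> ball p r. \<gamma> (x - (x \<bullet> \<nu>) *\<^sub>R \<nu>) < x \<bullet> \<nu>}"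
    using assms by (auto simp: bounded_Lipschitz_domain_def)
  have local: "\<exists>r>0. negligible (frontier \<Omega> \<inter> ball p0 r)" if p0: "p0 \<in> frontier \<Omega>" for p0
  proof -
    obtain r \<nu> \<gamma> L where r: "0 < r" and \<nu>: "norm \<nu> = 1" and L: "L-lipschitz_on UNIV (\<gamma> :: 'a \<Rightarrow> real)"
      and eq: "\<Omega> \<inter> ball p0 r = {x \<in> ball p0 r. \<gamma> (x - (x \<bullet> \<nu>) *\<^sub>R \<nu>) < x \<bullet> \<nu>}"
      using loc[OF p0] by blast
    have eq1: "x \<in> \<Omega> \<longleftrightarrow> \<gamma> (x - (x \<bullet> \<nu>) *\<^sub>R \<nu>) < x \<bullet> \<nu>" if "x \<in> ball p0 r" for x
      using that eq by blast
    define f where "f x = x + \<gamma> x *\<^sub>R \<nu>" for x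
    have cont: "continuous_on UNIV \<gamma>" using L by (rule lipschitz_on_continuous_on)
    \<comment> \<open>Not lying in \<Omega> gives one inequality between height and graph, lying in
      its closure gives the other.\<close>
    have "frontier \<Omega> \<inter> ball p0 r \<subseteq> f ` {x. \<nu> \<bullet> x = 0}"
    proof
      fix p assume p: "p \<in> frontier \<Omega> \<inter> ball p0 r"
      then have "p \<notin> \<Omega>" using op by (simp add: frontier_def interior_open)
      with p eq1[of p] have le: "p \<bullet> \<nu> \<le> \<gamma> (p - (p \<bullet> \<nu>) *\<^sub>R \<nu>)" by simp
      have "p \<in> closure (\<Omega> \<inter> ball p0 r)"
        using p open_Int_closure_subset[of "ball p0 r" \<Omega>] by (auto simp: frontier_def Int_commute)
      also have "\<dots> \<subseteq> {x. \<gamma> (x - (x \<bullet> \<nu>) *\<^sub>R \<nu>) \<le> x \<bullet> \<nu>}"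
      proof (rule closure_minimal)
        show "\<Omega> \<inter> ball p0 r \<subseteq> {x. \<gamma> (x - (x \<bullet> \<nu>) *\<^sub>R \<nu>) \<le> x \<bullet> \<nu>}" using eq by auto
        show "closed {x. \<gamma> (x - (x \<bullet> \<nu>) *\<^sub>R \<nu>) \<le> x \<bullet> \<nu>}"
          by (intro closed_Collect_le continuous_intros continuous_on_compose2[OF cont]) auto
      qed
      finally have "\<gamma> (p - (p \<bullet> \<nu>) *\<^sub>R \<nu>) = p \<bullet> \<nu>" using le by simp
      then have "p = f (p - (p \<bullet> \<nu>) *\<^sub>R \<nu>)" by (simp add: f_def)
      moreover have "\<nu> \<bullet> (p - (p \<bullet> \<nu>) *\<^sub>R \<nu>) = 0" using \<nu> by (simp add: inner_simps norm_eq_1 inner_commute)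
      ultimately show "p \<in> f ` {x. \<nu> \<bullet> x = 0}" by blast
    qed
    moreover have "negligible (f ` {x. \<nu> \<bullet> x = 0})"
    proof (rule negligible_locally_Lipschitz_image)
      show "negligible {x. \<nu> \<bullet> x = 0}" using \<nu> by (intro negligible_hyperplane) auto
      fix x assume "x \<in> {x. \<nu> \<bullet> x = 0}"
      have "norm (f y - f x) \<le> (1 + L) * norm (y - x)" for y
      proof -
        have "f y - f x = (y - x) + (\<gamma> y - \<gamma> x) *\<^sub>R \<nu>" by (simp add: f_def algebra_simps)
        also have "norm \<dots> \<le> norm (y - x) + \<bar>\<gamma> y - \<gamma> x\<bar>"
          using norm_triangle_ineq[of "y - x" "(\<gamma> y - \<gamma> x) *\<^sub>R \<nu>"] \<nu> by simp
        also have "\<bar>\<gamma> y - \<gamma> x\<bar> \<le> L * norm (y - x)"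
          using lipschitz_onD[OF L, of y x] by (simp add: dist_norm)
        finally show ?thesis by (simp add: algebra_simps)
      qed
      then show "\<exists>T B. open T \<and> x \<in> T \<and> (\<forall>y\<in>{x. \<nu> \<bullet> x = 0} \<inter> T. norm (f y - f x) \<le> B * norm (y - x))"
        by (intro exI[of _ UNIV] exI[of _ "1 + L"]) auto
    qed simp
    ultimately show ?thesis using r negligible_subset by blast
  qed
  show ?thesis
    unfolding locally_negligible_alt[of "frontier \<Omega>"]
  proof
    fix p assume p: "p \<in> frontier \<Omega>"
    then obtain r where "0 < r" "negligible (frontier \<Omega> \<inter> ball p r)" using local by blast
    with p show "\<exists>U. openin (top_of_set (frontier \<Omega>)) U \<and> p \<in> U \<and> negligible U"
      by (intro exI[of _ "frontier \<Omega> \<inter> ball p r"]) auto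
  qed
qed

section \<open>Integrals of truncated kernels\<close>

lemma nn_integral_lborel_affine:
  fixes f :: "'a::euclidean_space \<Rightarrow> ennreal"
  assumes [measurable]: "f \<in> borel_measurable borel" and c: "c \<noteq> 0"
  shows "(\<integral>\<^sup>+x. f x \<partial>lborel) = ennreal (\<bar>c\<bar> ^ DIM('a)) * (\<integral>\<^sup>+x. f (t + c *\<^sub>R x) \<partial>lborel)"
  by (subst lborel_affine[OF c, of t])
    (simp add: nn_integral_density nn_integral_distr nn_integral_cmult)

lemma ex_dyadic:
  assumes "(1::real) \<le> t"
  shows "\<exists>j. 2 ^ j \<le> t \<and> t < 2 ^ Suc j"
proof -
  obtain k where "t < 2 ^ k" using real_arch_pow[of 2 t] by auto
  define k where "k = (LEAST k. t < 2 ^ k)"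
  have 1: "t < 2 ^ k" unfolding k_def by (rule LeastI) fact
  with assms obtain j where j: "k = Suc j" by (cases k) auto
  have "\<not> t < 2 ^ j" using not_less_Least[of j "\<lambda>k. t < 2 ^ k"] j by (simp add: k_def)
  with 1 j show ?thesis by (intro exI[of _ j]) auto
qed

text \<open>Dyadic shells reduce the integral to two geometric series with ratios
  \<open>2 powr (n - p)\<close> (large \<open>z\<close>) and \<open>2 powr (p - n - 2)\<close>
  (small \<open>z\<close>). The two bounds on \<open>p\<close> say exactly that both ratios are
  below 1.\<close>

lemma nn_integral_truncated_kernel_finite:
  fixes p :: real
  assumes p: "real DIM('a) < p" "p < real DIM('a) + 2"
  shows "(\<integral>\<^sup>+z. ennreal (min 1 ((norm z)\<^sup>2) / norm z powr p) \<partial>(lborel :: 'a::euclidean_space measure)) < \<infinity>"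
proof -
  define n where "n = real DIM('a)"
  define V where "V = unit_ball_vol n"
  have V: "V \<ge> 0" by (simp add: V_def n_def)
  have eball: "emeasure lborel (ball (0::'a) r) = ennreal (V * r powr n)" if "r > 0" for r
    using that by (simp add: emeasure_ball V_def n_def powr_realpow)
  have [measurable]: "ball (0::'a) r \<in> sets borel" for r by simp
  \<comment> \<open>\<open>A j\<close> serves the shell from \<open>2^j\<close> to
    \<open>2^(j+1)\<close>, \<open>B j\<close> the shell from \<open>2^-(j+1)\<close> to
    \<open>2^-j\<close>. Each takes the extreme values of numerator and denominator on its shell and
    replaces the shell by an open ball containing it.\<close>
  define A where "A j z = (2 powr (- p * real j)) * indicator (ball 0 (2 powr (real j + 1))) z" for j and z :: 'a
  define B where "B j z = (2 powr (p * (real j + 1) - 2 * real j)) * indicator (ball 0 (2 powr (1 - real j))) z" for j and z :: 'a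
  have A0: "0 \<le> A j z" and B0: "0 \<le> B j z" for j z by (auto simp: A_def B_def)
  have pt: "ennreal (min 1 ((norm z)\<^sup>2) / norm z powr p) \<le> (\<Sum>j. ennreal (A j z + B j z))" for z :: 'a
  proof -
    have "\<exists>j. min 1 ((norm z)\<^sup>2) / norm z powr p \<le> A j z + B j z"
    proof (cases "norm z \<ge> 1")
      case True
      from ex_dyadic[OF this] obtain j where j: "2 ^ j \<le> norm z" "norm z < 2 ^ Suc j" by auto
      have "min 1 ((norm z)\<^sup>2) / norm z powr p \<le> 1 / norm z powr p"
        by (intro divide_right_mono) auto
      also have "\<dots> \<le> 1 / (2 powr real j) powr p"
        using j(1) p True by (intro divide_left_mono powr_mono2) (auto simp: powr_realpow intro!: mult_pos_pos)
      also have "\<dots> = 2 powr (- p * real j)" by (simp add: powr_powr powr_minus_divide mult.commute)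
      also have "\<dots> = A j z"
        using j(2) by (simp add: A_def powr_add powr_realpow)
      finally show ?thesis using B0[of j z] by (intro exI[of _ j]) linarith
    next
      case False
      show ?thesis
      proof (cases "z = 0")
        case True
        then show ?thesis using A0 B0 by (intro exI[of _ 0]) (simp add: add_nonneg_nonneg)
      next
        case nz: False
        with False have "1 \<le> 1 / norm z" by simp
        from ex_dyadic[OF this] obtain j where j: "2 ^ j \<le> 1 / norm z" "1 / norm z < 2 ^ Suc j" by auto
        have "2 powr (- real j) = 1 / 2 ^ j" "2 powr (- (real j + 1)) = 1 / 2 ^ Suc j"
          by (auto simp: powr_minus_divide powr_realpow powr_add powr_diff)
        then have j1: "norm z \<le> 2 powr (- real j)" and j2: "2 powr (- (real j + 1)) < norm z"
          using j nz by (simp_all only:) (auto simp: field_simps)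
        have "min 1 ((norm z)\<^sup>2) / norm z powr p \<le> (norm z)\<^sup>2 / norm z powr p"
          by (intro divide_right_mono) auto
        also have "\<dots> \<le> (2 powr (- real j))\<^sup>2 / (2 powr (- (real j + 1))) powr p"
          using j1 j2 p by (intro frac_le powr_mono2 power_mono) auto
        also have "\<dots> = 2 powr (p * (real j + 1) - 2 * real j)"
        proof -
          have "(2 powr (- real j))\<^sup>2 = 2 powr (- 2 * real j)"
            by (simp add: power2_eq_square flip: powr_add)
          moreover have "1 / (2 powr (- (real j + 1))) powr p = 2 powr (p * (real j + 1))"
            by (simp add: powr_powr algebra_simps flip: powr_minus_divide)
          ultimately have "(2 powr (- real j))\<^sup>2 / (2 powr (- (real j + 1))) powr p = 2 powr (- 2 * real j) * 2 powr (p * (real j + 1))"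
            by (metis divide_inverse_commute inverse_eq_divide mult.commute)
          then show ?thesis by (simp add: algebra_simps flip: powr_add)
        qed
        also have "\<dots> = B j z"
        proof -
          have "norm z < 2 powr (1 - real j)"
            by (rule le_less_trans[OF j1]) (auto intro: powr_less_mono)
          then show ?thesis by (simp add: B_def)
        qed
        finally show ?thesis using A0[of j z] by (intro exI[of _ j]) linarith
      qed
    qed
    then obtain j where "min 1 ((norm z)\<^sup>2) / norm z powr p \<le> A j z + B j z" ..
    then have "ennreal (min 1 ((norm z)\<^sup>2) / norm z powr p) \<le> ennreal (A j z + B j z)"
      by (rule ennreal_leI)
    also have "\<dots> \<le> (\<Sum>j. ennreal (A j z + B j z))"
      using sum_le_suminf[of "\<lambda>j. ennreal (A j z + B j z)" "{j}"] by simp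
    finally show ?thesis .
  qed
  define a where "a j = V * 2 powr n * (2 powr (n - p)) ^ j" for j :: nat
  define b where "b j = V * 2 powr (n + p) * (2 powr (p - n - 2)) ^ j" for j :: nat
  have two_balls: "(\<integral>\<^sup>+z. ennreal c1 * indicator (ball 0 r1) z + ennreal c2 * indicator (ball 0 r2) z \<partial>(lborel::'a measure))
      = ennreal (c1 * (V * r1 powr n) + c2 * (V * r2 powr n))" if "0 \<le> c1" "0 \<le> c2" "0 < r1" "0 < r2" for c1 c2 r1 r2
    using that V by (subst nn_integral_add) (simp_all add: nn_integral_cmult_indicator eball ennreal_mult ennreal_plus)
  have int: "(\<integral>\<^sup>+z. ennreal (A j z + B j z) \<partial>lborel) = ennreal (a j + b j)" for j
  proof -
    have "(\<integral>\<^sup>+z. ennreal (A j z + B j z) \<partial>lborel) = (\<integral>\<^sup>+z. ennreal (2 powr (- p * real j)) * indicator (ball 0 (2 powr (real j + 1))) z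
        + ennreal (2 powr (p * (real j + 1) - 2 * real j)) * indicator (ball 0 (2 powr (1 - real j))) z \<partial>(lborel::'a measure))"
      by (intro nn_integral_cong) (auto simp: A_def B_def indicator_def)
    also have "\<dots> = ennreal (2 powr (- p * real j) * (V * (2 powr (real j + 1)) powr n)
        + 2 powr (p * (real j + 1) - 2 * real j) * (V * (2 powr (1 - real j)) powr n))"
      by (rule two_balls) auto
    also have "2 powr (- p * real j) * (V * (2 powr (real j + 1)) powr n) = a j"
    proof -
      have "2 powr (- p * real j) * (2 powr (real j + 1)) powr n = 2 powr n * 2 powr ((n-p) * real j)"
        by (simp add: powr_powr flip: powr_add) (simp add: algebra_simps)
      moreover have "2 powr ((n-p) * real j) = (2 powr (n - p)) ^ j" by (simp add: powr_power mult.commute)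
      ultimately show ?thesis by (simp only: a_def mult_ac)
    qed
    also have "2 powr (p * (real j + 1) - 2 * real j) * (V * (2 powr (1 - real j)) powr n) = b j"
    proof -
      have "2 powr (p * (real j + 1) - 2 * real j) * (2 powr (1 - real j)) powr n = 2 powr (n + p) * 2 powr ((p-n-2) * real j)"
        by (simp add: powr_powr flip: powr_add) (simp add: algebra_simps)
      moreover have "2 powr ((p-n-2) * real j) = (2 powr (p - n - 2)) ^ j" by (simp add: powr_power mult.commute)
      ultimately show ?thesis by (simp only: b_def mult_ac)
    qed
    finally show ?thesis .
  qed
  have lt1: "2 powr (n - p) < 1" "2 powr (p - n - 2) < 1"
    using p powr_less_mono[of "n - p" 0 2] powr_less_mono[of "p - n - 2" 0 2] by (auto simp: n_def)
  have "summable (\<lambda>j. a j + b j)"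
    unfolding a_def b_def using lt1 by (intro summable_add summable_mult summable_geometric) auto
  moreover have "0 \<le> a j + b j" for j using V by (auto simp: a_def b_def)
  ultimately have fin: "(\<Sum>j. ennreal (a j + b j)) < \<infinity>"
    by (simp add: suminf_ennreal2 less_top)
  have "(\<integral>\<^sup>+z. ennreal (min 1 ((norm z)\<^sup>2) / norm z powr p) \<partial>(lborel :: 'a measure))
      \<le> (\<integral>\<^sup>+z. (\<Sum>j. ennreal (A j z + B j z)) \<partial>lborel)"
    by (intro nn_integral_mono pt)
  also have "\<dots> = (\<Sum>j. (\<integral>\<^sup>+z. ennreal (A j z + B j z) \<partial>lborel))"
    by (rule nn_integral_suminf) (simp add: A_def B_def)
  also have "\<dots> < \<infinity>" using fin by (simp add: int)
  finally show ?thesis .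
qed

text \<open>The substitution \<open>y = x - r z\<close> produces \<open>r^n\<close> from the volume
  and \<open>r powr (- (n + 2 s))\<close> from the kernel. This scaling is the origin of the weight
  \<open>r powr (- 2 s)\<close> throughout.\<close>

lemma truncated_kernel_bound:
  assumes s: "0 < s" "s < 1"
  obtains J where "0 \<le> J" "\<And>r (x::'a::euclidean_space). 0 < r \<Longrightarrow>
    (\<integral>\<^sup>+y. ennreal (min 1 ((norm (x - y))\<^sup>2 / r\<^sup>2) / norm (x - y) powr (real DIM('a) + 2 * s)) \<partial>lborel)
      = ennreal (J * r powr (- 2 * s))"
proof -
  define p where "p = real DIM('a) + 2 * s"
  define I where "I = (\<integral>\<^sup>+z. ennreal (min 1 ((norm z)\<^sup>2) / norm z powr p) \<partial>(lborel :: 'a measure))"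
  have "I < \<infinity>" unfolding I_def using s by (intro nn_integral_truncated_kernel_finite) (auto simp: p_def)
  then obtain J where J: "0 \<le> J" "I = ennreal J" by (cases I) auto
  have "(\<integral>\<^sup>+y. ennreal (min 1 ((norm (x - y))\<^sup>2 / r\<^sup>2) / norm (x - y) powr p) \<partial>lborel) = ennreal (J * r powr (- 2 * s))"
    if r: "0 < r" for r and x :: 'a
  proof -
    have "(\<integral>\<^sup>+y. ennreal (min 1 ((norm (x - y))\<^sup>2 / r\<^sup>2) / norm (x - y) powr p) \<partial>lborel)
      = ennreal (r ^ DIM('a)) * (\<integral>\<^sup>+z. ennreal (min 1 ((norm (x - (x + (- r) *\<^sub>R z)))\<^sup>2 / r\<^sup>2) / norm (x - (x + (- r) *\<^sub>R z)) powr p) \<partial>lborel)"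
      using r by (subst nn_integral_lborel_affine[where c = "- r" and t = x]) auto
    also have "(\<lambda>z. ennreal (min 1 ((norm (x - (x + (- r) *\<^sub>R z)))\<^sup>2 / r\<^sup>2) / norm (x - (x + (- r) *\<^sub>R z)) powr p))
        = (\<lambda>z. ennreal (r powr - p) * ennreal (min 1 ((norm z)\<^sup>2) / norm z powr p))"
      using r by (auto simp: fun_eq_iff powr_mult powr_minus_divide power_mult_distrib simp flip: ennreal_mult)
    also have "ennreal (r ^ DIM('a)) * (\<integral>\<^sup>+z. ennreal (r powr - p) * ennreal (min 1 ((norm z)\<^sup>2) / norm z powr p) \<partial>(lborel :: 'a measure))
       = ennreal (r ^ DIM('a)) * (ennreal (r powr - p) * I)"
      unfolding I_def by (subst nn_integral_cmult) auto
    also have "\<dots> = ennreal (J * (r powr real DIM('a) * r powr - p))"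
      using r J by (simp add: powr_realpow mult_ac flip: ennreal_mult)
    also have "r powr real DIM('a) * r powr - p = r powr (- 2 * s)"
      by (simp add: p_def flip: powr_add)
    finally show ?thesis .
  qed
  then show ?thesis using that[of J] J(1) unfolding p_def by blast
qed

section \<open>Smooth mollifiers\<close>

text \<open>\<open>C_k\<close> speaks of the chosen \<open>frechet_derivative\<close>; uniqueness of
  derivatives lets any explicit one be used instead.\<close>

lemma C_k_SucI:
  assumes "\<And>x. (f has_derivative f' x) (at x)" and "\<And>b. b \<in> Basis \<Longrightarrow> C_k k (\<lambda>x. f' x b)"
  shows "C_k (Suc k) f"
proof -
  have "frechet_derivative f (at x) = f' x" for x
    using frechet_derivative_at[OF assms(1)[of x]] by simp
  then show ?thesis using assms by (auto simp: differentiable_def)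
qed

lemma C_k_SucD:
  assumes "C_k (Suc k) f"
  obtains f' where "\<And>x. (f has_derivative f' x) (at x)" "\<And>b. b \<in> Basis \<Longrightarrow> C_k k (\<lambda>x. f' x b)"
proof (rule that)
  show "(f has_derivative frechet_derivative f (at x)) (at x)" for x
    using assms frechet_derivative_works by auto
qed (use assms in auto)

lemma C_k_Suc_imp: "C_k (Suc k) f \<Longrightarrow> C_k k f"
proof (induction k arbitrary: f)
  case 0
  then show ?case by (auto simp: continuous_on_eq_continuous_at differentiable_imp_continuous_within)
next
  case (Suc k)
  from C_k_SucD[OF Suc.prems] obtain f' where f': "\<And>x. (f has_derivative f' x) (at x)"
    "\<And>b. b \<in> Basis \<Longrightarrow> C_k (Suc k) (\<lambda>x. f' x b)" by blast
  then show ?case by (intro C_k_SucI[of f f'] Suc.IH) auto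
qed

lemma C_k_add: "C_k k f \<Longrightarrow> C_k k g \<Longrightarrow> C_k k (\<lambda>x. f x + g x)"
proof (induction k arbitrary: f g)
  case 0
  then show ?case by (auto intro: continuous_intros)
next
  case (Suc k)
  from C_k_SucD[OF Suc.prems(1)] obtain f' where f': "\<And>x. (f has_derivative f' x) (at x)"
    "\<And>b. b \<in> Basis \<Longrightarrow> C_k k (\<lambda>x. f' x b)" by blast
  from C_k_SucD[OF Suc.prems(2)] obtain g' where g': "\<And>x. (g has_derivative g' x) (at x)"
    "\<And>b. b \<in> Basis \<Longrightarrow> C_k k (\<lambda>x. g' x b)" by blast
  show ?case
    by (rule C_k_SucI[of _ "\<lambda>x h. f' x h + g' x h"])
      (auto intro!: has_derivative_add f' g' Suc.IH)
qed

lemma C_k_mult: "C_k k f \<Longrightarrow> C_k k g \<Longrightarrow> C_k k (\<lambda>x. f x * g x)"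
proof (induction k arbitrary: f g)
  case 0
  then show ?case by (auto intro: continuous_intros)
next
  case (Suc k)
  from C_k_SucD[OF Suc.prems(1)] obtain f' where f': "\<And>x. (f has_derivative f' x) (at x)"
    "\<And>b. b \<in> Basis \<Longrightarrow> C_k k (\<lambda>x. f' x b)" by blast
  from C_k_SucD[OF Suc.prems(2)] obtain g' where g': "\<And>x. (g has_derivative g' x) (at x)"
    "\<And>b. b \<in> Basis \<Longrightarrow> C_k k (\<lambda>x. g' x b)" by blast
  have fk: "C_k k f" and gk: "C_k k g" using Suc.prems by (auto intro: C_k_Suc_imp simp del: C_k.simps)
  show ?case
    by (rule C_k_SucI[of _ "\<lambda>x h. f x * g' x h + f' x h * g x"])
      (auto intro!: has_derivative_mult f' g' Suc.IH C_k_add fk gk)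
qed

text \<open>An invariant for the induction on the order of smoothness: each derivative is again a
  member, so every bound proved for members holds for all their derivatives too.\<close>

definition derivative_closed :: "('a::euclidean_space \<Rightarrow> real) set \<Rightarrow> bool" where
  "derivative_closed S \<longleftrightarrow> (\<forall>f\<in>S. continuous_on UNIV f \<and> (\<exists>R. \<forall>x. R \<le> norm x \<longrightarrow> f x = 0) \<and>
     (\<exists>f'. (\<forall>x. (f has_derivative f' x) (at x)) \<and> (\<forall>b\<in>Basis. (\<lambda>x. f' x b) \<in> S)))"

lemma derivative_closed_bounded:
  fixes f :: "'a::euclidean_space \<Rightarrow> real"
  assumes "derivative_closed S" "f \<in> S"
  obtains M where "0 \<le> M" "\<And>x. \<bar>f x\<bar> \<le> M"
proof -
  obtain R where cont: "continuous_on UNIV f" and R: "\<And>x. R \<le> norm x \<Longrightarrow> f x = 0"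
    using assms unfolding derivative_closed_def by blast
  have "compact (f ` cball 0 R)"
    by (intro compact_continuous_image continuous_on_subset[OF cont]) auto
  then obtain M where M: "\<And>x. x \<in> cball 0 R \<Longrightarrow> \<bar>f x\<bar> \<le> M"
    using compact_imp_bounded[of "f ` cball 0 R"] unfolding bounded_iff by fastforce
  have "\<bar>f x\<bar> \<le> max 0 M" for x
    using M[of x] R[of x] by (cases "norm x \<le> R") (auto simp: le_max_iff_disj)
  then show ?thesis using that[of "max 0 M"] by auto
qed

text \<open>The partial derivatives are members of \<open>S\<close>, hence bounded; summing over the
  basis bounds the whole derivative uniformly in \<open>x\<close>.\<close>

lemma derivative_closed_linear_bound:
  fixes f :: "'a::euclidean_space \<Rightarrow> real"
  assumes S: "derivative_closed S" "f \<in> S"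
  obtains f' C where "0 \<le> C" "\<And>x. (f has_derivative f' x) (at x)" "\<And>b. b \<in> Basis \<Longrightarrow> (\<lambda>x. f' x b) \<in> S"
    "\<And>x h. \<bar>f' x h\<bar> \<le> C * norm h"
proof -
  obtain f' where f': "\<And>x. (f has_derivative f' x) (at x)" "\<And>b. b \<in> Basis \<Longrightarrow> (\<lambda>x. f' x b) \<in> S"
    using S unfolding derivative_closed_def by blast
  have "\<exists>M. 0 \<le> M \<and> (\<forall>x. \<bar>f' x b\<bar> \<le> M)" if "b \<in> Basis" for b
    using derivative_closed_bounded[OF S(1) f'(2)[OF that]] by metis
  then obtain M where M: "\<And>b. b \<in> Basis \<Longrightarrow> 0 \<le> M b" "\<And>b x. b \<in> Basis \<Longrightarrow> \<bar>f' x b\<bar> \<le> M b" by metis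
  have "\<bar>f' x h\<bar> \<le> (\<Sum>b\<in>Basis. M b) * norm h" for x h
  proof -
    interpret f': bounded_linear "f' x" using f'(1) by (rule has_derivative_bounded_linear)
    have "f' x h = f' x (\<Sum>b\<in>Basis. (h \<bullet> b) *\<^sub>R b)" by (simp add: euclidean_representation)
    also have "\<dots> = (\<Sum>b\<in>Basis. (h \<bullet> b) * f' x b)" by (simp add: f'.sum f'.scaleR)
    also have "\<bar>\<dots>\<bar> \<le> (\<Sum>b\<in>Basis. \<bar>h \<bullet> b\<bar> * \<bar>f' x b\<bar>)" by (rule order_trans[OF sum_abs]) (simp add: abs_mult)
    also have "\<dots> \<le> (\<Sum>b\<in>Basis. norm h * M b)"
      by (intro sum_mono mult_mono M) (auto simp: Basis_le_norm)
    finally show ?thesis by (simp add: sum_distrib_left sum_distrib_right mult.commute)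
  qed
  moreover have "0 \<le> (\<Sum>b\<in>Basis. M b)" using M by (auto intro: sum_nonneg)
  ultimately show ?thesis using that f' by blast
qed

text \<open>The partial derivatives are themselves Lipschitz, because their derivatives are bounded
  again. What matters is one constant for all base points, so that the remainder can be integrated
  against \<open>w\<close>.\<close>

lemma derivative_closed_taylor:
  fixes f :: "'a::euclidean_space \<Rightarrow> real"
  assumes S: "derivative_closed S" "f \<in> S"
    and f': "\<And>x. (f has_derivative f' x) (at x)" "\<And>b. b \<in> Basis \<Longrightarrow> (\<lambda>x. f' x b) \<in> S"
  obtains C where "0 \<le> C" "\<And>x h. \<bar>f (x + h) - f x - f' x h\<bar> \<le> C * (norm h)\<^sup>2"
proof -
  have "\<exists>C. 0 \<le> C \<and> (\<forall>x y. \<bar>f' x b - f' y b\<bar> \<le> C * norm (x - y))" if b: "b \<in> Basis" for b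
  proof -
    obtain g' C where g: "0 \<le> C" "\<And>x. ((\<lambda>x. f' x b) has_derivative g' x) (at x)" "\<And>x h. \<bar>g' x h\<bar> \<le> C * norm h"
      using derivative_closed_linear_bound[OF S(1) f'(2)[OF b]] by metis
    have "norm (f' x b - f' y b) \<le> C * norm (x - y)" for x y
    proof (rule differentiable_bound[of UNIV "\<lambda>x. f' x b" g'])
      show "((\<lambda>x. f' x b) has_derivative g' x) (at x within UNIV)" for x using g(2) by simp
      show "onorm (g' x) \<le> C" for x by (rule onorm_le) (simp add: g(3))
    qed auto
    then show ?thesis using g(1) by auto
  qed
  then obtain C where C: "\<And>b. b \<in> Basis \<Longrightarrow> 0 \<le> C b" "\<And>b x y. b \<in> Basis \<Longrightarrow> \<bar>f' x b - f' y b\<bar> \<le> C b * norm (x - y)"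
    by metis
  define K where "K = (\<Sum>b\<in>Basis. C b)"
  have K0: "0 \<le> K" unfolding K_def using C by (auto intro: sum_nonneg)
  have lin: "\<bar>f' x h - f' y h\<bar> \<le> K * norm (x - y) * norm h" for x y h
  proof -
    interpret x: bounded_linear "f' x" using f'(1) by (rule has_derivative_bounded_linear)
    interpret y: bounded_linear "f' y" using f'(1) by (rule has_derivative_bounded_linear)
    have "f' x h - f' y h = f' x (\<Sum>b\<in>Basis. (h \<bullet> b) *\<^sub>R b) - f' y (\<Sum>b\<in>Basis. (h \<bullet> b) *\<^sub>R b)"
      by (simp add: euclidean_representation)
    also have "\<dots> = (\<Sum>b\<in>Basis. (h \<bullet> b) * (f' x b - f' y b))"
      by (simp add: x.sum x.scaleR y.sum y.scaleR sum_subtractf algebra_simps)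
    also have "\<bar>\<dots>\<bar> \<le> (\<Sum>b\<in>Basis. \<bar>h \<bullet> b\<bar> * \<bar>f' x b - f' y b\<bar>)"
      by (rule order_trans[OF sum_abs]) (simp add: abs_mult)
    also have "\<dots> \<le> (\<Sum>b\<in>Basis. norm h * (C b * norm (x - y)))"
      by (intro sum_mono mult_mono C) (auto simp: Basis_le_norm)
    also have "\<dots> = K * norm (x - y) * norm h" by (simp add: K_def sum_distrib_left sum_distrib_right mult_ac)
    finally show ?thesis .
  qed
  have "\<bar>f (x + h) - f x - f' x h\<bar> \<le> K * (norm h)\<^sup>2" for x h
  proof -
    have "norm (f (x + h) - f x - f' x (x + h - x)) \<le> norm (x + h - x) * (K * norm h)"
    proof (rule differentiable_bound_linearization[of x "x + h" "closed_segment x (x + h)" f f' x "K * norm h"])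
      show "x + t *\<^sub>R (x + h - x) \<in> closed_segment x (x + h)" if "t \<in> {0..1}" for t
        using that by (auto simp: closed_segment_def algebra_simps intro!: exI[of _ t])
      show "(f has_derivative f' y) (at y within closed_segment x (x + h))" for y
        using f'(1) by (rule has_derivative_at_withinI)
      show "onorm (f' y - f' x) \<le> K * norm h" if "y \<in> closed_segment x (x + h)" for y
      proof (rule onorm_le)
        fix v :: 'a
        have "norm (y - x) \<le> norm h" using segment_bound(1)[OF that] by simp
        then have "K * norm (y - x) * norm v \<le> K * norm h * norm v" using K0 by (intro mult_mono) auto
        then show "norm ((f' y - f' x) v) \<le> K * norm h * norm v" using lin[of y v x] by simp
      qed
    qed auto
    then show ?thesis by (simp add: power2_eq_square mult_ac)
  qed
  with K0 show ?thesis using that by blast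
qed

text \<open>All derivatives fall on the smooth factor, so integrability of \<open>w\<close>
  suffices. The uniform Taylor remainder makes the error of the candidate derivative at most a
  multiple of the squared increment times the integral of \<open>|w|\<close>, and the induction on
  \<open>k\<close> runs over all of \<open>S\<close> at once.\<close>

lemma derivative_closed_convolution:
  fixes w :: "'a::euclidean_space \<Rightarrow> real"
  assumes S: "derivative_closed S" and w: "integrable lborel w" and "f \<in> S"
  shows "C_k k (\<lambda>x. LINT y|lborel. f (x - y) * w y)"
proof -
  have w_meas [measurable]: "w \<in> borel_measurable borel" using borel_measurable_integrable[OF w] by simp
  have step: "\<exists>f'. (\<forall>x. ((\<lambda>x. LINT y|lborel. f (x - y) * w y) has_derivative (\<lambda>h. LINT y|lborel. f' (x - y) h * w y)) (at x)) \<and>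
      (\<forall>b\<in>Basis. (\<lambda>x. f' x b) \<in> S)" if f: "f \<in> S" for f
  proof -
    obtain f' B where f': "\<And>x. (f has_derivative f' x) (at x)" "\<And>b. b \<in> Basis \<Longrightarrow> (\<lambda>x. f' x b) \<in> S"
      and B: "0 \<le> B" "\<And>x h. \<bar>f' x h\<bar> \<le> B * norm h"
      using derivative_closed_linear_bound[OF S f] by metis
    obtain C where C: "0 \<le> C" "\<And>x h. \<bar>f (x + h) - f x - f' x h\<bar> \<le> C * (norm h)\<^sup>2"
      using derivative_closed_taylor[OF S f f'] by metis
    obtain M where M: "0 \<le> M" "\<And>x. \<bar>f x\<bar> \<le> M" using derivative_closed_bounded[OF S f] by metis
    have contb: "continuous_on UNIV (\<lambda>x. f' x b)" if "b \<in> Basis" for b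
      using S f'(2)[OF that] unfolding derivative_closed_def by blast
    have contf: "continuous_on UNIV f" using S f unfolding derivative_closed_def by blast
    have f'_rep: "f' x h = (\<Sum>b\<in>Basis. (h \<bullet> b) * f' x b)" for x h
    proof -
      interpret x: bounded_linear "f' x" using f'(1) by (rule has_derivative_bounded_linear)
      have "f' x h = f' x (\<Sum>b\<in>Basis. (h \<bullet> b) *\<^sub>R b)" by (simp add: euclidean_representation)
      then show ?thesis by (simp add: x.sum x.scaleR)
    qed
    have [measurable]: "f \<in> borel_measurable borel" by (rule borel_measurable_continuous_onI[OF contf])
    have [measurable]: "(\<lambda>x. f' x h) \<in> borel_measurable borel" for h
      by (subst f'_rep) (intro borel_measurable_sum borel_measurable_times borel_measurable_const
          borel_measurable_continuous_onI contb)
    have i1: "integrable lborel (\<lambda>y. f (x - y) * w y)" for x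
      by (rule Bochner_Integration.integrable_bound[OF integrable_mult_right[OF w, of M]])
        (auto simp: abs_mult M intro!: mult_right_mono)
    have i2: "integrable lborel (\<lambda>y. f' (x - y) h * w y)" for x h
      by (rule Bochner_Integration.integrable_bound[OF integrable_mult_right[OF w, of "B * norm h"]])
        (auto simp: abs_mult B intro!: mult_right_mono)
    define W where "W = (LINT y|lborel. \<bar>w y\<bar>)"
    have W0: "0 \<le> W" by (simp add: W_def)
    have "((\<lambda>x. LINT y|lborel. f (x - y) * w y) has_derivative (\<lambda>h. LINT y|lborel. f' (x - y) h * w y)) (at x)" for x
    proof (rule has_derivativeI_sandwich[of 1])
      show "bounded_linear (\<lambda>h. LINT y|lborel. f' (x - y) h * w y)"
      proof (rule bounded_linear_intro)
        show "(LINT y|lborel. f' (x - y) (h + k) * w y) = (LINT y|lborel. f' (x - y) h * w y) + (LINT y|lborel. f' (x - y) k * w y)" for h k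
        proof -
          have "f' z (h + k) = f' z h + f' z k" for z
            using has_derivative_linear[OF f'(1)] by (rule linear_add)
          then show ?thesis by (simp add: distrib_right i2)
        qed
        show "(LINT y|lborel. f' (x - y) (r *\<^sub>R h) * w y) = r *\<^sub>R (LINT y|lborel. f' (x - y) h * w y)" for r h
        proof -
          have "f' z (r *\<^sub>R h) = r * f' z h" for z
            using linear_scale[OF has_derivative_linear[OF f'(1)]] by simp
          then show ?thesis by (simp add: mult.assoc)
        qed
        show "norm (LINT y|lborel. f' (x - y) h * w y) \<le> norm h * (B * W)" for h
        proof -
          have "norm (LINT y|lborel. f' (x - y) h * w y) \<le> (LINT y|lborel. norm (f' (x - y) h * w y))"
            by (rule integral_norm_bound)
          also have "\<dots> \<le> (LINT y|lborel. (B * norm h) * \<bar>w y\<bar>)"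
            using w integrable_norm[OF i2] by (intro integral_mono) (auto simp: abs_mult B intro!: mult_right_mono)
          finally show ?thesis by (simp add: W_def mult_ac)
        qed
      qed
      fix y assume y: "y \<noteq> x"
      have "(LINT z|lborel. f (y - z) * w z) - (LINT z|lborel. f (x - z) * w z) - (LINT z|lborel. f' (x - z) (y - x) * w z)
        = (LINT z|lborel. (f (y - z) - f (x - z) - f' (x - z) (y - x)) * w z)"
        by (simp add: left_diff_distrib i1 i2 flip: Bochner_Integration.integral_diff)
      also have "norm \<dots> \<le> (LINT z|lborel. norm ((f (y - z) - f (x - z) - f' (x - z) (y - x)) * w z))"
        by (rule integral_norm_bound)
      also have "\<dots> \<le> (LINT z|lborel. (C * (norm (y - x))\<^sup>2) * \<bar>w z\<bar>)"
      proof (rule integral_mono)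
        show "integrable lborel (\<lambda>z. norm ((f (y - z) - f (x - z) - f' (x - z) (y - x)) * w z))"
          by (simp add: left_diff_distrib i1 i2)
        show "norm ((f (y - z) - f (x - z) - f' (x - z) (y - x)) * w z) \<le> (C * (norm (y - x))\<^sup>2) * \<bar>w z\<bar>" for z
          using C(2)[of "x - z" "y - x"] by (auto simp: abs_mult intro!: mult_right_mono)
      qed (use w in auto)
      also have "\<dots> = C * W * (norm (y - x))\<^sup>2" by (simp add: W_def mult_ac)
      finally show "norm ((LINT z|lborel. f (y - z) * w z) - (LINT z|lborel. f (x - z) * w z) - (LINT z|lborel. f' (x - z) (y - x) * w z)) / norm (y - x)
          \<le> C * W * norm (y - x)"
        using y by (simp add: field_simps power2_eq_square)
    next
      have "((\<lambda>y. C * W * norm (y - x)) \<longlongrightarrow> C * W * norm (x - x)) (at x)"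
        by (intro tendsto_intros)
      then show "((\<lambda>y. C * W * norm (y - x)) \<longlongrightarrow> 0) (at x)" by simp
    qed auto
    then show ?thesis using f'(2) by blast
  qed
  show ?thesis using \<open>f \<in> S\<close>
  proof (induction k arbitrary: f)
    case 0
    have "isCont (\<lambda>x. LINT y|lborel. f (x - y) * w y) x" for x
      using step[OF 0] has_derivative_continuous by blast
    then show ?case by (simp add: continuous_at_imp_continuous_on)
  next
    case (Suc k)
    obtain f' where D1: "\<And>x. ((\<lambda>x. LINT y|lborel. f (x - y) * w y) has_derivative (\<lambda>h. LINT y|lborel. f' (x - y) h * w y)) (at x)"
      and D2: "\<And>b. b \<in> Basis \<Longrightarrow> (\<lambda>x. f' x b) \<in> S" using step[OF Suc.prems] by auto
    show ?case by (rule C_k_SucI[OF D1]) (rule Suc.IH[OF D2])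
  qed
qed

text \<open>The classical function \<open>exp (-1/t)\<close>, flat at 0, times \<open>t^-m\<close>.
  Carrying the power as a parameter makes the family closed, up to linear combinations, under
  differentiation.\<close>

definition flat :: "nat \<Rightarrow> real \<Rightarrow> real" where
  "flat m t = (if 0 < t then (inverse t) ^ m / exp (inverse t) else 0)"

lemma flat_has_derivative: "(flat m has_field_derivative flat (m + 2) t - real m * flat (m + 1) t) (at t)"
proof -
  consider "t > 0" | "t < 0" | "t = 0" by linarith
  then show ?thesis
  proof cases
    case 1
    define y where "y = inverse t"
    \<comment> \<open>For \<open>m = 0\<close> the truncated exponent \<open>m - 1\<close> does no
      harm, since its coefficient \<open>real m\<close> is 0.\<close>
    have "((\<lambda>y. y ^ m / exp y) has_field_derivative (real m * y ^ (m - 1) - y ^ m) / exp y) (at y)"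
      by (auto intro!: derivative_eq_intros simp: field_simps)
    then have "((\<lambda>t. (inverse t) ^ m / exp (inverse t)) has_field_derivative
        (real m * y ^ (m - 1) - y ^ m) / exp y * - (inverse t ^ Suc (Suc 0))) (at t)"
      unfolding y_def by (rule DERIV_chain2) (use 1 in \<open>auto intro: DERIV_inverse simp del: power_Suc\<close>)
    also have "(real m * y ^ (m - 1) - y ^ m) / exp y * - (inverse t ^ Suc (Suc 0)) = flat (m + 2) t - real m * flat (m + 1) t"
      using 1 by (cases m) (simp_all add: flat_def y_def[symmetric] diff_divide_distrib add_divide_distrib algebra_simps)
    finally have "((\<lambda>t. (inverse t) ^ m / exp (inverse t)) has_field_derivative flat (m + 2) t - real m * flat (m + 1) t) (at t)" .
    then show ?thesis
      by (rule has_field_derivative_transform_within_open[of _ _ _ "{0<..}"]) (use 1 in \<open>auto simp: flat_def\<close>)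
  next
    case 2
    have "((\<lambda>t. 0) has_field_derivative flat (m + 2) t - real m * flat (m + 1) t) (at t)"
      using 2 by (auto simp: flat_def)
    then show ?thesis
      by (rule has_field_derivative_transform_within_open[of _ _ _ "{..<0}"]) (use 2 in \<open>auto simp: flat_def\<close>)
  next
    case 3
    \<comment> \<open>At 0 the difference quotient from the right is \<open>y^(m+1) / exp y\<close>
      with \<open>y = 1/h\<close> tending to infinity.\<close>
    have "((\<lambda>h. (inverse h) ^ (m + 1) / exp (inverse h)) \<longlongrightarrow> 0) (at_right (0::real))"
      by (rule filterlim_compose[OF tendsto_power_div_exp_0 filterlim_inverse_at_top_right])
    then have "((\<lambda>h. flat m h / h) \<longlongrightarrow> 0) (at_right 0)"
      by (rule Lim_transform_eventually) (auto simp: flat_def eventually_at_right_less field_simps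
        intro!: eventually_at_rightI[of 0 1])
    moreover have "((\<lambda>h. flat m h / h) \<longlongrightarrow> 0) (at_left 0)"
      by (rule Lim_transform_eventually[OF tendsto_const]) (auto simp: flat_def intro!: eventually_at_leftI[of "-1"])
    ultimately have "((\<lambda>h. flat m h / h) \<longlongrightarrow> 0) (at 0)" using filterlim_split_at by blast
    then show ?thesis using 3 by (simp add: DERIV_def flat_def)
  qed
qed

text \<open>Polynomials times \<open>flat m (1 - |x|^2)\<close>. The chain rule brings out the
  factor \<open>-2 (x \<bullet> h)\<close>, which is why multiplication by linear functionals has to
  be a constructor.\<close>

inductive_set bumps :: "('a::euclidean_space \<Rightarrow> real) set" where
  base: "(\<lambda>x. flat m (1 - x \<bullet> x)) \<in> bumps"
| mult: "f \<in> bumps \<Longrightarrow> (\<lambda>x. (x \<bullet> b) * f x) \<in> bumps"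
| scale: "f \<in> bumps \<Longrightarrow> (\<lambda>x. c * f x) \<in> bumps"
| add: "f \<in> bumps \<Longrightarrow> g \<in> bumps \<Longrightarrow> (\<lambda>x. f x + g x) \<in> bumps"

lemma bumps_derivative:
  assumes "f \<in> bumps"
  shows "\<exists>f'. (\<forall>x. (f has_derivative f' x) (at x)) \<and> (\<forall>b. (\<lambda>x. f' x b) \<in> bumps)"
  using assms
proof induction
  case (base m)
  define g :: "'a \<Rightarrow> real" where "g = (\<lambda>x. flat (m + 2) (1 - x \<bullet> x) + (- real m) * flat (m + 1) (1 - x \<bullet> x))"
  have g: "g \<in> bumps" unfolding g_def by (intro bumps.intros)
  have "((\<lambda>x. flat m (1 - x \<bullet> x)) has_derivative (\<lambda>h. (-2) * ((x \<bullet> h) * g x))) (at x)" for x :: 'a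
  proof -
    have "((\<lambda>x. flat m (1 - x \<bullet> x)) has_derivative (\<lambda>h. (flat (m + 2) (1 - x \<bullet> x) - real m * flat (m + 1) (1 - x \<bullet> x)) * (- (2 * (x \<bullet> h))))) (at x)"
      by (rule has_derivative_compose[OF _ flat_has_derivative[unfolded has_field_derivative_def], of "\<lambda>x. 1 - x \<bullet> x"])
        (auto intro!: derivative_eq_intros simp: inner_commute)
    then show ?thesis by (simp add: g_def algebra_simps)
  qed
  moreover have "(\<lambda>x. (-2) * ((x \<bullet> b) * g x)) \<in> bumps" for b using g by (intro bumps.intros)
  ultimately show ?case by (intro exI[of _ "\<lambda>x h. (-2) * ((x \<bullet> h) * g x)"]) auto
next
  case (mult f b)
  then obtain f' where f': "\<And>x. (f has_derivative f' x) (at x)" "\<And>b. (\<lambda>x. f' x b) \<in> bumps" by auto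
  have "((\<lambda>x. (x \<bullet> b) * f x) has_derivative (\<lambda>h. (x \<bullet> b) * f' x h + (h \<bullet> b) * f x)) (at x)" for x
    by (rule has_derivative_mult) (auto intro!: f' derivative_eq_intros)
  moreover have "(\<lambda>x. (x \<bullet> b) * f' x h + (h \<bullet> b) * f x) \<in> bumps" for h
    using f' mult by (intro bumps.intros)
  ultimately show ?case by (intro exI[of _ "\<lambda>x h. (x \<bullet> b) * f' x h + (h \<bullet> b) * f x"]) auto
next
  case (scale f c)
  then obtain f' where f': "\<And>x. (f has_derivative f' x) (at x)" "\<And>b. (\<lambda>x. f' x b) \<in> bumps" by auto
  show ?case using f' by (intro exI[of _ "\<lambda>x h. c * f' x h"]) (auto intro: bumps.intros has_derivative_mult_right)
next
  case (add f g)
  then obtain f' g' where f': "\<And>x. (f has_derivative f' x) (at x)" "\<And>b. (\<lambda>x. f' x b) \<in> bumps"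
    and g': "\<And>x. (g has_derivative g' x) (at x)" "\<And>b. (\<lambda>x. g' x b) \<in> bumps" by auto
  show ?case using f' g' by (intro exI[of _ "\<lambda>x h. f' x h + g' x h"]) (auto intro: bumps.intros has_derivative_add)
qed

lemma bumps_support: "f \<in> bumps \<Longrightarrow> 1 \<le> norm x \<Longrightarrow> f x = 0"
proof (induction rule: bumps.induct)
  case (base m)
  then have "1 \<le> x \<bullet> x" by (simp add: power2_norm_eq_inner[symmetric])
  then show ?case by (simp add: flat_def)
qed auto

text \<open>A dilation by \<open>c\<close> multiplies derivatives by \<open>c\<close>, and the
  constructor \<open>scale\<close> absorbs that factor.\<close>

lemma derivative_closed_scaled_bumps:
  assumes "0 < (c::real)"
  shows "derivative_closed ((\<lambda>f x. f (c *\<^sub>R x)) ` (bumps :: ('a::euclidean_space \<Rightarrow> real) set))"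
  unfolding derivative_closed_def
proof (rule ballI)
  fix F assume "F \<in> (\<lambda>f x. f (c *\<^sub>R x)) ` (bumps :: ('a \<Rightarrow> real) set)"
  then obtain f :: "'a \<Rightarrow> real" where f: "f \<in> bumps" and F: "F = (\<lambda>x. f (c *\<^sub>R x))" by auto
  from bumps_derivative[OF f] obtain f' where f': "\<And>x. (f has_derivative f' x) (at x)" "\<And>b. (\<lambda>x. f' x b) \<in> bumps" by auto
  have D: "(F has_derivative (\<lambda>h. c * f' (c *\<^sub>R x) h)) (at x)" for x
  proof -
    have "(F has_derivative (\<lambda>h. f' (c *\<^sub>R x) (c *\<^sub>R h))) (at x)"
      unfolding F by (rule has_derivative_compose[OF _ f'(1)]) (auto intro!: derivative_eq_intros)
    moreover have "f' y (c *\<^sub>R h) = c * f' y h" for y h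
      using linear_scale[OF has_derivative_linear[OF f'(1)]] by simp
    ultimately show ?thesis by simp
  qed
  have "continuous_on UNIV F"
    using D by (auto intro!: continuous_at_imp_continuous_on has_derivative_continuous)
  moreover have "F x = 0" if "1 / c \<le> norm x" for x
    unfolding F using that assms by (intro bumps_support[OF f]) (auto simp: field_simps)
  moreover have "(\<lambda>x. c * f' (c *\<^sub>R x) b) \<in> (\<lambda>f x. f (c *\<^sub>R x)) ` bumps" for b
    by (rule image_eqI[of _ _ "\<lambda>x. c * f' x b"]) (auto intro: bumps.intros f')
  ultimately show "continuous_on UNIV F \<and> (\<exists>R. \<forall>x. R \<le> norm x \<longrightarrow> F x = 0) \<and>
      (\<exists>f'. (\<forall>x. (F has_derivative f' x) (at x)) \<and> (\<forall>b\<in>Basis. (\<lambda>x. f' x b) \<in> (\<lambda>f x. f (c *\<^sub>R x)) ` bumps))"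
    using D by (intro conjI exI[of _ "\<lambda>x h. c * f' (c *\<^sub>R x) h"] exI[of _ "1 / c"]) auto
qed

text \<open>The set \<open>S\<close> is returned so that convolutions with \<rho> are known to be
  smooth; the bound \<open>M\<close> is returned because integrability of \<rho> times an integrable
  function rests on it.\<close>

lemma mollifier_exists:
  assumes "0 < (e::real)"
  obtains S and \<rho> :: "'a::euclidean_space \<Rightarrow> real" and M where "derivative_closed S" "\<rho> \<in> S"
    "\<And>x. 0 \<le> \<rho> x" "\<And>x. \<rho> x \<le> M" "\<And>x. e \<le> norm x \<Longrightarrow> \<rho> x = 0" "\<rho> \<in> borel_measurable borel"
    "integrable lborel \<rho>" "integral\<^sup>L lborel \<rho> = 1"
proof -
  define S where "S = (\<lambda>f x. f ((1 / e) *\<^sub>R x)) ` (bumps :: ('a \<Rightarrow> real) set)"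
  have S: "derivative_closed S" unfolding S_def using assms by (intro derivative_closed_scaled_bumps) simp
  define h where "h x = flat 0 (1 - ((1 / e) *\<^sub>R x) \<bullet> ((1 / e) *\<^sub>R x))" for x :: 'a
  have sc: "(\<lambda>x. c * h x) \<in> S" for c
    unfolding S_def by (rule image_eqI[of _ _ "\<lambda>x. c * flat 0 (1 - x \<bullet> x)"]) (auto intro!: bumps.intros simp: h_def)
  then have h: "h \<in> S" using sc[of 1] by simp
  have h0: "0 \<le> h x" for x by (simp add: h_def flat_def)
  have supp: "h x = 0" if "e \<le> norm x" for x
  proof -
    have "1 \<le> norm ((1 / e) *\<^sub>R x)" using that assms by simp
    then have "1 \<le> ((1 / e) *\<^sub>R x) \<bullet> ((1 / e) *\<^sub>R x)" unfolding power2_norm_eq_inner[symmetric] by simp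
    then show ?thesis by (simp add: h_def flat_def)
  qed
  have pos: "0 < h x" if "norm x < e" for x
  proof -
    have "norm ((1 / e) *\<^sub>R x) < 1" using that assms by simp
    then have "((1 / e) *\<^sub>R x) \<bullet> ((1 / e) *\<^sub>R x) < 1" unfolding power2_norm_eq_inner[symmetric] by (simp add: power_less_one_iff)
    then show ?thesis by (simp add: h_def flat_def)
  qed
  obtain M where M: "0 \<le> M" "\<And>x. \<bar>h x\<bar> \<le> M" using derivative_closed_bounded[OF S h] by metis
  have [measurable]: "h \<in> borel_measurable borel"
    using S h by (auto intro: borel_measurable_continuous_onI simp: derivative_closed_def)
  have int: "integrable lborel h"
  proof (rule Bochner_Integration.integrable_bound)
    show "integrable lborel (\<lambda>x. M * indicator (cball (0::'a) e) x)"
      using emeasure_lborel_cball_finite[of "0::'a" e] by (intro integrable_mult_right integrable_real_indicator) auto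
    show "AE x in lborel. norm (h x) \<le> norm (M * indicator (cball (0::'a) e) x)"
      using M supp by (auto simp: indicator_def)
  qed simp
  \<comment> \<open>A vanishing integral would force \<open>h = 0\<close> almost everywhere,
    although \<open>h\<close> is positive on a ball of positive measure.\<close>
  have I: "0 < integral\<^sup>L lborel h"
  proof (rule ccontr)
    assume "\<not> ?thesis"
    then have "integral\<^sup>L lborel h = 0" using integral_nonneg_AE[of h lborel] h0 by fastforce
    then have "AE x in lborel. h x = 0" using integral_nonneg_eq_0_iff_AE[OF int] h0 by simp
    then have "AE x in lborel. x \<notin> ball (0::'a) e" by eventually_elim (use pos in force)
    then have "ball (0::'a) e \<in> null_sets lborel" by (subst AE_iff_null_sets) auto
    then show False using assms content_ball_gt_0_iff[of "0::'a" e] by (auto simp: measure_def null_sets_def)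
  qed
  show ?thesis
  proof (rule that[OF S sc[of "1 / integral\<^sup>L lborel h"], of "1 / integral\<^sup>L lborel h * M"])
    show "1 / integral\<^sup>L lborel h * h x \<le> 1 / integral\<^sup>L lborel h * M" for x
      using M(2)[of x] I by (intro mult_left_mono) auto
  qed (use I h0 supp int in auto)
qed

section \<open>Continuity of translations\<close>

lemma integral_lborel_affine:
  fixes f :: "'a::euclidean_space \<Rightarrow> real"
  assumes f: "integrable lborel f" and c: "c \<noteq> 0"
  shows "integrable lborel (\<lambda>x. f (t + c *\<^sub>R x))"
    and "integral\<^sup>L lborel f = \<bar>c\<bar> ^ DIM('a) * (LINT x|lborel. f (t + c *\<^sub>R x))"
proof -
  have [measurable]: "f \<in> borel_measurable borel" using borel_measurable_integrable[OF f] by simp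
  have "integrable (density (distr lborel borel (\<lambda>x. t + c *\<^sub>R x)) (\<lambda>_. ennreal (\<bar>c\<bar> ^ DIM('a)))) f"
    using f lborel_affine[OF c, of t] by simp
  then show "integrable lborel (\<lambda>x. f (t + c *\<^sub>R x))"
    using c by (simp add: integrable_density integrable_distr_eq)
  have "integral\<^sup>L lborel f = integral\<^sup>L (density (distr lborel borel (\<lambda>x. t + c *\<^sub>R x)) (\<lambda>_. ennreal (\<bar>c\<bar> ^ DIM('a)))) f"
    using lborel_affine[OF c, of t] by simp
  also have "\<dots> = \<bar>c\<bar> ^ DIM('a) * (LINT x|lborel. f (t + c *\<^sub>R x))"
    by (simp add: integral_density integral_distr)
  finally show "integral\<^sup>L lborel f = \<bar>c\<bar> ^ DIM('a) * (LINT x|lborel. f (t + c *\<^sub>R x))" .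
qed

lemma integrable_lborel_translate:
  fixes f :: "'a::euclidean_space \<Rightarrow> real"
  assumes "integrable lborel f"
  shows "integrable lborel (\<lambda>x. f (x + t))"
    and "(LINT x|lborel. f (x + t)) = integral\<^sup>L lborel f"
  using integral_lborel_affine[OF assms, of 1 t] by (simp_all add: add.commute)

text \<open>A three-term estimate: by translation invariance the shifted approximation error has the
  same integral as the unshifted one, uniformly in the shift.\<close>

lemma translation_continuous_approx:
  fixes f :: "'a::euclidean_space \<Rightarrow> real"
  assumes f: "integrable lborel f"
    and approx: "\<And>e. 0 < e \<Longrightarrow> \<exists>g. integrable lborel g \<and> (LINT x|lborel. \<bar>f x - g x\<bar>) < e \<and>
      (\<lambda>n. LINT x|lborel. \<bar>g (x + T n) - g x\<bar>) \<longlonglongrightarrow> 0"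
  shows "(\<lambda>n. LINT x|lborel. \<bar>f (x + T n) - f x\<bar>) \<longlonglongrightarrow> 0"
proof (rule LIMSEQ_I)
  fix r :: real assume "0 < r"
  then obtain g where g: "integrable lborel g" "(LINT x|lborel. \<bar>f x - g x\<bar>) < r / 3"
      "(\<lambda>n. LINT x|lborel. \<bar>g (x + T n) - g x\<bar>) \<longlonglongrightarrow> 0"
    using approx[of "r / 3"] by auto
  obtain N where N: "\<And>n. n \<ge> N \<Longrightarrow> norm ((LINT x|lborel. \<bar>g (x + T n) - g x\<bar>) - 0) < r / 3"
    using LIMSEQ_D[OF g(3), of "r / 3"] \<open>0 < r\<close> by auto
  have "norm ((LINT x|lborel. \<bar>f (x + T n) - f x\<bar>) - 0) < r" if n: "n \<ge> N" for n
  proof -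
    note tr = integrable_lborel_translate
    have d: "integrable lborel (\<lambda>x. \<bar>f x - g x\<bar>)" using f g by auto
    have "(LINT x|lborel. \<bar>f (x + T n) - f x\<bar>)
        \<le> (LINT x|lborel. \<bar>f (x + T n) - g (x + T n)\<bar> + \<bar>g (x + T n) - g x\<bar> + \<bar>f x - g x\<bar>)"
      using f g by (intro integral_mono Bochner_Integration.integrable_add integrable_abs
          Bochner_Integration.integrable_diff tr) auto
    also have "\<dots> = (LINT x|lborel. \<bar>f (x + T n) - g (x + T n)\<bar>) + (LINT x|lborel. \<bar>g (x + T n) - g x\<bar>) + (LINT x|lborel. \<bar>f x - g x\<bar>)"
      using f g by (simp add: tr)
    also have "(LINT x|lborel. \<bar>f (x + T n) - g (x + T n)\<bar>) = (LINT x|lborel. \<bar>f x - g x\<bar>)"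
      using tr(2)[OF d] .
    finally have "(LINT x|lborel. \<bar>f (x + T n) - f x\<bar>) < r"
      using g(2) N[OF n] by simp
    then show ?thesis by simp
  qed
  then show "\<exists>no. \<forall>n\<ge>no. norm ((LINT x|lborel. \<bar>f (x + T n) - f x\<bar>) - 0) < r" by blast
qed

text \<open>For open sets the indicator is lower semicontinuous, and since translation preserves
  the integral it is enough to control the negative part of the increment.\<close>

lemma translation_continuous_open:
  fixes U :: "'a::euclidean_space set"
  assumes U: "open U" "emeasure lborel U < \<infinity>" and T: "T \<longlonglongrightarrow> 0"
  shows "(\<lambda>n. LINT x|lborel. \<bar>indicator U (x + T n) - indicator U x :: real\<bar>) \<longlonglongrightarrow> 0"
proof -
  let ?u = "indicator U :: 'a \<Rightarrow> real"
  have [measurable]: "U \<in> sets borel" using U by auto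
  have i: "integrable lborel ?u" using U by (auto intro: integrable_real_indicator)
  note tr = integrable_lborel_translate[OF i]
  have "(\<lambda>n. LINT x|lborel. max 0 (?u x - ?u (x + T n))) \<longlonglongrightarrow> (LINT x|(lborel::'a measure). 0)"
  proof (rule integral_dominated_convergence[where w = ?u])
    show "AE x in lborel. (\<lambda>n. max 0 (?u x - ?u (x + T n))) \<longlonglongrightarrow> 0"
    proof (rule AE_I2)
      fix x
      have "eventually (\<lambda>n. max 0 (?u x - ?u (x + T n)) = 0) sequentially"
      proof (cases "x \<in> U")
        case True
        have "(\<lambda>n. x + T n) \<longlonglongrightarrow> x + 0" by (intro tendsto_intros T)
        then have "eventually (\<lambda>n. x + T n \<in> U) sequentially"
          using topological_tendstoD[of _ "x + 0" _ U] U True by simp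
        then show ?thesis by eventually_elim (simp add: indicator_def)
      qed (simp add: indicator_def)
      then show "(\<lambda>n. max 0 (?u x - ?u (x + T n))) \<longlonglongrightarrow> 0" by (rule tendsto_eventually)
    qed
  qed (auto simp: i indicator_def)
  then have "(\<lambda>n. 2 * (LINT x|lborel. max 0 (?u x - ?u (x + T n)))) \<longlonglongrightarrow> 2 * 0"
    by (intro tendsto_intros) simp
  moreover have "(LINT x|lborel. \<bar>?u (x + T n) - ?u x\<bar>) = 2 * (LINT x|lborel. max 0 (?u x - ?u (x + T n)))" for n
  proof -
    have m: "integrable lborel (\<lambda>x. max 0 (?u x - ?u (x + T n)))"
      by (rule Bochner_Integration.integrable_bound[OF i]) (auto simp: indicator_def)
    have "(LINT x|lborel. \<bar>?u (x + T n) - ?u x\<bar>) = (LINT x|lborel. 2 * max 0 (?u x - ?u (x + T n)) - (?u x - ?u (x + T n)))"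
      by (intro Bochner_Integration.integral_cong) (auto simp: indicator_def)
    also have "\<dots> = 2 * (LINT x|lborel. max 0 (?u x - ?u (x + T n))) - ((LINT x|lborel. ?u x) - (LINT x|lborel. ?u (x + T n)))"
      using m i tr(1)[of "T n"] by simp
    finally show ?thesis using tr(2)[of "T n"] by simp
  qed
  ultimately show ?thesis by simp
qed

text \<open>Open sets are the seed. Outer regularity passes to measurable sets of finite measure,
  the triangle inequality to sums, and approximation in the mean to all integrable
  functions.\<close>

lemma translation_continuous_L1:
  fixes f :: "'a::euclidean_space \<Rightarrow> real"
  assumes "integrable lborel f" and T: "T \<longlonglongrightarrow> 0"
  shows "(\<lambda>n. LINT x|lborel. \<bar>f (x + T n) - f x\<bar>) \<longlonglongrightarrow> 0"
  using assms(1)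
proof (induction f rule: integrable_induct)
  case (base A c)
  have A [measurable]: "A \<in> sets borel" using base by simp
  have iA: "integrable lborel (indicator A :: 'a \<Rightarrow> real)" using base by (intro integrable_real_indicator) auto
  have "(\<lambda>n. LINT x|lborel. \<bar>indicator A (x + T n) - indicator A x :: real\<bar>) \<longlonglongrightarrow> 0"
  proof (rule translation_continuous_approx[OF iA])
    fix e :: real assume "0 < e"
    then obtain U where U: "open U" "A \<subseteq> U" "emeasure lborel (U - A) < ennreal e"
      using outer_regular_lborel[OF A] by blast
    have [measurable]: "U \<in> sets borel" using U by auto
    have "emeasure lborel U = emeasure lborel A + emeasure lborel (U - A)"
      using U(2) by (subst plus_emeasure) (auto intro!: arg_cong[of _ _ "emeasure lborel"])
    also have "\<dots> < \<infinity>" using base U(3) by (auto simp: less_top intro: order_less_trans)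
    finally have fU: "emeasure lborel U < \<infinity>" .
    have "(LINT x|lborel. \<bar>indicator A x - indicator U x :: real\<bar>) = (LINT x|lborel. indicator (U - A) x)"
      using U(2) by (intro Bochner_Integration.integral_cong) (auto simp: indicator_def)
    also have "\<dots> = measure lborel (U - A)" by simp
    also have "\<dots> < e" using U(3) \<open>0 < e\<close> by (simp add: measure_def enn2real_less_iff less_top order_less_trans)
    finally show "\<exists>g. integrable lborel g \<and> (LINT x|lborel. \<bar>indicator A x - g x\<bar>) < e \<and>
        (\<lambda>n. LINT x|lborel. \<bar>g (x + T n) - g x\<bar>) \<longlonglongrightarrow> 0"
      using translation_continuous_open[OF U(1) fU T] fU
      by (intro exI[of _ "indicator U"]) (auto intro: integrable_real_indicator)
  qed
  then have "(\<lambda>n. \<bar>c\<bar> * (LINT x|lborel. \<bar>indicator A (x + T n) - indicator A x :: real\<bar>)) \<longlonglongrightarrow> \<bar>c\<bar> * 0"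
    by (intro tendsto_intros)
  moreover have "(LINT x|lborel. \<bar>indicator A (x + T n) *\<^sub>R c - indicator A x *\<^sub>R c\<bar>)
      = \<bar>c\<bar> * (LINT x|lborel. \<bar>indicator A (x + T n) - indicator A x :: real\<bar>)" for n
  proof -
    have "\<bar>indicator A (x + T n) *\<^sub>R c - indicator A x *\<^sub>R c\<bar> = \<bar>c\<bar> * \<bar>indicator A (x + T n) - indicator A x :: real\<bar>" for x
      by (auto simp: indicator_def)
    then show ?thesis by simp
  qed
  ultimately show ?case by simp
next
  case (add f g)
  note tr = integrable_lborel_translate
  show ?case
  proof (rule real_tendsto_sandwich[where f = "\<lambda>_. 0"])
    show "eventually (\<lambda>n. (LINT x|lborel. \<bar>(f (x + T n) + g (x + T n)) - (f x + g x)\<bar>)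
        \<le> (LINT x|lborel. \<bar>f (x + T n) - f x\<bar>) + (LINT x|lborel. \<bar>g (x + T n) - g x\<bar>)) sequentially"
    proof (rule always_eventually, rule allI)
      fix n
      have "(LINT x|lborel. \<bar>(f (x + T n) + g (x + T n)) - (f x + g x)\<bar>)
        \<le> (LINT x|lborel. \<bar>f (x + T n) - f x\<bar> + \<bar>g (x + T n) - g x\<bar>)"
        using add.hyps by (intro integral_mono integrable_abs Bochner_Integration.integrable_add
          Bochner_Integration.integrable_diff tr) auto
      also have "\<dots> = (LINT x|lborel. \<bar>f (x + T n) - f x\<bar>) + (LINT x|lborel. \<bar>g (x + T n) - g x\<bar>)"
        using add.hyps by (simp add: tr)
      finally show "(LINT x|lborel. \<bar>(f (x + T n) + g (x + T n)) - (f x + g x)\<bar>)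
        \<le> (LINT x|lborel. \<bar>f (x + T n) - f x\<bar>) + (LINT x|lborel. \<bar>g (x + T n) - g x\<bar>)" .
    qed
    show "(\<lambda>n. (LINT x|lborel. \<bar>f (x + T n) - f x\<bar>) + (LINT x|lborel. \<bar>g (x + T n) - g x\<bar>)) \<longlonglongrightarrow> 0"
      using tendsto_add[OF add.IH] by simp
  qed (auto intro!: always_eventually)
next
  case (lim f s)
  show ?case
  proof (rule translation_continuous_approx[OF lim.hyps(4)])
    fix e :: real assume "0 < e"
    have "(\<lambda>i. LINT x|lborel. \<bar>f x - s i x\<bar>) \<longlonglongrightarrow> (LINT x|(lborel::'a measure). 0)"
    \<comment> \<open>The approximants satisfy \<open>|s i x| \<le> 2 |f x|\<close>, hence the
      factor 3 for the difference.\<close>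
    proof (rule integral_dominated_convergence[where w = "\<lambda>x. 3 * \<bar>f x\<bar>"])
      show "AE x in lborel. (\<lambda>i. \<bar>f x - s i x\<bar>) \<longlonglongrightarrow> 0"
      proof (rule AE_I2)
        fix x
        have "(\<lambda>i. \<bar>f x - s i x\<bar>) \<longlonglongrightarrow> \<bar>f x - f x\<bar>" by (intro tendsto_intros lim.hyps(2)) simp
        then show "(\<lambda>i. \<bar>f x - s i x\<bar>) \<longlonglongrightarrow> 0" by simp
      qed
      show "AE x in lborel. norm \<bar>f x - s i x\<bar> \<le> 3 * \<bar>f x\<bar>" for i
      proof (rule AE_I2)
        fix x
        have "\<bar>s i x\<bar> \<le> 2 * \<bar>f x\<bar>" using lim.hyps(3)[of x i] by simp
        then show "norm \<bar>f x - s i x\<bar> \<le> 3 * \<bar>f x\<bar>" by simp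
      qed
    qed (use lim.hyps(1,4) in auto)
    then have "eventually (\<lambda>i. (LINT x|lborel. \<bar>f x - s i x\<bar>) < e) sequentially"
      using order_tendstoD(2) \<open>0 < e\<close> by fastforce
    then obtain i where "(LINT x|lborel. \<bar>f x - s i x\<bar>) < e" using eventually_happens by fastforce
    then show "\<exists>g. integrable lborel g \<and> (LINT x|lborel. \<bar>f x - g x\<bar>) < e \<and>
        (\<lambda>n. LINT x|lborel. \<bar>g (x + T n) - g x\<bar>) \<longlonglongrightarrow> 0"
      using lim.hyps(1) lim.IH by blast
  qed
qed

text \<open>The map \<open>p \<mapsto> sgn p * p\<^sup>2\<close> reduces the square integrable case to the integrable one.\<close>

lemma square_diff_le_signed_squares:
  fixes p q :: real
  shows "(p - q)\<^sup>2 \<le> 2 * \<bar>sgn p * p\<^sup>2 - sgn q * q\<^sup>2\<bar>"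
proof -
  have same: "(a - b)\<^sup>2 \<le> 2 * \<bar>a\<^sup>2 - b\<^sup>2\<bar>" if "0 \<le> a" "0 \<le> b" for a b :: real
  proof -
    have "\<bar>a - b\<bar> * \<bar>a - b\<bar> \<le> \<bar>a - b\<bar> * \<bar>a + b\<bar>" using that by (intro mult_left_mono) auto
    moreover have "(a - b)\<^sup>2 = \<bar>a - b\<bar> * \<bar>a - b\<bar>" by (simp add: power2_eq_square)
    moreover have "\<bar>a\<^sup>2 - b\<^sup>2\<bar> = \<bar>a - b\<bar> * \<bar>a + b\<bar>"
      by (simp add: power2_eq_square square_diff_square_factored abs_mult mult.commute)
    ultimately show ?thesis by simp
  qed
  have opp: "(a + b)\<^sup>2 \<le> 2 * (a\<^sup>2 + b\<^sup>2)" for a b :: real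
    using zero_le_power2[of "a - b"] by (simp add: power2_eq_square algebra_simps)
  consider "0 \<le> p" "0 \<le> q" | "p < 0" "q < 0" | "0 \<le> p" "q < 0" | "p < 0" "0 \<le> q" by linarith
  then show ?thesis
  proof cases
    case 1
    then show ?thesis using same[of p q] by (cases "p = 0"; cases "q = 0") auto
  next
    case 2
    then show ?thesis using same[of "- p" "- q"] by (simp add: power2_commute abs_minus_commute)
  next
    case 3
    then show ?thesis using opp[of p "- q"] by (cases "p = 0") auto
  next
    case 4
    then show ?thesis using opp[of "- p" q] by (cases "q = 0") (auto simp: power2_commute)
  qed
qed

text \<open>Needed in dimension \<open>n\<close> for a function and in dimension \<open>2n\<close>
  for its difference quotient. If no \<delta> worked, shifts tending to 0 would contradict the
  sequential statement for the signed square of \<open>f\<close>.\<close>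

lemma translation_continuous_L2:
  fixes f :: "'a::euclidean_space \<Rightarrow> real"
  assumes [measurable]: "f \<in> borel_measurable borel" and f: "integrable lborel (\<lambda>x. (f x)\<^sup>2)" and e: "0 < e"
  shows "\<exists>\<delta>>0. \<forall>t. norm t < \<delta> \<longrightarrow> (\<integral>\<^sup>+x. ennreal ((f (x - t) - f x)\<^sup>2) \<partial>lborel) \<le> ennreal e"
proof (rule ccontr)
  assume "\<not> ?thesis"
  then have "\<exists>t. norm t < \<delta> \<and> ennreal e < (\<integral>\<^sup>+x. ennreal ((f (x - t) - f x)\<^sup>2) \<partial>lborel)" if "0 < \<delta>" for \<delta>
    using that by (auto simp: not_le)
  then have "\<exists>t. norm t < inverse (real (Suc n)) \<and> ennreal e < (\<integral>\<^sup>+x. ennreal ((f (x - t) - f x)\<^sup>2) \<partial>lborel)" for n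
    by simp
  then obtain t where t: "\<And>n. norm (t n) < inverse (real (Suc n))"
    "\<And>n. ennreal e < (\<integral>\<^sup>+x. ennreal ((f (x - t n) - f x)\<^sup>2) \<partial>lborel)" by metis
  define h where "h x = sgn (f x) * (f x)\<^sup>2" for x
  have [measurable]: "h \<in> borel_measurable borel" unfolding h_def by measurable
  have h: "integrable lborel h"
    by (rule Bochner_Integration.integrable_bound[OF f]) (auto simp: h_def abs_mult sgn_real_def)
  have "t \<longlonglongrightarrow> 0"
    by (rule Lim_null_comparison[OF _ LIMSEQ_inverse_real_of_nat]) (use t(1) in \<open>auto intro!: always_eventually less_imp_le\<close>)
  then have "(\<lambda>n. - t n) \<longlonglongrightarrow> 0" using tendsto_minus by fastforce
  from translation_continuous_L1[OF h this]
  have "eventually (\<lambda>n. (LINT x|lborel. \<bar>h (x + - t n) - h x\<bar>) < e / 2) sequentially"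
    using order_tendstoD(2)[of _ 0 _ "e / 2"] e by auto
  then obtain n where n: "(LINT x|lborel. \<bar>h (x + - t n) - h x\<bar>) < e / 2" using eventually_happens by fastforce
  have ih: "integrable lborel (\<lambda>x. \<bar>h (x + - t n) - h x\<bar>)"
    using h integrable_lborel_translate(1)[OF h, of "- t n"] by auto
  have "(\<integral>\<^sup>+x. ennreal ((f (x - t n) - f x)\<^sup>2) \<partial>lborel) \<le> (\<integral>\<^sup>+x. ennreal (2 * \<bar>h (x + - t n) - h x\<bar>) \<partial>lborel)"
    by (intro nn_integral_mono ennreal_leI) (simp add: h_def square_diff_le_signed_squares)
  also have "\<dots> = ennreal (LINT x|lborel. 2 * \<bar>h (x + - t n) - h x\<bar>)"
    using ih by (intro nn_integral_eq_integral) auto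
  also have "\<dots> \<le> ennreal e" using n by (intro ennreal_leI) simp
  finally show False using t(2)[of n] by simp
qed

section \<open>Approximation by test functions\<close>

text \<open>The definitions use the completed measure, whereas Fubini and the product structure are
  at hand for \<open>lborel\<close>. For Borel functions the two agree, and most of the analysis
  takes place there.\<close>

lemma Hs_borel_iff:
  fixes f :: "'a::euclidean_space \<Rightarrow> real"
  assumes [measurable]: "f \<in> borel_measurable borel"
  shows "gagliardo s f \<in> borel_measurable borel"
    and "f \<in> Hs s \<longleftrightarrow> integrable lborel (\<lambda>x. (f x)\<^sup>2) \<and> integrable lborel (gagliardo s f)"
    and "f \<in> Hs s \<Longrightarrow> Hs_norm s f = sqrt (integral\<^sup>L lborel (\<lambda>x. (f x)\<^sup>2) + integral\<^sup>L lborel (gagliardo s f))"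
proof -
  have "gagliardo s f = (\<lambda>p. (f (fst p) - f (snd p))\<^sup>2 / norm (fst p - snd p) powr (real DIM('a) + 2 * s))"
    by (auto simp: gagliardo_def)
  then show [measurable]: "gagliardo s f \<in> borel_measurable borel" by (simp add: borel_prod[symmetric])
  have m: "(\<lambda>x. (norm (f x))\<^sup>2) \<in> borel_measurable lborel" "gagliardo s f \<in> borel_measurable lborel" by auto
  have "f \<in> borel_measurable lebesgue" by (rule measurable_completion) simp
  then show "f \<in> Hs s \<longleftrightarrow> integrable lborel (\<lambda>x. (f x)\<^sup>2) \<and> integrable lborel (gagliardo s f)"
    using integrable_completion[OF m(1)] integrable_completion[OF m(2)] by (simp add: Hs_def)
  show "Hs_norm s f = sqrt (integral\<^sup>L lborel (\<lambda>x. (f x)\<^sup>2) + integral\<^sup>L lborel (gagliardo s f))"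
    using integral_completion[OF m(1)] integral_completion[OF m(2)] by (simp add: Hs_norm_def)
qed

text \<open>Jensen's inequality for the probability density \<rho>, from nonnegativity of the
  variance.\<close>

lemma square_integral_le_integral_square:
  fixes h \<rho> :: "'a::euclidean_space \<Rightarrow> real"
  assumes \<rho>: "integrable lborel \<rho>" "integral\<^sup>L lborel \<rho> = 1" "\<And>z. 0 \<le> \<rho> z"
    and h: "integrable lborel (\<lambda>z. \<rho> z * h z)" "integrable lborel (\<lambda>z. \<rho> z * (h z)\<^sup>2)"
  shows "(LINT z|lborel. \<rho> z * h z)\<^sup>2 \<le> (LINT z|lborel. \<rho> z * (h z)\<^sup>2)"
proof -
  define m where "m = (LINT z|lborel. \<rho> z * h z)"
  have "0 \<le> (LINT z|lborel. \<rho> z * (h z - m)\<^sup>2)" using \<rho>(3) by simp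
  also have "(\<lambda>z. \<rho> z * (h z - m)\<^sup>2) = (\<lambda>z. \<rho> z * (h z)\<^sup>2 - (2 * m) * (\<rho> z * h z) + m\<^sup>2 * \<rho> z)"
    by (auto simp: power2_eq_square algebra_simps)
  also have "(LINT z|lborel. \<rho> z * (h z)\<^sup>2 - (2 * m) * (\<rho> z * h z) + m\<^sup>2 * \<rho> z)
      = (LINT z|lborel. \<rho> z * (h z)\<^sup>2) - 2 * m * m + m\<^sup>2"
    using \<rho> h by (simp add: m_def)
  finally show ?thesis by (simp add: m_def power2_eq_square)
qed

lemma integrable_weighted:
  fixes h \<rho> :: "'a::euclidean_space \<Rightarrow> real"
  assumes "integrable lborel \<rho>" "\<And>z. 0 \<le> \<rho> z" "integrable lborel (\<lambda>z. \<rho> z * (h z)\<^sup>2)"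
    and [measurable]: "h \<in> borel_measurable borel"
  shows "integrable lborel (\<lambda>z. \<rho> z * h z)"
proof (rule Bochner_Integration.integrable_bound)
  show "integrable lborel (\<lambda>z. \<rho> z + \<rho> z * (h z)\<^sup>2)" using assms by simp
  have [measurable]: "\<rho> \<in> borel_measurable borel" using borel_measurable_integrable[OF assms(1)] by simp
  show "(\<lambda>z. \<rho> z * h z) \<in> borel_measurable lborel" by simp
  have "\<bar>h z\<bar> \<le> 1 + (h z)\<^sup>2" for z
    using zero_le_power2[of "\<bar>h z\<bar> - 1"] by (simp add: power2_eq_square algebra_simps)
  then have "\<rho> z * \<bar>h z\<bar> \<le> \<rho> z * (1 + (h z)\<^sup>2)" for z using assms(2) by (rule mult_left_mono)
  then show "AE z in lborel. norm (\<rho> z * h z) \<le> norm (\<rho> z + \<rho> z * (h z)\<^sup>2)"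
    using assms(2) by (auto simp: abs_mult algebra_simps)
qed

text \<open>Jensen in \<open>z\<close>, then an exchange of integrals. The map \<open>T\<close>
  covers two uses: \<open>T z = z\<close> for a function, and \<open>T z = (z, z)\<close> for its
  Gagliardo quotient, which is shifted along the diagonal.\<close>

lemma mollify_L2:
  fixes g :: "'b::euclidean_space \<Rightarrow> real" and \<rho> :: "'a::euclidean_space \<Rightarrow> real" and T :: "'a \<Rightarrow> 'b"
  assumes [measurable]: "g \<in> borel_measurable borel" "T \<in> borel_measurable borel"
    and \<rho>: "integrable lborel \<rho>" "integral\<^sup>L lborel \<rho> = 1" "\<And>z. 0 \<le> \<rho> z" "\<And>z. \<delta> \<le> norm z \<Longrightarrow> \<rho> z = 0"
    and int: "\<And>p. integrable lborel (\<lambda>z. \<rho> z * (g (p - T z))\<^sup>2)"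
    and small: "\<And>z. norm z < \<delta> \<Longrightarrow> (\<integral>\<^sup>+p. ennreal ((g (p - T z) - g p)\<^sup>2) \<partial>lborel) \<le> ennreal e"
  shows "(\<integral>\<^sup>+p. ennreal (((LINT z|lborel. \<rho> z * g (p - T z)) - g p)\<^sup>2) \<partial>lborel) \<le> ennreal e"
proof -
  have [measurable]: "\<rho> \<in> borel_measurable borel" using borel_measurable_integrable[OF \<rho>(1)] by simp
  have pt: "ennreal (((LINT z|lborel. \<rho> z * g (p - T z)) - g p)\<^sup>2)
      \<le> (\<integral>\<^sup>+z. ennreal (\<rho> z * (g (p - T z) - g p)\<^sup>2) \<partial>lborel)" for p
  proof -
    have i1: "integrable lborel (\<lambda>z. \<rho> z * g (p - T z))"
      by (rule integrable_weighted[OF \<rho>(1,3) int]) simp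
    have eq: "(\<lambda>z. \<rho> z * (g (p - T z) - g p)\<^sup>2) = (\<lambda>z. \<rho> z * (g (p - T z))\<^sup>2 - (2 * g p) * (\<rho> z * g (p - T z)) + (g p)\<^sup>2 * \<rho> z)"
      by (auto simp: power2_eq_square algebra_simps)
    have i2: "integrable lborel (\<lambda>z. \<rho> z * (g (p - T z) - g p)\<^sup>2)"
      unfolding eq by (intro Bochner_Integration.integrable_add Bochner_Integration.integrable_diff integrable_mult_right int i1 \<rho>)
    have i3: "integrable lborel (\<lambda>z. \<rho> z * (g (p - T z) - g p))"
      using i1 \<rho>(1) by (simp add: right_diff_distrib)
    have "(LINT z|lborel. \<rho> z * g (p - T z)) - g p = (LINT z|lborel. \<rho> z * (g (p - T z) - g p))"
      using i1 \<rho>(1,2) by (simp add: right_diff_distrib)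
    then have le: "((LINT z|lborel. \<rho> z * g (p - T z)) - g p)\<^sup>2 \<le> (LINT z|lborel. \<rho> z * (g (p - T z) - g p)\<^sup>2)"
      using square_integral_le_integral_square[OF \<rho>(1-3) i3 i2] by simp
    moreover have "ennreal (LINT z|lborel. \<rho> z * (g (p - T z) - g p)\<^sup>2) = (\<integral>\<^sup>+z. ennreal (\<rho> z * (g (p - T z) - g p)\<^sup>2) \<partial>lborel)"
      using i2 \<rho>(3) by (intro nn_integral_eq_integral[symmetric]) auto
    ultimately show ?thesis using ennreal_leI[OF le] by simp
  qed
  have "(\<integral>\<^sup>+p. ennreal (((LINT z|lborel. \<rho> z * g (p - T z)) - g p)\<^sup>2) \<partial>lborel)
      \<le> (\<integral>\<^sup>+p. (\<integral>\<^sup>+z. ennreal (\<rho> z * (g (p - T z) - g p)\<^sup>2) \<partial>lborel) \<partial>lborel)"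
    by (intro nn_integral_mono pt)
  also have "\<dots> = (\<integral>\<^sup>+z. (\<integral>\<^sup>+p. ennreal (\<rho> z * (g (p - T z) - g p)\<^sup>2) \<partial>lborel) \<partial>lborel)"
    by (rule lborel_pair.Fubini'[symmetric]) (simp add: borel_prod[symmetric] case_prod_beta lborel_prod[symmetric])
  also have "\<dots> = (\<integral>\<^sup>+z. ennreal (\<rho> z) * (\<integral>\<^sup>+p. ennreal ((g (p - T z) - g p)\<^sup>2) \<partial>lborel) \<partial>lborel)"
    using \<rho>(3) by (intro nn_integral_cong) (simp add: ennreal_mult nn_integral_cmult)
  also have "\<dots> \<le> (\<integral>\<^sup>+z. ennreal (\<rho> z) * ennreal e \<partial>lborel)"
  proof (rule nn_integral_mono)
    fix z show "ennreal (\<rho> z) * (\<integral>\<^sup>+p. ennreal ((g (p - T z) - g p)\<^sup>2) \<partial>lborel) \<le> ennreal (\<rho> z) * ennreal e"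
      using small[of z] \<rho>(4)[of z] by (cases "norm z < \<delta>") (auto intro: mult_left_mono)
  qed
  also have "\<dots> = (\<integral>\<^sup>+z. ennreal (\<rho> z) \<partial>lborel) * ennreal e" by (simp add: nn_integral_multc)
  also have "(\<integral>\<^sup>+z. ennreal (\<rho> z) \<partial>lborel) = 1"
    using \<rho> by (subst nn_integral_eq_integral) auto
  finally show ?thesis by simp
qed

text \<open>A diagonal shift of \<open>(x, y)\<close> leaves \<open>x - y\<close> unchanged, so
  forming the Gagliardo quotient commutes with mollification. Approximation in \<open>H^s\<close>
  thus becomes two approximations in \<open>L^2\<close>, one for \<open>w\<close> and one for its
  quotient \<open>G\<close>.\<close>

lemma mollify_Hs:
  fixes w :: "'a::euclidean_space \<Rightarrow> real"
  assumes [measurable]: "w \<in> borel_measurable borel" and w: "w \<in> Hs s" and e: "0 < e"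
  shows "\<exists>\<delta>>0. \<forall>\<rho>. integrable lborel \<rho> \<longrightarrow> integral\<^sup>L lborel \<rho> = 1 \<longrightarrow> (\<forall>z. 0 \<le> \<rho> z) \<longrightarrow> (\<forall>z. \<delta> \<le> norm z \<longrightarrow> \<rho> z = 0)
    \<longrightarrow> (\<exists>M. \<forall>z. \<rho> z \<le> M) \<longrightarrow>
    (\<lambda>x. (LINT z|lborel. \<rho> z * w (x - z)) - w x) \<in> Hs s \<and> Hs_norm s (\<lambda>x. (LINT z|lborel. \<rho> z * w (x - z)) - w x) < e"
proof -
  define q where "q = (real DIM('a) + 2 * s) / 2"
  have w2: "integrable lborel (\<lambda>x. (w x)\<^sup>2)" and wg: "integrable lborel (gagliardo s w)"
    using w Hs_borel_iff(2)[of w s] by auto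
  define G where "G p = (w (fst p) - w (snd p)) / norm (fst p - snd p) powr q" for p
  have gag: "gagliardo s f (x, y) = ((f x - f y) / norm (x - y) powr q)\<^sup>2" for f :: "'a \<Rightarrow> real" and x y
  proof -
    have "norm (x - y) powr (real DIM('a) + 2 * s) = (norm (x - y) powr q)\<^sup>2"
      by (simp add: q_def power2_eq_square flip: powr_add)
    then show ?thesis by (simp add: gagliardo_def power_divide)
  qed
  have G2: "(\<lambda>p. (G p)\<^sup>2) = gagliardo s w" by (auto simp: gag G_def)
  have [measurable]: "G \<in> borel_measurable borel" unfolding G_def borel_prod[symmetric] by measurable
  \<comment> \<open>Two squared errors of size \<open>e^2 / 3\<close> leave room for the strict
    inequality.\<close>
  define e' where "e' = e\<^sup>2 / 3"
  have e': "0 < e'" using e by (simp add: e'_def)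
  obtain \<delta>1 where \<delta>1: "0 < \<delta>1" "\<And>t. norm t < \<delta>1 \<Longrightarrow> (\<integral>\<^sup>+x. ennreal ((w (x - t) - w x)\<^sup>2) \<partial>lborel) \<le> ennreal e'"
    using translation_continuous_L2[of w, OF _ w2 e'] by auto
  obtain \<delta>2 where \<delta>2: "0 < \<delta>2" "\<And>t. norm t < \<delta>2 \<Longrightarrow> (\<integral>\<^sup>+x. ennreal ((G (x - t) - G x)\<^sup>2) \<partial>lborel) \<le> ennreal e'"
    using translation_continuous_L2[of G e'] wg e' by (auto simp: G2)
  \<comment> \<open>The half is due to \<open>norm (z, z) \<le> 2 norm z\<close>.\<close>
  define \<delta> where "\<delta> = min \<delta>1 (\<delta>2 / 2)"
  have \<delta>: "0 < \<delta>" using \<delta>1 \<delta>2 by (simp add: \<delta>_def)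
  have "(\<lambda>x. (LINT z|lborel. \<rho> z * w (x - z)) - w x) \<in> Hs s \<and> Hs_norm s (\<lambda>x. (LINT z|lborel. \<rho> z * w (x - z)) - w x) < e"
    if \<rho>: "integrable lborel \<rho>" "integral\<^sup>L lborel \<rho> = 1" "\<And>z. 0 \<le> \<rho> z" "\<And>z. \<delta> \<le> norm z \<Longrightarrow> \<rho> z = 0"
      and M: "\<And>z. \<rho> z \<le> M" for \<rho> :: "'a \<Rightarrow> real" and M
  proof -
    have [measurable]: "\<rho> \<in> borel_measurable borel" using borel_measurable_integrable[OF \<rho>(1)] by simp
    have wshift: "integrable lborel (\<lambda>z. (w (x - z))\<^sup>2)" for x
      using integral_lborel_affine(1)[OF w2, of "-1" x] by simp
    have i1: "integrable lborel (\<lambda>z. \<rho> z * (w (x - z))\<^sup>2)" for x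
      by (rule Bochner_Integration.integrable_bound[OF integrable_mult_right[OF wshift, of M x]])
        (use \<rho>(3) M in \<open>auto simp: abs_mult intro!: mult_right_mono order_trans[OF M]\<close>)
    have i1': "integrable lborel (\<lambda>z. \<rho> z * w (x - z))" for x
      by (rule integrable_weighted[OF \<rho>(1,3) i1]) simp
    have i2: "integrable lborel (\<lambda>z. \<rho> z * (G (p - (z, z)))\<^sup>2)" for p
    proof (rule Bochner_Integration.integrable_bound)
      \<comment> \<open>For fixed \<open>p\<close> the denominator of the quotient does not depend
        on \<open>z\<close>; on the diagonal it is 0 and \<open>k\<close> is 0 by the convention for
        division.\<close>
      define k where "k = 1 / (norm (fst p - snd p) powr q)\<^sup>2"
      show "integrable lborel (\<lambda>z. (2 * k) * (\<rho> z * (w (fst p - z))\<^sup>2 + \<rho> z * (w (snd p - z))\<^sup>2))"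
        by (intro integrable_mult_right Bochner_Integration.integrable_add i1)
      show "AE z in lborel. norm (\<rho> z * (G (p - (z, z)))\<^sup>2)
          \<le> norm ((2 * k) * (\<rho> z * (w (fst p - z))\<^sup>2 + \<rho> z * (w (snd p - z))\<^sup>2))"
      proof (rule AE_I2)
        fix z
        have "(w (fst p - z) - w (snd p - z))\<^sup>2 \<le> 2 * ((w (fst p - z))\<^sup>2 + (w (snd p - z))\<^sup>2)"
          using zero_le_power2[of "w (fst p - z) + w (snd p - z)"] by (simp add: power2_eq_square algebra_simps)
        then have "(\<rho> z * k) * (w (fst p - z) - w (snd p - z))\<^sup>2 \<le> (\<rho> z * k) * (2 * ((w (fst p - z))\<^sup>2 + (w (snd p - z))\<^sup>2))"
          using \<rho>(3) by (intro mult_left_mono) (auto simp: k_def)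
        also have "(\<rho> z * k) * (w (fst p - z) - w (snd p - z))\<^sup>2 = \<rho> z * (G (p - (z, z)))\<^sup>2"
          by (simp add: G_def k_def power_divide)
        also have "(\<rho> z * k) * (2 * ((w (fst p - z))\<^sup>2 + (w (snd p - z))\<^sup>2))
            = (2 * k) * (\<rho> z * (w (fst p - z))\<^sup>2 + \<rho> z * (w (snd p - z))\<^sup>2)"
          by (simp add: algebra_simps)
        finally have "\<rho> z * (G (p - (z, z)))\<^sup>2 \<le> (2 * k) * (\<rho> z * (w (fst p - z))\<^sup>2 + \<rho> z * (w (snd p - z))\<^sup>2)" .
        moreover have "0 \<le> \<rho> z * (G (p - (z, z)))\<^sup>2" using \<rho>(3) by simp
        ultimately show "norm (\<rho> z * (G (p - (z, z)))\<^sup>2)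
          \<le> norm ((2 * k) * (\<rho> z * (w (fst p - z))\<^sup>2 + \<rho> z * (w (snd p - z))\<^sup>2))"
          unfolding real_norm_def by linarith
      qed
      have "(\<lambda>z. p - (z, z)) \<in> borel_measurable borel" by (intro borel_measurable_continuous_onI continuous_intros)
      note [measurable] = this
      show "(\<lambda>z. \<rho> z * (G (p - (z, z)))\<^sup>2) \<in> borel_measurable lborel" by measurable
    qed
    define h where "h x = (LINT z|lborel. \<rho> z * w (x - z)) - w x" for x
    have [measurable]: "h \<in> borel_measurable borel" unfolding h_def by measurable
    have 1: "(\<integral>\<^sup>+x. ennreal ((h x)\<^sup>2) \<partial>lborel) \<le> ennreal e'"
      unfolding h_def using mollify_L2[of w "\<lambda>z. z" \<rho> \<delta> e', OF _ _ \<rho> i1] \<delta>1(2) by (simp add: \<delta>_def)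
    have hG: "((h x - h y) / norm (x - y) powr q) = (LINT z|lborel. \<rho> z * G ((x, y) - (z, z))) - G (x, y)" for x y
    proof -
      have "(LINT z|lborel. \<rho> z * G ((x, y) - (z, z))) = (LINT z|lborel. (\<rho> z * w (x - z) - \<rho> z * w (y - z)) / norm (x - y) powr q)"
        by (simp add: G_def right_diff_distrib)
      also have "\<dots> = ((LINT z|lborel. \<rho> z * w (x - z)) - (LINT z|lborel. \<rho> z * w (y - z))) / norm (x - y) powr q"
        using i1' by simp
      finally show ?thesis by (simp add: h_def G_def diff_divide_distrib)
    qed
    have "gagliardo s h p = ((LINT z|lborel. \<rho> z * G (p - (z, z))) - G p)\<^sup>2" for p
      by (cases p) (simp only: gag hG)
    moreover have "(\<integral>\<^sup>+p. ennreal (((LINT z|lborel. \<rho> z * G (p - (z, z))) - G p)\<^sup>2) \<partial>lborel) \<le> ennreal e'"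
    proof (rule mollify_L2[OF _ _ \<rho> i2])
      show "(\<lambda>z. (z, z)) \<in> borel_measurable (borel :: 'a measure)"
        by (intro borel_measurable_continuous_onI continuous_intros)
      fix z :: 'a assume "norm z < \<delta>"
      moreover have "norm (z, z) \<le> norm z + norm z" by (rule norm_Pair_le)
      ultimately show "(\<integral>\<^sup>+p. ennreal ((G (p - (z, z)) - G p)\<^sup>2) \<partial>lborel) \<le> ennreal e'"
        by (intro \<delta>2(2)) (simp add: \<delta>_def)
    qed simp
    ultimately have 2: "(\<integral>\<^sup>+p. ennreal (gagliardo s h p) \<partial>lborel) \<le> ennreal e'" by simp
    have [measurable]: "gagliardo s h \<in> borel_measurable borel" by (rule Hs_borel_iff(1)) simp
    have gpos: "0 \<le> gagliardo s h p" for p by (cases p) (simp add: gag)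
    have j1: "integrable lborel (\<lambda>x. (h x)\<^sup>2)"
      using 1 by (intro integrableI_nonneg) (auto intro: le_less_trans)
    have j2: "integrable lborel (gagliardo s h)"
      using 2 gpos by (intro integrableI_nonneg) (auto intro: le_less_trans)
    have hs: "h \<in> Hs s" using j1 j2 Hs_borel_iff(2)[of h s] by simp
    have "integral\<^sup>L lborel (\<lambda>x. (h x)\<^sup>2) \<le> e'"
      using 1 nn_integral_eq_integral[OF j1] e' by (simp add: ennreal_le_iff)
    moreover have "integral\<^sup>L lborel (gagliardo s h) \<le> e'"
      using 2 nn_integral_eq_integral[OF j2] gpos e' by (simp add: ennreal_le_iff)
    ultimately have "integral\<^sup>L lborel (\<lambda>x. (h x)\<^sup>2) + integral\<^sup>L lborel (gagliardo s h) < e\<^sup>2"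
      using e' e'_def by linarith
    then have "sqrt (integral\<^sup>L lborel (\<lambda>x. (h x)\<^sup>2) + integral\<^sup>L lborel (gagliardo s h)) < sqrt (e\<^sup>2)"
      by (rule real_sqrt_less_mono)
    then have "Hs_norm s h < e" using e hs Hs_borel_iff(3)[of h s] by simp
    with hs show ?thesis unfolding h_def by blast
  qed
  with \<delta> show ?thesis by blast
qed

text \<open>The mollification radius is limited twice: by the distance of \<open>K\<close> to the
  complement of \<Omega>, which keeps the support inside, and by the tolerance in
  \<open>H^s\<close>. Compactness of \<open>K\<close> also makes the square integrable
  \<open>w\<close> integrable.\<close>

lemma Hs_test_function_approx:
  fixes w :: "'a::euclidean_space \<Rightarrow> real"
  assumes w_meas [measurable]: "w \<in> borel_measurable borel" and w: "w \<in> Hs s" and \<Omega>: "open \<Omega>"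
    and K: "compact K" "K \<subseteq> \<Omega>" "\<And>x. x \<notin> K \<Longrightarrow> w x = 0" and pos: "\<And>x. 0 \<le> w x" and e: "0 < e"
  shows "\<exists>\<psi>\<in>test_functions \<Omega>. (\<forall>x. 0 \<le> \<psi> x) \<and> \<psi> \<in> borel_measurable borel \<and>
    (\<lambda>x. \<psi> x - w x) \<in> Hs s \<and> Hs_norm s (\<lambda>x. \<psi> x - w x) < e"
proof -
  obtain \<delta>1 where \<delta>1: "0 < \<delta>1" "(\<Union>x\<in>K. cball x \<delta>1) \<subseteq> \<Omega>"
    using compact_subset_open_imp_cball_epsilon_subset[OF K(1) \<Omega> K(2)] by blast
  obtain \<delta>2 where \<delta>2: "0 < \<delta>2" "\<And>\<rho> M. integrable lborel \<rho> \<Longrightarrow> integral\<^sup>L lborel \<rho> = 1 \<Longrightarrow> (\<And>z. 0 \<le> \<rho> z) \<Longrightarrow>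
      (\<And>z. \<delta>2 \<le> norm z \<Longrightarrow> \<rho> z = 0) \<Longrightarrow> (\<And>z. \<rho> z \<le> M) \<Longrightarrow>
    (\<lambda>x. (LINT z|lborel. \<rho> z * w (x - z)) - w x) \<in> Hs s \<and> Hs_norm s (\<lambda>x. (LINT z|lborel. \<rho> z * w (x - z)) - w x) < e"
    using mollify_Hs[OF w_meas w e] by blast
  define \<delta> where "\<delta> = min \<delta>1 \<delta>2"
  have \<delta>: "0 < \<delta>" using \<delta>1 \<delta>2 by (simp add: \<delta>_def)
  obtain S M and \<rho> :: "'a \<Rightarrow> real" where S: "derivative_closed S" "\<rho> \<in> S"
    and \<rho>: "\<And>x. 0 \<le> \<rho> x" "\<And>x. \<rho> x \<le> M" "\<And>x. \<delta> \<le> norm x \<Longrightarrow> \<rho> x = 0" "\<rho> \<in> borel_measurable borel"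
    "integrable lborel \<rho>" "integral\<^sup>L lborel \<rho> = 1"
    using mollifier_exists[OF \<delta>] by metis
  note [measurable] = \<rho>(4)
  define \<psi> where "\<psi> x = (LINT z|lborel. \<rho> z * w (x - z))" for x
  have w2: "integrable lborel (\<lambda>x. (w x)\<^sup>2)" using w Hs_borel_iff(2)[of w s] by auto
  have wi: "integrable lborel w"
  proof (rule Bochner_Integration.integrable_bound)
    show "integrable lborel (\<lambda>x. indicator K x + (w x)\<^sup>2)"
      using w2 emeasure_compact_finite[OF K(1)] K(1)
      by (intro Bochner_Integration.integrable_add integrable_real_indicator) (auto simp: borel_compact)
    have "\<bar>w x\<bar> \<le> 1 + (w x)\<^sup>2" for x
      using zero_le_power2[of "w x - 1"] pos[of x] by (simp add: power2_eq_square algebra_simps)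
    then show "AE x in lborel. norm (w x) \<le> norm (indicator K x + (w x)\<^sup>2)"
      using K(3) by (auto simp: indicator_def)
  qed simp
  \<comment> \<open>The defining form shifts \<open>w\<close> and suits the \<open>H^s\<close>
    estimate; this form has \<open>x\<close> only in the smooth factor and suits
    differentiation.\<close>
  have conv: "\<psi> x = (LINT y|lborel. \<rho> (x - y) * w y)" for x
  proof -
    have "integrable lborel (\<lambda>y. \<rho> (x - y) * w y)"
    proof (rule Bochner_Integration.integrable_bound)
      show "integrable lborel (\<lambda>y. M * w y)" using wi by simp
      have "0 \<le> M" using \<rho>(1,2)[of 0] by linarith
      then show "AE y in lborel. norm (\<rho> (x - y) * w y) \<le> norm (M * w y)"
        using \<rho>(1,2) pos by (auto simp: abs_mult intro!: mult_right_mono)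
    qed simp
    from integral_lborel_affine(2)[OF this, of "-1" x] show ?thesis by (simp add: \<psi>_def)
  qed
  have Ck: "C_k k \<psi>" for k
    using derivative_closed_convolution[OF S(1) wi S(2), of k] by (simp add: conv[abs_def])
  define L where "L = (\<Union>x\<in>K. cball x \<delta>)"
  have cL: "compact L" unfolding L_def using K(1) by (rule compact_minkowski_sum_cball)
  have L\<Omega>: "L \<subseteq> \<Omega>" using \<delta>1(2) unfolding L_def \<delta>_def by force
  have "\<psi> x = 0" if "x \<notin> L" for x
  proof -
    have "\<rho> (x - y) * w y = 0" for y
      using that \<rho>(3)[of "x - y"] K(3)[of y] by (cases "y \<in> K") (auto simp: L_def dist_norm norm_minus_commute not_le less_imp_le)
    then show ?thesis by (simp only: conv) simp
  qed
  then have sub: "closure {x. \<psi> x \<noteq> 0} \<subseteq> L"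
    using cL by (intro closure_minimal) (auto simp: compact_imp_closed)
  show ?thesis
  proof (intro bexI[of _ \<psi>] conjI allI)
    have "compact (closure {x. \<psi> x \<noteq> 0})"
      using sub cL by (meson closed_closure compact_Int_closed compact_closure compact_imp_bounded bounded_subset closure_subset)
    then show "\<psi> \<in> test_functions \<Omega>" using Ck sub L\<Omega> by (auto simp: test_functions_def)
    show "0 \<le> \<psi> x" for x unfolding \<psi>_def using \<rho>(1) pos by (intro integral_nonneg_AE) auto
    show "\<psi> \<in> borel_measurable borel" unfolding \<psi>_def by measurable
    have "\<And>z. \<delta>2 \<le> norm z \<Longrightarrow> \<rho> z = 0" using \<rho>(3) by (simp add: \<delta>_def)
    from \<delta>2(2)[OF \<rho>(5,6,1) this \<rho>(2)]
    show "(\<lambda>x. \<psi> x - w x) \<in> Hs s" "Hs_norm s (\<lambda>x. \<psi> x - w x) < e" by (auto simp: \<psi>_def)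
  qed
qed

text \<open>This makes the cut-off negative part admissible in the weak formulation. The quotient
  norm on \<Omega> is an infimum over extensions, and \<open>w - \<psi>\<close> is one of
  them.\<close>

lemma compact_supported_in_Hs0_on:
  fixes w :: "'a::euclidean_space \<Rightarrow> real"
  assumes w_meas [measurable]: "w \<in> borel_measurable borel" and w: "w \<in> Hs s" and \<Omega>: "open \<Omega>"
    and K: "compact K" "K \<subseteq> \<Omega>" "\<And>x. x \<notin> K \<Longrightarrow> w x = 0" and pos: "\<And>x. 0 \<le> w x"
  shows "w \<in> Hs0_on s \<Omega>"
proof -
  have "w \<in> Hs_extensions s \<Omega> w" using w by (simp add: Hs_extensions_def)
  moreover have "\<exists>\<psi> \<in> test_functions \<Omega>. Hs_on_norm s \<Omega> (\<lambda>x. w x - \<psi> x) < e" if e: "0 < e" for e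
  proof -
    obtain \<psi> where \<psi>: "\<psi> \<in> test_functions \<Omega>" "\<psi> \<in> borel_measurable borel"
      "(\<lambda>x. \<psi> x - w x) \<in> Hs s" "Hs_norm s (\<lambda>x. \<psi> x - w x) < e"
      using Hs_test_function_approx[OF assms e] by blast
    note [measurable] = \<psi>(2)
    have "gagliardo s (\<lambda>x. w x - \<psi> x) = gagliardo s (\<lambda>x. \<psi> x - w x)"
    proof (rule ext)
      fix p :: "'a \<times> 'a"
      obtain x y where "p = (x, y)" by (cases p)
      moreover have "((w x - \<psi> x) - (w y - \<psi> y))\<^sup>2 = ((\<psi> x - w x) - (\<psi> y - w y))\<^sup>2"
        by (simp add: power2_eq_square algebra_simps)
      ultimately show "gagliardo s (\<lambda>x. w x - \<psi> x) p = gagliardo s (\<lambda>x. \<psi> x - w x) p"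
        by (simp add: gagliardo_def)
    qed
    moreover have "(\<lambda>x. (w x - \<psi> x)\<^sup>2) = (\<lambda>x. (\<psi> x - w x)\<^sup>2)" by (simp add: power2_commute)
    ultimately have ext: "(\<lambda>x. w x - \<psi> x) \<in> Hs_extensions s \<Omega> (\<lambda>x. w x - \<psi> x)"
      and n: "Hs_norm s (\<lambda>x. w x - \<psi> x) < e"
      using \<psi>(3,4) Hs_borel_iff(2)[of "\<lambda>x. \<psi> x - w x" s] Hs_borel_iff(2)[of "\<lambda>x. w x - \<psi> x" s]
      by (auto simp: Hs_extensions_def Hs_norm_def)
    have gpos: "0 \<le> gagliardo s f p" for f :: "'a \<Rightarrow> real" and p by (cases p) (simp add: gagliardo_def)
    have "bdd_below (Hs_norm s ` Hs_extensions s \<Omega> (\<lambda>x. w x - \<psi> x))"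
      by (rule bdd_belowI[of _ 0]) (auto simp: Hs_norm_def gpos intro!: integral_nonneg_AE add_nonneg_nonneg)
    then have "Hs_on_norm s \<Omega> (\<lambda>x. w x - \<psi> x) \<le> Hs_norm s (\<lambda>x. w x - \<psi> x)"
      unfolding Hs_on_norm_def using ext by (rule cINF_lower)
    with n have "Hs_on_norm s \<Omega> (\<lambda>x. w x - \<psi> x) < e" by simp
    with \<psi>(1) show ?thesis by blast
  qed
  ultimately show ?thesis unfolding Hs0_on_def Hs_on_def by blast
qed

section \<open>Cutoffs and the Riesz kernel\<close>

text \<open>The kernel of the Dirichlet form of the fractional Laplacian, without its constant. On
  the diagonal its value is 0, because \<open>0 powr a = 0\<close> and
  \<open>1 / 0 = 0\<close>.\<close>

definition riesz :: "real \<Rightarrow> 'a::euclidean_space \<Rightarrow> 'a \<Rightarrow> real" where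
  "riesz s x y = 1 / norm (x - y) powr (real DIM('a) + 2 * s)"

text \<open>Measuring to the complement rather than to the frontier gives a function that is
  1-Lipschitz on the whole space and vanishes off \<Omega>.\<close>

definition bdist :: "'a::euclidean_space set \<Rightarrow> 'a \<Rightarrow> real" where
  "bdist \<Omega> x = infdist x (- \<Omega>)"

text \<open>A ramp from 0 at distance \<epsilon> to 1 at distance \<open>2 \<epsilon>\<close>.
  Lipschitz regularity is enough: multiplication by it preserves \<open>H^s\<close>, and smoothness
  of test functions comes from mollification.\<close>

definition cutoff :: "'a::euclidean_space set \<Rightarrow> real \<Rightarrow> 'a \<Rightarrow> real" where
  "cutoff \<Omega> \<epsilon> x = min 1 (max 0 (bdist \<Omega> x / \<epsilon> - 1))"

lemma riesz_nonneg [simp]: "0 \<le> riesz s x y" by (simp add: riesz_def)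
lemma riesz_refl [simp]: "riesz s x x = 0" by (simp add: riesz_def)
lemma riesz_commute: "riesz s x y = riesz s y x" by (simp add: riesz_def norm_minus_commute)

lemma riesz_measurable [measurable]:
  assumes [measurable]: "f \<in> borel_measurable M" "g \<in> borel_measurable M"
  shows "(\<lambda>x. riesz s (f x) (g x)) \<in> borel_measurable M"
  unfolding riesz_def by measurable

lemma measurable_fst_borel [measurable]:
  fixes f :: "'a::euclidean_space \<Rightarrow> 'c::topological_space"
  assumes [measurable]: "f \<in> borel_measurable borel"
  shows "(\<lambda>p :: 'a \<times> 'a. f (fst p)) \<in> borel_measurable borel" "(\<lambda>p :: 'a \<times> 'a. f (snd p)) \<in> borel_measurable borel"
  unfolding borel_prod[symmetric] by measurable

lemma nn_integral_lborel_pair: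
  fixes f :: "'a::euclidean_space \<times> 'b::euclidean_space \<Rightarrow> ennreal"
  assumes "f \<in> borel_measurable borel"
  shows "(\<integral>\<^sup>+p. f p \<partial>lborel) = (\<integral>\<^sup>+x. \<integral>\<^sup>+y. f (x, y) \<partial>lborel \<partial>lborel)"
  using lborel.nn_integral_fst[of f "lborel :: 'a measure"] assms by (simp add: lborel_prod)

lemma lborel_swap:
  fixes f :: "'a::euclidean_space \<times> 'a \<Rightarrow> real"
  assumes "integrable lborel f"
  shows "integrable lborel (\<lambda>p. f (snd p, fst p))" "(LINT p|lborel. f (snd p, fst p)) = integral\<^sup>L lborel f"
proof -
  have f: "integrable (lborel \<Otimes>\<^sub>M lborel) f" using assms by (simp add: lborel_prod)
  show "integrable lborel (\<lambda>p. f (snd p, fst p))"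
    using lborel_pair.integrable_product_swap[OF f] by (simp add: lborel_prod case_prod_unfold)
  show "(LINT p|lborel. f (snd p, fst p)) = integral\<^sup>L lborel f"
    using lborel_pair.integral_product_swap[of f] f by (simp add: lborel_prod case_prod_unfold)
qed

lemma bdist_lipschitz: "\<bar>bdist \<Omega> x - bdist \<Omega> y\<bar> \<le> norm (x - y)"
  unfolding bdist_def using infdist_triangle_abs[of x "- \<Omega>" y] by (simp add: dist_norm)

lemma bdist_nonneg [simp]: "0 \<le> bdist \<Omega> x" by (simp add: bdist_def infdist_nonneg)

lemma bdist_eq_0: "x \<notin> \<Omega> \<Longrightarrow> bdist \<Omega> x = 0" by (simp add: bdist_def)

lemma bdist_le_dist: "y \<notin> \<Omega> \<Longrightarrow> bdist \<Omega> x \<le> norm (x - y)"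
  unfolding bdist_def using infdist_le[of y "- \<Omega>" x] by (simp add: dist_norm)

text \<open>\<open>infdist\<close> to the empty set is 0 by convention, so \<open>bdist\<close>
  could not be positive without this.\<close>

lemma bounded_Compl_nonempty:
  fixes \<Omega> :: "'a::euclidean_space set"
  assumes "bounded \<Omega>"
  shows "- \<Omega> \<noteq> {}"
  using assms not_bounded_UNIV by (metis Compl_empty_eq double_complement)

lemma bdist_pos:
  fixes \<Omega> :: "'a::euclidean_space set"
  assumes "open \<Omega>" "bounded \<Omega>" "x \<in> \<Omega>"
  shows "0 < bdist \<Omega> x"
  unfolding bdist_def using assms bounded_Compl_nonempty[OF assms(2)]
  by (metis ComplD closed_Compl infdist_nonneg in_closed_iff_infdist_zero less_eq_real_def)

lemma bdist_measurable [measurable]: "bdist \<Omega> \<in> borel_measurable borel"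
  unfolding bdist_def by (intro borel_measurable_continuous_onI continuous_intros)

lemma cutoff_bounds [simp]: "0 \<le> cutoff \<Omega> \<epsilon> x" "cutoff \<Omega> \<epsilon> x \<le> 1"
  by (auto simp: cutoff_def)

lemma cutoff_measurable [measurable]: "cutoff \<Omega> \<epsilon> \<in> borel_measurable borel"
  unfolding cutoff_def by measurable

lemma cutoff_eq_0: "0 < \<epsilon> \<Longrightarrow> bdist \<Omega> x \<le> \<epsilon> \<Longrightarrow> cutoff \<Omega> \<epsilon> x = 0"
  by (auto simp: cutoff_def max_def field_simps)

lemma cutoff_lipschitz:
  assumes "0 < \<epsilon>"
  shows "\<bar>cutoff \<Omega> \<epsilon> x - cutoff \<Omega> \<epsilon> y\<bar> \<le> norm (x - y) / \<epsilon>"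
proof -
  have "\<bar>bdist \<Omega> x / \<epsilon> - bdist \<Omega> y / \<epsilon>\<bar> = \<bar>bdist \<Omega> x - bdist \<Omega> y\<bar> / \<epsilon>"
    using assms by (simp flip: diff_divide_distrib)
  also have "\<dots> \<le> norm (x - y) / \<epsilon>"
    using assms bdist_lipschitz by (intro divide_right_mono) auto
  finally have "\<bar>bdist \<Omega> x / \<epsilon> - bdist \<Omega> y / \<epsilon>\<bar> \<le> norm (x - y) / \<epsilon>" .
  moreover have "\<bar>min 1 (max 0 (a - 1)) - min 1 (max 0 (b - 1))\<bar> \<le> \<bar>a - b\<bar>" for a b :: real
    by linarith
  ultimately show ?thesis unfolding cutoff_def by (rule order_trans[rotated])
qed

lemma cutoff_increment_sq:
  assumes "0 < \<epsilon>"
  shows "(cutoff \<Omega> \<epsilon> x - cutoff \<Omega> \<epsilon> y)\<^sup>2 \<le> min 1 ((norm (x - y))\<^sup>2 / \<epsilon>\<^sup>2)"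
proof -
  have "\<bar>cutoff \<Omega> \<epsilon> x - cutoff \<Omega> \<epsilon> y\<bar>\<^sup>2 \<le> (norm (x - y) / \<epsilon>)\<^sup>2"
    by (rule power_mono[OF cutoff_lipschitz[OF assms]]) simp
  moreover have "\<bar>cutoff \<Omega> \<epsilon> x - cutoff \<Omega> \<epsilon> y\<bar> \<le> 1"
    using cutoff_bounds[of \<Omega> \<epsilon> x] cutoff_bounds[of \<Omega> \<epsilon> y] by linarith
  ultimately show ?thesis by (simp add: power_divide abs_square_le_1)
qed

lemma cutoff_antimono:
  assumes "0 < \<epsilon>" "\<epsilon> \<le> \<epsilon>'"
  shows "cutoff \<Omega> \<epsilon>' x \<le> cutoff \<Omega> \<epsilon> x"
proof -
  have "bdist \<Omega> x / \<epsilon>' \<le> bdist \<Omega> x / \<epsilon>" using assms by (intro divide_left_mono) auto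
  then show ?thesis unfolding cutoff_def by (intro min.mono max.mono) auto
qed

text \<open>The point of this choice of cutoff: the bound does not depend on \<open>\<epsilon>\<close>.\<close>

lemma cutoff_increment:
  assumes \<epsilon>: "0 < \<epsilon>" and lt: "cutoff \<Omega> \<epsilon> y \<le> cutoff \<Omega> \<epsilon> x" and pos: "0 < bdist \<Omega> x"
  shows "(cutoff \<Omega> \<epsilon> x - cutoff \<Omega> \<epsilon> y)\<^sup>2 \<le> min 1 ((norm (x - y))\<^sup>2 / (bdist \<Omega> x / 4)\<^sup>2)"
proof -
  define \<Delta> where "\<Delta> = cutoff \<Omega> \<epsilon> x - cutoff \<Omega> \<epsilon> y"
  have 0: "0 \<le> \<Delta>" and 1: "\<Delta> \<le> 1"
    using lt cutoff_bounds(1)[of \<Omega> \<epsilon> y] cutoff_bounds(2)[of \<Omega> \<epsilon> x] unfolding \<Delta>_def by linarith+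
  have "\<Delta> \<le> norm (x - y) / (bdist \<Omega> x / 4)"
  proof (cases "\<Delta> = 0")
    case False
    have lip: "\<Delta> \<le> norm (x - y) / \<epsilon>" using cutoff_lipschitz[OF \<epsilon>, of \<Omega> x y] by (simp add: \<Delta>_def)
    \<comment> \<open>Up to distance \<open>4 \<epsilon>\<close> the Lipschitz constant
      \<open>1 / \<epsilon>\<close> is at most \<open>4 / bdist \<Omega> x\<close>. Farther in, a
      nonzero increment puts \<open>y\<close> within \<open>2 \<epsilon>\<close> of the complement,
      so \<open>x\<close> and \<open>y\<close> are far apart and the trivial bound 1
      suffices.\<close>
    show ?thesis
    proof (cases "bdist \<Omega> x \<le> 4 * \<epsilon>")
      case True
      then have "norm (x - y) / \<epsilon> \<le> norm (x - y) / (bdist \<Omega> x / 4)"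
        using pos \<epsilon> by (intro divide_left_mono) auto
      with lip show ?thesis by simp
    next
      case far: False
      have "cutoff \<Omega> \<epsilon> y < 1" using False 0 cutoff_bounds(2)[of \<Omega> \<epsilon> x] unfolding \<Delta>_def by linarith
      then have "bdist \<Omega> y < 2 * \<epsilon>" using \<epsilon> by (auto simp: cutoff_def min_def max_def field_simps split: if_splits)
      then have "bdist \<Omega> x / 4 \<le> norm (x - y)" using bdist_lipschitz[of \<Omega> x y] far by linarith
      then have "1 \<le> norm (x - y) / (bdist \<Omega> x / 4)" using pos by simp
      with 1 show ?thesis by linarith
    qed
  qed (use pos in simp)
  then have "\<Delta>\<^sup>2 \<le> (norm (x - y) / (bdist \<Omega> x / 4))\<^sup>2" using 0 by (intro power_mono)
  moreover have "\<Delta>\<^sup>2 \<le> 1" using 0 1 by (simp add: power_le_one)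
  ultimately show ?thesis by (simp add: \<Delta>_def power_divide)
qed

lemma cutoff_support:
  fixes \<Omega> :: "'a::euclidean_space set"
  assumes "open \<Omega>" "bounded \<Omega>" "0 < \<epsilon>"
  shows "compact {x. \<epsilon> \<le> bdist \<Omega> x}" "{x. \<epsilon> \<le> bdist \<Omega> x} \<subseteq> \<Omega>"
proof -
  show sub: "{x. \<epsilon> \<le> bdist \<Omega> x} \<subseteq> \<Omega>" using bdist_eq_0[of _ \<Omega>] assms(3) by force
  have "closed {x. \<epsilon> \<le> bdist \<Omega> x}"
    unfolding bdist_def by (intro closed_Collect_le continuous_intros)
  then show "compact {x. \<epsilon> \<le> bdist \<Omega> x}"
    using bounded_subset[OF assms(2) sub] by (simp add: compact_eq_bounded_closed)
qed

lemma cutoff_tendsto: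
  fixes \<Omega> :: "'a::euclidean_space set"
  assumes "open \<Omega>" "bounded \<Omega>" "x \<in> \<Omega>"
  shows "eventually (\<lambda>j. cutoff \<Omega> (inverse (real (Suc j))) x = 1) sequentially"
proof -
  have d: "0 < bdist \<Omega> x" by (rule bdist_pos[OF assms])
  have "eventually (\<lambda>j. inverse (real (Suc j)) < bdist \<Omega> x / 2) sequentially"
    using LIMSEQ_inverse_real_of_nat d by (intro order_tendstoD(2)) auto
  then show ?thesis
  proof eventually_elim
    case (elim j)
    then have "2 \<le> bdist \<Omega> x / inverse (real (Suc j))" by (simp add: field_simps)
    then show ?case by (simp add: cutoff_def)
  qed
qed

text \<open>Next to the boundary point nearest to \<open>x\<close>, at distance \<open>d\<close>,
  sits an exterior ball of radius comparable to \<open>d\<close>. It lies within \<open>2 d\<close>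
  of \<open>x\<close>, so it contributes about \<open>d^n\<close> times
  \<open>d powr (- (n + 2 s))\<close>.\<close>

lemma exterior_kernel_lower_bound:
  fixes \<Omega> :: "'a::euclidean_space set"
  assumes dom: "bounded_Lipschitz_domain \<Omega>" and s: "0 < s"
  obtains c0 where "0 < c0"
    "\<And>x. x \<in> \<Omega> \<Longrightarrow> ennreal (c0 * bdist \<Omega> x powr (- 2 * s)) \<le> (\<integral>\<^sup>+y. ennreal (indicator (- \<Omega>) y * riesz s x y) \<partial>lborel)"
proof -
  have op: "open \<Omega>" and bd: "bounded \<Omega>" using dom by (auto simp: bounded_Lipschitz_domain_def)
  obtain \<rho> \<theta> where \<rho>: "0 < \<rho>" "0 < \<theta>" "\<theta> < 1"
    and ball: "\<And>p t. p \<in> frontier \<Omega> \<Longrightarrow> 0 < t \<Longrightarrow> t \<le> \<rho> \<Longrightarrow> \<exists>q. ball q (\<theta> * t) \<subseteq> ball p t - \<Omega>"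
    using bounded_Lipschitz_domain_exterior_balls[OF dom] by blast
  obtain R0 where R0: "\<And>x. x \<in> \<Omega> \<Longrightarrow> norm x \<le> R0" using bd unfolding bounded_iff by blast
  obtain p0 where p0: "p0 \<notin> \<Omega>" using bounded_Compl_nonempty[OF bd] by auto
  define R where "R = \<bar>R0\<bar> + norm p0 + 1"
  have R: "bdist \<Omega> x \<le> R" if "x \<in> \<Omega>" for x
    using bdist_le_dist[OF p0, of x] R0[OF that] norm_triangle_ineq4[of x p0] by (auto simp: R_def)
  have R': "0 < R" unfolding R_def using norm_ge_zero[of p0] by linarith
  \<comment> \<open>Exterior balls are available only up to scale \<rho>, whereas \<open>d\<close>
    can be as large as \<open>R\<close>; the factor \<tau> shrinks \<open>d\<close> to an admissible
    scale while keeping it comparable to \<open>d\<close>.\<close>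
  define \<tau> where "\<tau> = min 1 (\<rho> / R)"
  have \<tau>: "0 < \<tau>" "\<tau> \<le> 1" using \<rho> R' by (auto simp: \<tau>_def)
  define n where "n = real DIM('a)"
  define V where "V = unit_ball_vol n"
  have V: "0 < V" by (simp add: V_def n_def)
  define c0 where "c0 = V * (\<theta> * \<tau>) powr n * 2 powr (- (n + 2 * s))"
  have "ennreal (c0 * bdist \<Omega> x powr (- 2 * s)) \<le> (\<integral>\<^sup>+y. ennreal (indicator (- \<Omega>) y * riesz s x y) \<partial>lborel)"
    if x: "x \<in> \<Omega>" for x
  proof -
    define d where "d = bdist \<Omega> x"
    have d: "0 < d" unfolding d_def by (rule bdist_pos[OF op bd x])
    obtain p where p: "p \<in> - \<Omega>" "d = dist x p"
      using infdist_attains_inf[of "- \<Omega>" x] op bounded_Compl_nonempty[OF bd] by (auto simp: d_def bdist_def)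
    have "ball x d \<subseteq> \<Omega>"
    proof
      fix y assume "y \<in> ball x d"
      then show "y \<in> \<Omega>" using bdist_le_dist[of y \<Omega> x] by (force simp: d_def dist_norm)
    qed
    then have "closure (ball x d) \<subseteq> closure \<Omega>" by (rule closure_mono)
    then have "p \<in> closure \<Omega>" using p d by auto
    then have pf: "p \<in> frontier \<Omega>" using p op by (simp add: frontier_def interior_open)
    define t where "t = \<tau> * d"
    have t: "0 < t" "t \<le> d" using \<tau> d by (auto simp: t_def)
    have "\<tau> * d \<le> \<rho> / R * R" using R[OF x] \<tau> \<rho> d by (intro mult_mono) (auto simp: \<tau>_def d_def)
    then have "t \<le> \<rho>" using R' by (simp add: t_def)
    with ball[OF pf t(1)] obtain q where q: "ball q (\<theta> * t) \<subseteq> ball p t - \<Omega>" by blast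
    have Kb: "(2 * d) powr (- (n + 2 * s)) \<le> riesz s x y" if "y \<in> ball q (\<theta> * t)" for y
    proof -
      have "y \<in> ball p t" "y \<notin> \<Omega>" using q that by auto
      then have "norm (x - y) \<le> 2 * d" using p t dist_triangle[of x y p] by (simp add: dist_norm)
      moreover have "0 < norm (x - y)" using \<open>y \<notin> \<Omega>\<close> x by auto
      ultimately have "(2 * d) powr (- (n + 2 * s)) \<le> norm (x - y) powr (- (n + 2 * s))"
        using s by (intro powr_mono2') (auto simp: n_def)
      also have "norm (x - y) powr (- (n + 2 * s)) = riesz s x y"
        unfolding riesz_def n_def by (rule powr_minus_divide)
      finally show ?thesis .
    qed
    have "ennreal (c0 * d powr (- 2 * s)) = ennreal ((2 * d) powr (- (n + 2 * s))) * emeasure lborel (ball q (\<theta> * t))"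
    proof -
      have "emeasure lborel (ball q (\<theta> * t)) = ennreal (V * (\<theta> * t) powr n)"
        using \<rho> t by (simp add: emeasure_ball V_def n_def powr_realpow)
      moreover have "(2 * d) powr (- (n + 2 * s)) * (V * (\<theta> * t) powr n) = c0 * d powr (- 2 * s)"
      proof -
        have "(2 * d) powr (- (n + 2 * s)) * (V * (\<theta> * t) powr n)
          = V * (\<theta> * \<tau>) powr n * 2 powr (- (n + 2 * s)) * (d powr (- (n + 2 * s)) * d powr n)"
          using d \<tau> \<rho> by (simp add: t_def powr_mult mult_ac)
        also have "d powr (- (n + 2 * s)) * d powr n = d powr (- 2 * s)" by (simp flip: powr_add)
        finally show ?thesis by (simp add: c0_def)
      qed
      ultimately show ?thesis by (simp add: ennreal_mult'[symmetric])
    qed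
    also have "\<dots> = (\<integral>\<^sup>+y. ennreal ((2 * d) powr (- (n + 2 * s))) * indicator (ball q (\<theta> * t)) y \<partial>lborel)"
      by (subst nn_integral_cmult_indicator) auto
    also have "\<dots> \<le> (\<integral>\<^sup>+y. ennreal (indicator (- \<Omega>) y * riesz s x y) \<partial>lborel)"
      using Kb q by (intro nn_integral_mono) (auto simp: indicator_def intro!: ennreal_leI)
    finally show ?thesis by (simp add: d_def)
  qed
  moreover have "0 < c0" using V \<rho> \<tau> by (simp add: c0_def)
  ultimately show ?thesis using that by blast
qed

section \<open>The energy argument\<close>

text \<open>The truncation radius may vary with \<open>x\<close>, and \<open>J\<close> is fixed
  before \<open>v\<close> and \<open>r\<close>. It is used with constant radius \<epsilon>, giving
  integrability for one cutoff, and with a quarter of the distance to the complement, giving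
  estimates uniform in the cutoff.\<close>

lemma weighted_kernel_integral:
  assumes s: "0 < s" "s < 1"
  obtains J where "0 \<le> J" "\<And>v r. v \<in> borel_measurable borel \<Longrightarrow> r \<in> borel_measurable borel \<Longrightarrow>
    (\<And>x. 0 \<le> v x) \<Longrightarrow> (\<And>x. v x \<noteq> 0 \<Longrightarrow> 0 < r x) \<Longrightarrow>
    integrable lborel (\<lambda>x. v x * r x powr (- 2 * s)) \<Longrightarrow>
    has_bochner_integral lborel (\<lambda>p :: 'a::euclidean_space \<times> 'a. v (fst p) *
      (min 1 ((norm (fst p - snd p))\<^sup>2 / (r (fst p))\<^sup>2) * riesz s (fst p) (snd p)))
      (J * (LINT x|lborel. v x * r x powr (- 2 * s)))"
proof -
  obtain J where J: "0 \<le> J" "\<And>r (x::'a). 0 < r \<Longrightarrow>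
    (\<integral>\<^sup>+y. ennreal (min 1 ((norm (x - y))\<^sup>2 / r\<^sup>2) / norm (x - y) powr (real DIM('a) + 2 * s)) \<partial>lborel)
      = ennreal (J * r powr (- 2 * s))"
    by (rule truncated_kernel_bound[OF s]) blast
  show ?thesis
  proof (rule that[OF J(1)])
    fix v r :: "'a \<Rightarrow> real"
    assume [measurable]: "v \<in> borel_measurable borel" "r \<in> borel_measurable borel"
      and v: "\<And>x. 0 \<le> v x" "\<And>x. v x \<noteq> 0 \<Longrightarrow> 0 < r x"
      and int: "integrable lborel (\<lambda>x. v x * r x powr (- 2 * s))"
    let ?f = "\<lambda>p :: 'a \<times> 'a. v (fst p) * (min 1 ((norm (fst p - snd p))\<^sup>2 / (r (fst p))\<^sup>2) * riesz s (fst p) (snd p))"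
    have m: "?f \<in> borel_measurable borel" unfolding borel_prod[symmetric] by measurable
    have "(\<integral>\<^sup>+p. ennreal (?f p) \<partial>lborel) = (\<integral>\<^sup>+x. \<integral>\<^sup>+y. ennreal (?f (x, y)) \<partial>lborel \<partial>lborel)"
      by (rule nn_integral_lborel_pair) (use m in simp)
    also have "\<dots> = (\<integral>\<^sup>+x. ennreal (J * (v x * r x powr (- 2 * s))) \<partial>lborel)"
    proof (rule nn_integral_cong)
      fix x :: 'a
      show "(\<integral>\<^sup>+y. ennreal (?f (x, y)) \<partial>lborel) = ennreal (J * (v x * r x powr (- 2 * s)))"
      proof (cases "v x = 0")
        case False
        have "(\<integral>\<^sup>+y. ennreal (?f (x, y)) \<partial>lborel) = (\<integral>\<^sup>+y. ennreal (v x) *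
            ennreal (min 1 ((norm (x - y))\<^sup>2 / (r x)\<^sup>2) / norm (x - y) powr (real DIM('a) + 2 * s)) \<partial>lborel)"
          using v(1) by (simp add: riesz_def ennreal_mult[symmetric])
        also have "\<dots> = ennreal (v x) * ennreal (J * r x powr (- 2 * s))"
          using J(2)[OF v(2)[OF False]] by (subst nn_integral_cmult) auto
        finally show ?thesis using v(1) J(1) by (simp add: ennreal_mult[symmetric] mult_ac)
      qed simp
    qed
    also have "\<dots> = ennreal (LINT x|lborel. J * (v x * r x powr (- 2 * s)))"
      using int J(1) v(1) by (intro nn_integral_eq_integral) auto
    finally show "has_bochner_integral lborel ?f (J * (LINT x|lborel. v x * r x powr (- 2 * s)))"
      using m v(1) J(1) by (intro has_bochner_integral_nn_integral) auto
  qed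
qed

lemma integrable_truncated_kernel:
  fixes v :: "'a::euclidean_space \<Rightarrow> real"
  assumes s: "0 < s" "s < 1" and [measurable]: "v \<in> borel_measurable borel"
    and v: "integrable lborel (\<lambda>x. (v x)\<^sup>2)" and \<epsilon>: "0 < \<epsilon>"
  shows "integrable lborel (\<lambda>p :: 'a \<times> 'a. (v (fst p))\<^sup>2 *
    (min 1 ((norm (fst p - snd p))\<^sup>2 / \<epsilon>\<^sup>2) * riesz s (fst p) (snd p)))"
proof (rule weighted_kernel_integral[OF s, where 'a = 'a])
  fix J
  assume "\<And>v r. v \<in> borel_measurable borel \<Longrightarrow> r \<in> borel_measurable borel \<Longrightarrow>
    (\<And>x. 0 \<le> v x) \<Longrightarrow> (\<And>x. v x \<noteq> 0 \<Longrightarrow> 0 < r x) \<Longrightarrow>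
    integrable lborel (\<lambda>x. v x * r x powr (- 2 * s)) \<Longrightarrow>
    has_bochner_integral lborel (\<lambda>p :: 'a \<times> 'a. v (fst p) *
      (min 1 ((norm (fst p - snd p))\<^sup>2 / (r (fst p))\<^sup>2) * riesz s (fst p) (snd p)))
      (J * (LINT x|lborel. v x * r x powr (- 2 * s)))"
  from this[of "\<lambda>x. (v x)\<^sup>2" "\<lambda>_. \<epsilon>"] show ?thesis
    using v \<epsilon> by (auto simp: has_bochner_integral_iff)
qed

text \<open>Split into \<open>(\<alpha> - \<beta>) g^2\<close> and
  \<open>\<alpha> (h - g) (h + g)\<close>. As \<open>h\<close> is the larger cutoff value,
  \<open>h + g \<le> 2 h\<close>, so the increment is weighted by \<open>\<alpha> h\<close>, the
  function after the cutoff, and not by \<alpha> alone.\<close>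

lemma product_increment_bound:
  fixes \<alpha> \<beta> g h m :: real
  assumes "0 \<le> g" "g \<le> h" "h \<le> 1" "(h - g)\<^sup>2 \<le> m"
  shows "(\<alpha> * h\<^sup>2 - \<beta> * g\<^sup>2)\<^sup>2 \<le> 2 * (\<alpha> - \<beta>)\<^sup>2 + 8 * ((\<alpha> * h)\<^sup>2 * m)"
proof -
  define X Y where "X = (\<alpha> - \<beta>) * g\<^sup>2" and "Y = \<alpha> * (h\<^sup>2 - g\<^sup>2)"
  have "(X + Y)\<^sup>2 \<le> 2 * X\<^sup>2 + 2 * Y\<^sup>2"
    using zero_le_power2[of "X - Y"] by (simp add: power2_eq_square algebra_simps)
  moreover have "(\<alpha> * h\<^sup>2 - \<beta> * g\<^sup>2)\<^sup>2 = (X + Y)\<^sup>2" by (simp add: X_def Y_def algebra_simps)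
  moreover have "X\<^sup>2 \<le> (\<alpha> - \<beta>)\<^sup>2"
  proof -
    have "(g\<^sup>2)\<^sup>2 \<le> 1" using assms by (simp add: power_le_one)
    then have "(\<alpha> - \<beta>)\<^sup>2 * (g\<^sup>2)\<^sup>2 \<le> (\<alpha> - \<beta>)\<^sup>2 * 1" by (intro mult_left_mono) auto
    then show ?thesis by (simp add: X_def power_mult_distrib)
  qed
  moreover have "Y\<^sup>2 \<le> 4 * ((\<alpha> * h)\<^sup>2 * m)"
  proof -
    have "(h + g)\<^sup>2 \<le> (2 * h)\<^sup>2" using assms by (intro power_mono) auto
    then have "(h - g)\<^sup>2 * (h + g)\<^sup>2 \<le> m * (2 * h)\<^sup>2"
      using assms order_trans[OF zero_le_power2 assms(4)] by (intro mult_mono) auto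
    then have "\<alpha>\<^sup>2 * ((h - g)\<^sup>2 * (h + g)\<^sup>2) \<le> \<alpha>\<^sup>2 * (m * (2 * h)\<^sup>2)" by (intro mult_left_mono) auto
    moreover have "h\<^sup>2 - g\<^sup>2 = (h - g) * (h + g)" by (simp add: power2_eq_square algebra_simps)
    ultimately show ?thesis by (simp add: Y_def power_mult_distrib mult_ac)
  qed
  ultimately show ?thesis by linarith
qed

lemma young_scaled:
  fixes t u M :: real
  assumes "0 < M"
  shows "- (t * u) \<le> M / 2 * t\<^sup>2 + 1 / (2 * M) * u\<^sup>2"
proof -
  have "0 \<le> (M * t + u)\<^sup>2 / (2 * M)" using assms by simp
  also have "(M * t + u)\<^sup>2 / (2 * M) = M / 2 * t\<^sup>2 + t * u + 1 / (2 * M) * u\<^sup>2"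
    using assms by (simp add: power2_eq_square field_simps)
  finally show ?thesis by simp
qed

text \<open>The potential enters only through \<open>k\<close>. An upper bound on \<open>k\<close>
  is asked for inside \<Omega> alone, since the interaction with the complement has a good sign and
  is used from below.\<close>

lemma energy_rigidity:
  fixes \<Omega> :: "'a::euclidean_space set" and a :: "'a \<Rightarrow> real" and k :: "'a \<times> 'a \<Rightarrow> real"
  assumes dom: "bounded_Lipschitz_domain \<Omega>" and s: "0 < s" "s < 1"
    and [measurable]: "k \<in> borel_measurable borel" "a \<in> borel_measurable borel"
    and c: "0 < c" and k_low: "\<And>x y. c * riesz s x y \<le> k (x, y)"
    and k_high: "\<And>x y. x \<in> \<Omega> \<Longrightarrow> y \<in> \<Omega> \<Longrightarrow> k (x, y) \<le> C * riesz s x y" and C: "0 \<le> C"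
    and a_nonneg: "\<And>x. 0 \<le> a x" and a_zero: "\<And>x. x \<notin> \<Omega> \<Longrightarrow> a x = 0"
    and a2: "integrable lborel (\<lambda>x. (a x)\<^sup>2)"
    and a_semi: "integrable lborel (\<lambda>p. indicator (\<Omega> \<times> \<Omega>) p * ((a (fst p) - a (snd p))\<^sup>2 * riesz s (fst p) (snd p)))"
    and energy: "\<And>\<epsilon>. 0 < \<epsilon> \<Longrightarrow> integrable lborel (\<lambda>p. k p * ((a (fst p) - a (snd p)) *
        (a (fst p) * (cutoff \<Omega> \<epsilon> (fst p))\<^sup>2 - a (snd p) * (cutoff \<Omega> \<epsilon> (snd p))\<^sup>2)))"
      "\<And>\<epsilon>. 0 < \<epsilon> \<Longrightarrow> (LINT p|lborel. k p * ((a (fst p) - a (snd p)) *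
        (a (fst p) * (cutoff \<Omega> \<epsilon> (fst p))\<^sup>2 - a (snd p) * (cutoff \<Omega> \<epsilon> (snd p))\<^sup>2))) \<le> 0"
  shows "AE x in lborel. a x = 0"
proof -
  have op: "open \<Omega>" and bd: "bounded \<Omega>" using dom by (auto simp: bounded_Lipschitz_domain_def)
  have [measurable]: "\<Omega> \<in> sets borel" using op by auto
  have [measurable]: "\<Omega> \<times> \<Omega> \<in> sets (borel :: ('a \<times> 'a) measure)" using op by (intro borel_open open_Times)
  obtain c0 where c0: "0 < c0"
    "\<And>x. x \<in> \<Omega> \<Longrightarrow> ennreal (c0 * bdist \<Omega> x powr (- 2 * s)) \<le> (\<integral>\<^sup>+y. ennreal (indicator (- \<Omega>) y * riesz s x y) \<partial>lborel)"
    by (rule exterior_kernel_lower_bound[OF dom s(1)]) blast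
  obtain J where J: "0 \<le> J" "\<And>v r. v \<in> borel_measurable borel \<Longrightarrow> r \<in> borel_measurable borel \<Longrightarrow>
    (\<And>x. 0 \<le> v x) \<Longrightarrow> (\<And>x. v x \<noteq> 0 \<Longrightarrow> 0 < r x) \<Longrightarrow>
    integrable lborel (\<lambda>x. v x * r x powr (- 2 * s)) \<Longrightarrow>
    has_bochner_integral lborel (\<lambda>p :: 'a \<times> 'a. v (fst p) *
      (min 1 ((norm (fst p - snd p))\<^sup>2 / (r (fst p))\<^sup>2) * riesz s (fst p) (snd p)))
      (J * (LINT x|lborel. v x * r x powr (- 2 * s)))"
    by (rule weighted_kernel_integral[OF s]) blast
  define D where "D x = bdist \<Omega> x powr (- 2 * s)" for x
  have [measurable]: "D \<in> borel_measurable borel" unfolding D_def by measurable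
  have D0: "0 \<le> D x" for x by (simp add: D_def)
  define \<mu> where "\<mu> x y = min 1 ((norm (x - y))\<^sup>2 / (bdist \<Omega> x / 4)\<^sup>2) * riesz s x y" for x y :: 'a
  have \<mu>0: "0 \<le> \<mu> x y" for x y by (simp add: \<mu>_def)
  have a_pos: "0 < bdist \<Omega> x" if "a x \<noteq> 0" for x
    using a_zero[of x] that bdist_pos[OF op bd] by blast
  \<comment> \<open>The power of 4 comes from using a quarter of the distance as truncation
    radius.\<close>
  define J' where "J' = J * 4 powr (2 * s)"
  have J'0: "0 \<le> J'" using J(1) by (simp add: J'_def)
  have mu_int: "has_bochner_integral lborel (\<lambda>p :: 'a \<times> 'a. (v (fst p))\<^sup>2 * \<mu> (fst p) (snd p)) (J' * (LINT x|lborel. (v x)\<^sup>2 * D x))"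
    if [measurable]: "v \<in> borel_measurable borel" and v: "\<And>x. v x \<noteq> 0 \<Longrightarrow> 0 < bdist \<Omega> x"
      and int: "integrable lborel (\<lambda>x. (v x)\<^sup>2 * D x)" for v
  proof -
    have eq: "(bdist \<Omega> x / 4) powr (- 2 * s) = 4 powr (2 * s) * D x" for x
      using powr_divide[of "bdist \<Omega> x" 4 "- 2 * s"] by (simp add: D_def powr_minus_divide field_simps)
    have eq': "(\<lambda>x. (v x)\<^sup>2 * (bdist \<Omega> x / 4) powr (- 2 * s)) = (\<lambda>x. 4 powr (2 * s) * ((v x)\<^sup>2 * D x))"
      by (rule ext, subst eq, rule mult.left_commute)
    have "has_bochner_integral lborel (\<lambda>p :: 'a \<times> 'a. (v (fst p))\<^sup>2 *
      (min 1 ((norm (fst p - snd p))\<^sup>2 / (bdist \<Omega> (fst p) / 4)\<^sup>2) * riesz s (fst p) (snd p)))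
      (J * (LINT x|lborel. (v x)\<^sup>2 * (bdist \<Omega> x / 4) powr (- 2 * s)))"
    proof (rule J(2)[of "\<lambda>x. (v x)\<^sup>2" "\<lambda>x. bdist \<Omega> x / 4"])
      show "integrable lborel (\<lambda>x. (v x)\<^sup>2 * (bdist \<Omega> x / 4) powr (- 2 * s))" unfolding eq' using int by simp
    qed (use v in auto)
    moreover have "(LINT x|lborel. (v x)\<^sup>2 * (bdist \<Omega> x / 4) powr (- 2 * s)) = 4 powr (2 * s) * (LINT x|lborel. (v x)\<^sup>2 * D x)"
      unfolding eq' by simp
    ultimately show ?thesis by (simp add: J'_def \<mu>_def mult_ac)
  qed
  define w where "w \<epsilon> x = a x * cutoff \<Omega> \<epsilon> x" for \<epsilon> x
  have [measurable]: "w \<epsilon> \<in> borel_measurable borel" for \<epsilon> unfolding w_def by measurable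
  have w_pos: "\<epsilon> < bdist \<Omega> x" if "0 < \<epsilon>" "w \<epsilon> x \<noteq> 0" for \<epsilon> x
    using cutoff_eq_0[OF that(1), of \<Omega> x] that(2) by (force simp: w_def)
  have w_le: "(w \<epsilon> x)\<^sup>2 \<le> (a x)\<^sup>2" for \<epsilon> x
    unfolding w_def power_mult_distrib using mult_left_mono[of "(cutoff \<Omega> \<epsilon> x)\<^sup>2" 1 "(a x)\<^sup>2"] by (simp add: power_le_one)
  have w2: "integrable lborel (\<lambda>x. (w \<epsilon> x)\<^sup>2)" for \<epsilon>
    by (rule Bochner_Integration.integrable_bound[OF a2]) (use w_le in auto)
  \<comment> \<open>Finiteness only: this bound blows up as \<epsilon> tends to 0. The uniform bound
    has to come from the energy.\<close>
  have w2D: "integrable lborel (\<lambda>x. (w \<epsilon> x)\<^sup>2 * D x)" if \<epsilon>: "0 < \<epsilon>" for \<epsilon>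
  proof (rule Bochner_Integration.integrable_bound)
    show "integrable lborel (\<lambda>x. \<epsilon> powr (- 2 * s) * (w \<epsilon> x)\<^sup>2)" using w2 by simp
    have "(w \<epsilon> x)\<^sup>2 * D x \<le> \<epsilon> powr (- 2 * s) * (w \<epsilon> x)\<^sup>2" for x
    proof (cases "w \<epsilon> x = 0")
      case False
      have "D x \<le> \<epsilon> powr (- 2 * s)"
        unfolding D_def using w_pos[OF \<epsilon> False] \<epsilon> s by (intro powr_mono2') auto
      then have "D x * (w \<epsilon> x)\<^sup>2 \<le> \<epsilon> powr (- 2 * s) * (w \<epsilon> x)\<^sup>2" by (rule mult_right_mono) simp
      then show ?thesis by (subst mult.commute)
    qed simp
    then show "AE x in lborel. norm ((w \<epsilon> x)\<^sup>2 * D x) \<le> norm (\<epsilon> powr (- 2 * s) * (w \<epsilon> x)\<^sup>2)"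
      using D0 by (auto simp: abs_mult)
  qed simp
  define N where "N \<epsilon> = (LINT x|lborel. (w \<epsilon> x)\<^sup>2 * D x)" for \<epsilon>
  have N0: "0 \<le> N \<epsilon>" for \<epsilon> unfolding N_def using D0 by (intro integral_nonneg_AE) auto
  \<comment> \<open>Roles: \<open>I1\<close> is the coercive interaction with the complement,
    \<open>I2\<close> the cost of cutoff increments, \<open>I3\<close> the seminorm inside \<Omega>,
    \<open>P\<close> the energy density, and \<open>Q\<close> the error in the exact
    identity.\<close>
  define I1 where "I1 \<epsilon> p = (w \<epsilon> (fst p))\<^sup>2 * (indicator (- \<Omega>) (snd p) * riesz s (fst p) (snd p))" for \<epsilon> and p :: "'a \<times> 'a"
  define I2 where "I2 \<epsilon> p = (w \<epsilon> (fst p))\<^sup>2 * \<mu> (fst p) (snd p)" for \<epsilon> and p :: "'a \<times> 'a"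
  define I3 where "I3 p = indicator (\<Omega> \<times> \<Omega>) p * ((a (fst p) - a (snd p))\<^sup>2 * riesz s (fst p) (snd p))" for p :: "'a \<times> 'a"
  define P where "P \<epsilon> p = k p * ((a (fst p) - a (snd p)) *
        (a (fst p) * (cutoff \<Omega> \<epsilon> (fst p))\<^sup>2 - a (snd p) * (cutoff \<Omega> \<epsilon> (snd p))\<^sup>2))" for \<epsilon> and p :: "'a \<times> 'a"
  define Q where "Q \<epsilon> p = indicator (\<Omega> \<times> \<Omega>) p * (a (fst p) * a (snd p) * (cutoff \<Omega> \<epsilon> (fst p) - cutoff \<Omega> \<epsilon> (snd p))\<^sup>2
      * riesz s (fst p) (snd p))" for \<epsilon> and p :: "'a \<times> 'a"
  have I1_meas [measurable]: "I1 \<epsilon> \<in> borel_measurable borel" for \<epsilon>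
    unfolding I1_def borel_prod[symmetric] by measurable
  have Q_meas [measurable]: "Q \<epsilon> \<in> borel_measurable borel" for \<epsilon>
    unfolding Q_def by measurable
  have I1_int: "integrable lborel (I1 \<epsilon>)" if \<epsilon>: "0 < \<epsilon>" for \<epsilon>
  proof (rule Bochner_Integration.integrable_bound)
    show "integrable lborel (\<lambda>p :: 'a \<times> 'a. (w \<epsilon> (fst p))\<^sup>2 *
      (min 1 ((norm (fst p - snd p))\<^sup>2 / \<epsilon>\<^sup>2) * riesz s (fst p) (snd p)))"
      using s w2 \<epsilon> by (intro integrable_truncated_kernel) auto
    have "I1 \<epsilon> (x, y) \<le> (w \<epsilon> x)\<^sup>2 * (min 1 ((norm (x - y))\<^sup>2 / \<epsilon>\<^sup>2) * riesz s x y)" for x y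
    proof (cases "w \<epsilon> x = 0 \<or> y \<in> \<Omega>")
      case False
      \<comment> \<open>For \<open>x\<close> in the support of \<open>w \<epsilon>\<close> and
        \<open>y\<close> outside \<Omega> the truncation is inactive, so \<open>I1\<close> is below
        a truncated kernel.\<close>
      then have "\<epsilon> \<le> norm (x - y)" using w_pos[OF \<epsilon>, of x] bdist_le_dist[of y \<Omega> x] by simp
      then have "\<epsilon>\<^sup>2 \<le> (norm (x - y))\<^sup>2" using \<epsilon> by (intro power_mono) auto
      then have "min 1 ((norm (x - y))\<^sup>2 / \<epsilon>\<^sup>2) = 1" using \<epsilon> by simp
      then show ?thesis using False by (simp add: I1_def)
    qed (auto simp: I1_def)
    then show "AE p in lborel. norm (I1 \<epsilon> p) \<le> norm ((w \<epsilon> (fst p))\<^sup>2 *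
      (min 1 ((norm (fst p - snd p))\<^sup>2 / \<epsilon>\<^sup>2) * riesz s (fst p) (snd p)))"
      by (intro AE_I2) (auto simp: I1_def)
  qed simp
  have I1_low: "c0 * N \<epsilon> \<le> integral\<^sup>L lborel (I1 \<epsilon>)" if \<epsilon>: "0 < \<epsilon>" for \<epsilon>
  proof -
    have "ennreal (c0 * N \<epsilon>) = (\<integral>\<^sup>+x. ennreal (c0 * ((w \<epsilon> x)\<^sup>2 * D x)) \<partial>lborel)"
      unfolding N_def using w2D[OF \<epsilon>] c0 D0 by (subst nn_integral_eq_integral) auto
    also have "\<dots> \<le> (\<integral>\<^sup>+x. \<integral>\<^sup>+y. ennreal (I1 \<epsilon> (x, y)) \<partial>lborel \<partial>lborel)"
    proof (rule nn_integral_mono)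
      fix x :: 'a
      show "ennreal (c0 * ((w \<epsilon> x)\<^sup>2 * D x)) \<le> (\<integral>\<^sup>+y. ennreal (I1 \<epsilon> (x, y)) \<partial>lborel)"
      proof (cases "x \<in> \<Omega>")
        case True
        have "ennreal (c0 * ((w \<epsilon> x)\<^sup>2 * D x)) = ennreal ((w \<epsilon> x)\<^sup>2) * ennreal (c0 * D x)"
          using D0 c0 by (simp add: ennreal_mult[symmetric] mult_ac)
        also have "\<dots> \<le> ennreal ((w \<epsilon> x)\<^sup>2) * (\<integral>\<^sup>+y. ennreal (indicator (- \<Omega>) y * riesz s x y) \<partial>lborel)"
          using c0(2)[OF True] by (intro mult_left_mono) (auto simp: D_def)
        also have "\<dots> = (\<integral>\<^sup>+y. ennreal (I1 \<epsilon> (x, y)) \<partial>lborel)"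
          by (subst nn_integral_cmult[symmetric]) (auto simp: I1_def ennreal_mult)
        finally show ?thesis .
      qed (simp add: w_def a_zero)
    qed
    also have "\<dots> = (\<integral>\<^sup>+p. ennreal (I1 \<epsilon> p) \<partial>lborel)"
      by (rule nn_integral_lborel_pair[symmetric]) simp
    also have "\<dots> = ennreal (integral\<^sup>L lborel (I1 \<epsilon>))"
      by (rule nn_integral_eq_integral[OF I1_int[OF \<epsilon>]]) (auto simp: I1_def)
    finally show ?thesis by (subst (asm) ennreal_le_iff) (auto simp: I1_def intro!: integral_nonneg_AE)
  qed
  have I2_int: "has_bochner_integral lborel (I2 \<epsilon>) (J' * N \<epsilon>)" if \<epsilon>: "0 < \<epsilon>" for \<epsilon>
    unfolding I2_def[abs_def] N_def using w_pos[OF \<epsilon>] \<epsilon> by (intro mu_int w2D) (auto intro: less_trans)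
  have I3_int: "integrable lborel I3" unfolding I3_def[abs_def] by (rule a_semi)
  have k0: "0 \<le> k (x, y)" for x y
    using k_low[of x y] c riesz_nonneg[of s x y] by (meson less_imp_le mult_nonneg_nonneg order_trans)
  have outside: "c * I1 \<epsilon> (x, y) \<le> P \<epsilon> (x, y)" if "\<not> (x \<in> \<Omega> \<and> y \<in> \<Omega>)" for \<epsilon> x y
  proof (cases "x \<in> \<Omega>")
    case True
    then have y: "y \<notin> \<Omega>" using that by simp
    have "c * riesz s x y * (w \<epsilon> x)\<^sup>2 \<le> k (x, y) * (w \<epsilon> x)\<^sup>2" using k_low by (intro mult_right_mono) auto
    then show ?thesis using y by (simp add: I1_def P_def a_zero w_def power_mult_distrib power2_eq_square mult_ac)
  next
    case False
    then have "P \<epsilon> (x, y) = k (x, y) * (a y * cutoff \<Omega> \<epsilon> y)\<^sup>2"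
      by (simp add: P_def a_zero power2_eq_square mult_ac)
    then show ?thesis using False k0 by (simp add: I1_def a_zero w_def)
  qed
  have incr: "(cutoff \<Omega> \<epsilon> x - cutoff \<Omega> \<epsilon> y)\<^sup>2 * riesz s x y \<le> \<mu> x y"
    if "0 < \<epsilon>" "x \<in> \<Omega>" "cutoff \<Omega> \<epsilon> y \<le> cutoff \<Omega> \<epsilon> x" for \<epsilon> x y
    unfolding \<mu>_def using cutoff_increment[OF that(1,3) bdist_pos[OF op bd that(2)]] by (intro mult_right_mono) auto
  \<comment> \<open>Stated over plain reals so that the bulky products below enter the linear
    arithmetic as atoms.\<close>
  have arith1: "U \<le> 2 * T + 8 * V \<Longrightarrow> V \<le> X \<Longrightarrow> 0 \<le> Y \<Longrightarrow> U \<le> 2 * T + 8 * (X + Y)"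
    and arith2: "U \<le> 2 * T + 8 * V \<Longrightarrow> V \<le> Y \<Longrightarrow> 0 \<le> X \<Longrightarrow> U \<le> 2 * T + 8 * (X + Y)"
    and arith3: "U \<le> 2 * T + V \<Longrightarrow> T \<le> X \<Longrightarrow> V \<le> W \<Longrightarrow> 0 \<le> Y \<Longrightarrow> U \<le> W + 2 * (X + Y)"
    and arith4: "U \<le> 2 * T + V \<Longrightarrow> T \<le> Y \<Longrightarrow> V \<le> W \<Longrightarrow> 0 \<le> X \<Longrightarrow> U \<le> W + 2 * (X + Y)"
    for U V W X Y T :: real by auto
  \<comment> \<open>With \<open>t\<close> and \<open>u\<close> the two increments, Young bounds
    \<open>- t u\<close> by \<open>M/2 t^2 + 1/(2 M) u^2\<close>, and \<open>u^2\<close> costs at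
    most \<open>2 t^2\<close> plus 8 times the cutoff terms; this gives \<open>M/2 + 1/M\<close> and
    \<open>4/M\<close>. A large \<open>M\<close> makes the cutoff terms cheap at the expense of the
    fixed seminorm.\<close>
  have P_low1: "c * I1 \<epsilon> (x, y) - C * ((M / 2 + 1 / M) * I3 (x, y) + (4 / M) * (I2 \<epsilon> (x, y) + I2 \<epsilon> (y, x))) \<le> P \<epsilon> (x, y)"
    if \<epsilon>: "0 < \<epsilon>" and M: "0 < M" for \<epsilon> M x y
  proof -
    have I20: "0 \<le> I2 \<epsilon> p" for p using \<mu>0 by (simp add: I2_def)
    have I30: "0 \<le> I3 p" for p by (simp add: I3_def)
    show ?thesis
    proof (cases "x \<in> \<Omega> \<and> y \<in> \<Omega>")
      case False
      have "0 \<le> C * ((M / 2 + 1 / M) * I3 (x, y) + (4 / M) * (I2 \<epsilon> (x, y) + I2 \<epsilon> (y, x)))"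
        using C M I20 I30 by (intro mult_nonneg_nonneg add_nonneg_nonneg) auto
      with outside[OF False, of \<epsilon>] show ?thesis by linarith
    next
      case True
      define t where "t = a x - a y"
      define u where "u = a x * (cutoff \<Omega> \<epsilon> x)\<^sup>2 - a y * (cutoff \<Omega> \<epsilon> y)\<^sup>2"
      let ?K = "riesz s x y"
      have u: "u\<^sup>2 * ?K \<le> 2 * (t\<^sup>2 * ?K) + 8 * (I2 \<epsilon> (x, y) + I2 \<epsilon> (y, x))"
      proof (cases "cutoff \<Omega> \<epsilon> y \<le> cutoff \<Omega> \<epsilon> x")
        case le: True
        have "u\<^sup>2 \<le> 2 * t\<^sup>2 + 8 * ((w \<epsilon> x)\<^sup>2 * (cutoff \<Omega> \<epsilon> x - cutoff \<Omega> \<epsilon> y)\<^sup>2)"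
          unfolding u_def t_def w_def using le by (intro product_increment_bound) auto
        then have "u\<^sup>2 * ?K \<le> (2 * t\<^sup>2 + 8 * ((w \<epsilon> x)\<^sup>2 * (cutoff \<Omega> \<epsilon> x - cutoff \<Omega> \<epsilon> y)\<^sup>2)) * ?K"
          by (intro mult_right_mono) auto
        also have "\<dots> = 2 * (t\<^sup>2 * ?K) + 8 * ((w \<epsilon> x)\<^sup>2 * ((cutoff \<Omega> \<epsilon> x - cutoff \<Omega> \<epsilon> y)\<^sup>2 * ?K))"
          by (simp add: algebra_simps)
        finally have "u\<^sup>2 * ?K \<le> 2 * (t\<^sup>2 * ?K) + 8 * ((w \<epsilon> x)\<^sup>2 * ((cutoff \<Omega> \<epsilon> x - cutoff \<Omega> \<epsilon> y)\<^sup>2 * riesz s x y))" .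
        moreover have "(w \<epsilon> x)\<^sup>2 * ((cutoff \<Omega> \<epsilon> x - cutoff \<Omega> \<epsilon> y)\<^sup>2 * ?K) \<le> I2 \<epsilon> (x, y)"
          unfolding I2_def using incr[OF \<epsilon> _ le] True by (auto intro!: mult_left_mono)
        ultimately show ?thesis using I20[of "(y, x)"] by (rule arith1)
      next
        case False
        then have le: "cutoff \<Omega> \<epsilon> x \<le> cutoff \<Omega> \<epsilon> y" by simp
        have "(- u)\<^sup>2 \<le> 2 * (- t)\<^sup>2 + 8 * ((w \<epsilon> y)\<^sup>2 * (cutoff \<Omega> \<epsilon> y - cutoff \<Omega> \<epsilon> x)\<^sup>2)"
          unfolding u_def t_def w_def minus_diff_eq using le by (intro product_increment_bound) auto
        then have "u\<^sup>2 * ?K \<le> (2 * t\<^sup>2 + 8 * ((w \<epsilon> y)\<^sup>2 * (cutoff \<Omega> \<epsilon> y - cutoff \<Omega> \<epsilon> x)\<^sup>2)) * ?K"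
          by (intro mult_right_mono) auto
        also have "\<dots> = 2 * (t\<^sup>2 * ?K) + 8 * ((w \<epsilon> y)\<^sup>2 * ((cutoff \<Omega> \<epsilon> y - cutoff \<Omega> \<epsilon> x)\<^sup>2 * riesz s y x))"
          by (simp add: algebra_simps riesz_commute[of s x y])
        finally have "u\<^sup>2 * ?K \<le> 2 * (t\<^sup>2 * ?K) + 8 * ((w \<epsilon> y)\<^sup>2 * ((cutoff \<Omega> \<epsilon> y - cutoff \<Omega> \<epsilon> x)\<^sup>2 * riesz s y x))" .
        moreover have "(w \<epsilon> y)\<^sup>2 * ((cutoff \<Omega> \<epsilon> y - cutoff \<Omega> \<epsilon> x)\<^sup>2 * riesz s y x) \<le> I2 \<epsilon> (y, x)"
          unfolding I2_def using incr[OF \<epsilon> _ le] True by (auto intro!: mult_left_mono)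
        ultimately show ?thesis using I20[of "(x, y)"] by (rule arith2)
      qed
      define Y where "Y = M / 2 * t\<^sup>2 + 1 / (2 * M) * u\<^sup>2"
      have Y: "- (t * u) \<le> Y" "0 \<le> Y" using young_scaled[OF M, of t u] M by (auto simp: Y_def)
      have "- P \<epsilon> (x, y) = k (x, y) * (- (t * u))" by (simp add: P_def t_def u_def)
      also have "\<dots> \<le> k (x, y) * Y" using Y k0 by (intro mult_left_mono) auto
      also have "\<dots> \<le> (C * ?K) * Y" using k_high True Y by (intro mult_right_mono) auto
      also have "\<dots> = C * (M / 2 * (t\<^sup>2 * ?K) + 1 / (2 * M) * (u\<^sup>2 * ?K))" by (simp add: Y_def algebra_simps)
      also have "\<dots> \<le> C * (M / 2 * (t\<^sup>2 * ?K) + 1 / (2 * M) * (2 * (t\<^sup>2 * ?K) + 8 * (I2 \<epsilon> (x, y) + I2 \<epsilon> (y, x))))"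
        using C M u by (intro mult_left_mono add_left_mono) auto
      also have "\<dots> = C * ((M / 2 + 1 / M) * I3 (x, y) + (4 / M) * (I2 \<epsilon> (x, y) + I2 \<epsilon> (y, x)))"
        using True M by (simp add: I3_def t_def field_simps)
      finally show ?thesis using True by (simp add: I1_def)
    qed
  qed
  \<comment> \<open>The exact identity is used here: the square of the increment of \<open>w\<close>
    is dropped, and only the term with the squared cutoff increment remains.\<close>
  have P_low2: "c * I1 \<epsilon> (x, y) - C * Q \<epsilon> (x, y) \<le> P \<epsilon> (x, y)" for \<epsilon> x y
  proof (cases "x \<in> \<Omega> \<and> y \<in> \<Omega>")
    case False
    then show ?thesis using outside[OF False, of \<epsilon>] by (auto simp: Q_def)
  next
    case True
    let ?q = "a x * a y * (cutoff \<Omega> \<epsilon> x - cutoff \<Omega> \<epsilon> y)\<^sup>2"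
    have q0: "0 \<le> ?q" using a_nonneg by simp
    have "P \<epsilon> (x, y) = k (x, y) * (w \<epsilon> x - w \<epsilon> y)\<^sup>2 - k (x, y) * ?q"
      by (simp add: P_def w_def power2_eq_square algebra_simps)
    moreover have "0 \<le> k (x, y) * (w \<epsilon> x - w \<epsilon> y)\<^sup>2" using k0 by simp
    moreover have "k (x, y) * ?q \<le> (C * riesz s x y) * ?q" using k_high True q0 by (intro mult_right_mono) auto
    moreover have "(C * riesz s x y) * ?q = C * Q \<epsilon> (x, y)" using True by (simp add: Q_def)
    ultimately show ?thesis using True by (simp add: I1_def)
  qed
  have swap_int: "integrable lborel (\<lambda>p. f (snd p, fst p))" "(LINT p|lborel. f (snd p, fst p)) = integral\<^sup>L lborel f"
    if "integrable lborel f" for f :: "'a \<times> 'a \<Rightarrow> real" using lborel_swap[OF that] .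
  have P_int: "integrable lborel (P \<epsilon>)" "integral\<^sup>L lborel (P \<epsilon>) \<le> 0" if "0 < \<epsilon>" for \<epsilon>
    using energy[OF that] by (simp_all add: P_def[abs_def])
  have "\<exists>B. \<forall>\<epsilon>>0. N \<epsilon> \<le> B"
  proof -
    \<comment> \<open>Chosen so that \<open>8 C J' / M\<close> is at most half of
      \<open>c c0\<close>: the cutoff terms are then absorbed by the coercive one. The summand 1
      keeps \<open>M\<close> positive when \<open>C J' = 0\<close>.\<close>
    define M where "M = 16 * C * J' / (c * c0) + 1"
    have M: "0 < M" using C J'0 c c0 unfolding M_def by (intro add_nonneg_pos divide_nonneg_pos mult_nonneg_nonneg) auto
    define E where "E = (M / 2 + 1 / M) * integral\<^sup>L lborel I3"
    have "N \<epsilon> \<le> 2 * C * E / (c * c0)" if \<epsilon>: "0 < \<epsilon>" for \<epsilon>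
    proof -
      have i2: "integrable lborel (I2 \<epsilon>)" "integral\<^sup>L lborel (I2 \<epsilon>) = J' * N \<epsilon>"
        using I2_int[OF \<epsilon>] by (auto simp: has_bochner_integral_iff)
      let ?R = "\<lambda>p. c * I1 \<epsilon> p - C * ((M / 2 + 1 / M) * I3 p + (4 / M) * (I2 \<epsilon> p + I2 \<epsilon> (snd p, fst p)))"
      have "integral\<^sup>L lborel ?R \<le> integral\<^sup>L lborel (P \<epsilon>)"
      proof (rule integral_mono)
        show "integrable lborel ?R"
          by (intro Bochner_Integration.integrable_diff Bochner_Integration.integrable_add integrable_mult_right
              I1_int[OF \<epsilon>] I3_int i2(1) swap_int)
        show "?R p \<le> P \<epsilon> p" for p using P_low1[OF \<epsilon> M, of "fst p" "snd p"] by simp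
      qed (rule P_int[OF \<epsilon>])
      also have "\<dots> \<le> 0" by (rule P_int[OF \<epsilon>])
      also have "integral\<^sup>L lborel ?R = c * integral\<^sup>L lborel (I1 \<epsilon>) - C * (E + (4 / M) * (J' * N \<epsilon> + J' * N \<epsilon>))"
        using I1_int[OF \<epsilon>] I3_int i2 swap_int[OF i2(1)] by (simp add: E_def)
      finally have "c * integral\<^sup>L lborel (I1 \<epsilon>) \<le> C * E + 8 * C * J' / M * N \<epsilon>" by (simp add: algebra_simps)
      moreover have "c * (c0 * N \<epsilon>) \<le> c * integral\<^sup>L lborel (I1 \<epsilon>)" using I1_low[OF \<epsilon>] c by (intro mult_left_mono) auto
      moreover have "8 * C * J' / M * N \<epsilon> \<le> (c * c0 / 2) * N \<epsilon>"
      proof (rule mult_right_mono[OF _ N0])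
        have "16 * C * J' = (M - 1) * (c * c0)" using c c0 by (simp add: M_def)
        also have "\<dots> \<le> M * (c * c0)" using c c0 by (intro mult_right_mono) auto
        finally show "8 * C * J' / M \<le> c * c0 / 2" using M by (simp add: field_simps)
      qed
      moreover have "c * (c0 * N \<epsilon>) = 2 * ((c * c0 / 2) * N \<epsilon>)" by simp
      ultimately have "(c * c0 / 2) * N \<epsilon> \<le> C * E" by linarith
      then show ?thesis using c c0 by (simp add: field_simps)
    qed
    then show ?thesis by blast
  qed
  then obtain B where B: "\<And>\<epsilon>. 0 < \<epsilon> \<Longrightarrow> N \<epsilon> \<le> B" by blast
  define e where "e j = inverse (real (Suc j))" for j
  have e0: "0 < e j" for j by (simp add: e_def)
  have ev1: "eventually (\<lambda>j. cutoff \<Omega> (e j) x = 1) sequentially" if "x \<in> \<Omega>" for x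
    unfolding e_def by (rule cutoff_tendsto[OF op bd that])
  \<comment> \<open>Fatou: the uniform bound on \<open>N\<close> passes to the limit, because the
    cutoffs are eventually 1 at each point of \<Omega>.\<close>
  have a2D: "integrable lborel (\<lambda>x. (a x)\<^sup>2 * D x)"
  proof (rule integrableI_nonneg)
    have "(\<integral>\<^sup>+x. ennreal ((a x)\<^sup>2 * D x) \<partial>lborel) \<le> (\<integral>\<^sup>+x. liminf (\<lambda>j. ennreal ((w (e j) x)\<^sup>2 * D x)) \<partial>lborel)"
    proof (rule nn_integral_mono)
      fix x :: 'a
      have "eventually (\<lambda>j. ennreal ((w (e j) x)\<^sup>2 * D x) = ennreal ((a x)\<^sup>2 * D x)) sequentially"
      proof (cases "x \<in> \<Omega>")
        case True
        show ?thesis using ev1[OF True] by eventually_elim (simp add: w_def)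
      qed (simp add: w_def a_zero)
      then have "(\<lambda>j. ennreal ((w (e j) x)\<^sup>2 * D x)) \<longlonglongrightarrow> ennreal ((a x)\<^sup>2 * D x)" by (rule tendsto_eventually)
      then show "ennreal ((a x)\<^sup>2 * D x) \<le> liminf (\<lambda>j. ennreal ((w (e j) x)\<^sup>2 * D x))"
        using lim_imp_Liminf[of sequentially] by fastforce
    qed
    also have "\<dots> \<le> liminf (\<lambda>j. \<integral>\<^sup>+x. ennreal ((w (e j) x)\<^sup>2 * D x) \<partial>lborel)"
      by (rule nn_integral_liminf) simp
    also have "(\<lambda>j. \<integral>\<^sup>+x. ennreal ((w (e j) x)\<^sup>2 * D x) \<partial>lborel) = (\<lambda>j. ennreal (N (e j)))"
      unfolding N_def using w2D[OF e0] D0 by (subst nn_integral_eq_integral) auto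
    also have "liminf (\<lambda>j. ennreal (N (e j))) \<le> ennreal B"
      using B[OF e0] by (intro Liminf_le always_eventually allI ennreal_leI) auto
    finally show "(\<integral>\<^sup>+x. ennreal ((a x)\<^sup>2 * D x) \<partial>lborel) < \<infinity>" by (rule le_less_trans) simp
  qed (use D0 in auto)
  define Ia where "Ia p = (a (fst p))\<^sup>2 * \<mu> (fst p) (snd p)" for p :: "'a \<times> 'a"
  have Ia_int: "integrable lborel Ia"
    using mu_int[OF _ a_pos a2D] by (simp add: Ia_def[abs_def] has_bochner_integral_iff)
  \<comment> \<open>The dominating function for \<open>Q\<close>; its integrability is what the
    first use of the energy was for.\<close>
  define G where "G p = I3 p + 2 * (Ia p + Ia (snd p, fst p))" for p
  have G_int: "integrable lborel G"
    unfolding G_def[abs_def]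
    by (intro Bochner_Integration.integrable_add integrable_mult_right I3_int Ia_int swap_int)
  have Ia0: "0 \<le> Ia p" for p using \<mu>0 by (simp add: Ia_def)
  have Q0: "0 \<le> Q \<epsilon> p" for \<epsilon> p using a_nonneg by (simp add: Q_def)
  have Q_le: "Q \<epsilon> (x, y) \<le> G (x, y)" if \<epsilon>: "0 < \<epsilon>" for \<epsilon> x y
  proof (cases "x \<in> \<Omega> \<and> y \<in> \<Omega>")
    case False
    then show ?thesis using Ia0 by (auto simp: Q_def G_def I3_def)
  next
    case True
    let ?K = "riesz s x y" and ?d = "(cutoff \<Omega> \<epsilon> x - cutoff \<Omega> \<epsilon> y)\<^sup>2"
    have d1: "?d \<le> 1"
    proof -
      have "\<bar>cutoff \<Omega> \<epsilon> x - cutoff \<Omega> \<epsilon> y\<bar> \<le> 1"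
        using cutoff_bounds[of \<Omega> \<epsilon> x] cutoff_bounds[of \<Omega> \<epsilon> y] by linarith
      then show ?thesis by (simp add: abs_square_le_1)
    qed
    have ab: "a x * a y \<le> 2 * (a x)\<^sup>2 + (a x - a y)\<^sup>2" "a x * a y \<le> 2 * (a y)\<^sup>2 + (a x - a y)\<^sup>2"
    proof -
      have sq: "2 * \<alpha>\<^sup>2 + (\<alpha> - \<beta>)\<^sup>2 = \<alpha> * \<beta> + (3 / 2 * \<alpha> - \<beta>)\<^sup>2 + 3 / 4 * \<alpha>\<^sup>2" for \<alpha> \<beta> :: real
        by (simp add: power2_eq_square field_simps)
      have "\<alpha> * \<beta> \<le> 2 * \<alpha>\<^sup>2 + (\<alpha> - \<beta>)\<^sup>2" for \<alpha> \<beta> :: real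
        unfolding sq by simp
      from this[of "a x" "a y"] this[of "a y" "a x"]
      show "a x * a y \<le> 2 * (a x)\<^sup>2 + (a x - a y)\<^sup>2" "a x * a y \<le> 2 * (a y)\<^sup>2 + (a x - a y)\<^sup>2"
        by (simp_all add: power2_commute[of "a y"] mult.commute)
    qed
    have dK: "(a x - a y)\<^sup>2 * (?d * ?K) \<le> (a x - a y)\<^sup>2 * ?K"
      using mult_right_mono[OF d1, of ?K] by (intro mult_left_mono) auto
    have "Q \<epsilon> (x, y) = (a x * a y) * (?d * ?K)" using True by (simp add: Q_def mult_ac)
    moreover have "(a x * a y) * (?d * ?K) \<le> (a x - a y)\<^sup>2 * ?K + 2 * (Ia (x, y) + Ia (y, x))"
    proof (cases "cutoff \<Omega> \<epsilon> y \<le> cutoff \<Omega> \<epsilon> x")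
      case le: True
      have "(a x * a y) * (?d * ?K) \<le> (2 * (a x)\<^sup>2 + (a x - a y)\<^sup>2) * (?d * ?K)"
        using ab(1) by (intro mult_right_mono) auto
      also have "\<dots> = 2 * ((a x)\<^sup>2 * (?d * ?K)) + (a x - a y)\<^sup>2 * (?d * ?K)" by (simp add: algebra_simps)
      finally have "(a x * a y) * (?d * ?K) \<le> 2 * ((a x)\<^sup>2 * (?d * ?K)) + (a x - a y)\<^sup>2 * (?d * ?K)" .
      moreover have "(a x)\<^sup>2 * (?d * ?K) \<le> Ia (x, y)"
        unfolding Ia_def using incr[OF \<epsilon> _ le] True by (auto intro!: mult_left_mono)
      ultimately show ?thesis using dK Ia0[of "(y, x)"] by (rule arith3)
    next
      case False
      then have le: "cutoff \<Omega> \<epsilon> x \<le> cutoff \<Omega> \<epsilon> y" by simp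
      have "(a x * a y) * (?d * ?K) \<le> (2 * (a y)\<^sup>2 + (a x - a y)\<^sup>2) * (?d * ?K)"
        using ab(2) by (intro mult_right_mono) auto
      also have "\<dots> = 2 * ((a y)\<^sup>2 * (?d * ?K)) + (a x - a y)\<^sup>2 * (?d * ?K)" by (simp add: algebra_simps)
      finally have "(a x * a y) * (?d * ?K) \<le> 2 * ((a y)\<^sup>2 * (?d * ?K)) + (a x - a y)\<^sup>2 * (?d * ?K)" .
      moreover have "(a y)\<^sup>2 * (?d * ?K) \<le> Ia (y, x)"
        unfolding Ia_def using incr[OF \<epsilon> _ le] True
        by (auto intro!: mult_left_mono simp: riesz_commute[of s x y] power2_commute[of "cutoff \<Omega> \<epsilon> x"])
      ultimately show ?thesis using dK Ia0[of "(x, y)"] by (rule arith4)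
    qed
    ultimately show ?thesis using True by (simp add: G_def I3_def)
  qed
  have Q_lim: "(\<lambda>j. integral\<^sup>L lborel (Q (e j))) \<longlonglongrightarrow> (LINT p|(lborel :: ('a \<times> 'a) measure). 0)"
  proof (rule integral_dominated_convergence[where w = G])
    show "AE p in lborel. (\<lambda>j. Q (e j) p) \<longlonglongrightarrow> 0"
    proof (rule AE_I2, rule tendsto_eventually)
      fix p :: "'a \<times> 'a"
      show "eventually (\<lambda>j. Q (e j) p = 0) sequentially"
      proof (cases "p \<in> \<Omega> \<times> \<Omega>")
        case True
        then have "fst p \<in> \<Omega>" "snd p \<in> \<Omega>" by auto
        from ev1[OF this(1)] ev1[OF this(2)] show ?thesis by eventually_elim (simp add: Q_def)
      qed (simp add: Q_def)
    qed
    show "AE p in lborel. norm (Q (e j) p) \<le> G p" for j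
      using Q_le[OF e0] Q0 by (intro AE_I2) (auto simp: split_paired_all)
  qed (use G_int in auto)
  have Q_int: "integrable lborel (Q (e j))" for j
    by (rule Bochner_Integration.integrable_bound[OF G_int])
      (use Q_le[OF e0] Q0 in \<open>auto simp: split_paired_all intro!: AE_I2 order_trans[OF _ abs_ge_self]\<close>)
  have N_Q: "N (e j) \<le> C / (c * c0) * integral\<^sup>L lborel (Q (e j))" for j
  proof -
    have "(LINT p|lborel. c * I1 (e j) p - C * Q (e j) p) \<le> integral\<^sup>L lborel (P (e j))"
    proof (rule integral_mono)
      show "integrable lborel (\<lambda>p. c * I1 (e j) p - C * Q (e j) p)" using I1_int[OF e0] Q_int by simp
      show "c * I1 (e j) p - C * Q (e j) p \<le> P (e j) p" for p using P_low2[of "e j" "fst p" "snd p"] by simp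
    qed (rule P_int[OF e0])
    also have "\<dots> \<le> 0" by (rule P_int[OF e0])
    finally have "c * integral\<^sup>L lborel (I1 (e j)) \<le> C * integral\<^sup>L lborel (Q (e j))"
      using I1_int[OF e0, of j] Q_int[of j] by simp
    moreover have "c * (c0 * N (e j)) \<le> c * integral\<^sup>L lborel (I1 (e j))" using I1_low[OF e0] c by (intro mult_left_mono) auto
    ultimately have "c * c0 * N (e j) \<le> C * integral\<^sup>L lborel (Q (e j))" by simp
    then show ?thesis using c c0 by (simp add: field_simps)
  qed
  \<comment> \<open>\<open>N (e i)\<close> stays below all later \<open>N (e j)\<close> by
    monotonicity of the cutoffs, and these are bounded by multiples of integrals tending to
    0.\<close>
  have N_zero: "N (e i) = 0" for i
  proof -
    have "N (e i) \<le> N (e j)" if "i \<le> j" for j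
      unfolding N_def
    proof (rule integral_mono)
      fix x
      have "cutoff \<Omega> (e i) x \<le> cutoff \<Omega> (e j) x"
        using that e0 by (intro cutoff_antimono) (auto simp: e_def)
      then have "w (e i) x \<le> w (e j) x" "0 \<le> w (e i) x" using a_nonneg by (auto simp: w_def mult_left_mono)
      then show "(w (e i) x)\<^sup>2 * D x \<le> (w (e j) x)\<^sup>2 * D x" using D0 by (intro mult_right_mono power_mono) auto
    qed (rule w2D[OF e0])+
    then have "eventually (\<lambda>j. N (e i) \<le> C / (c * c0) * integral\<^sup>L lborel (Q (e j))) sequentially"
      using N_Q order_trans by (intro eventually_sequentiallyI[of i]) blast
    moreover have "(\<lambda>j. C / (c * c0) * integral\<^sup>L lborel (Q (e j))) \<longlonglongrightarrow> C / (c * c0) * 0"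
      using Q_lim by (intro tendsto_intros) simp
    ultimately have "N (e i) \<le> C / (c * c0) * 0"
      by (intro tendsto_lowerbound[where F = sequentially]) auto
    then show ?thesis using N0[of "e i"] by simp
  qed
  have "AE x in lborel. \<forall>i. (w (e i) x)\<^sup>2 * D x = 0"
    unfolding AE_all_countable
  proof
    fix i show "AE x in lborel. (w (e i) x)\<^sup>2 * D x = 0"
      using integral_nonneg_eq_0_iff_AE[OF w2D[OF e0, of i]] N_zero[of i] D0 by (simp add: N_def)
  qed
  then show ?thesis
  proof eventually_elim
    case (elim x)
    show "a x = 0"
    proof (cases "x \<in> \<Omega>")
      case True
      then obtain i where "cutoff \<Omega> (e i) x = 1" using eventually_happens[OF ev1] by auto
      moreover have "0 < D x" using bdist_pos[OF op bd True] by (simp add: D_def)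
      ultimately show ?thesis using elim[rule_format, of i] by (simp add: w_def)
    qed (rule a_zero)
  qed
qed

section \<open>The magnetic form\<close>

text \<open>By convention \<open>Gamma\<close> is 0 at its poles, the nonpositive integers, and
  nowhere else; \<open>- s\<close> lies strictly between two of them.\<close>

lemma frac_const_pos:
  assumes "0 < s" "s < 1"
  shows "0 < frac_const n s"
proof -
  have "- s \<notin> \<int>\<^sub>\<le>\<^sub>0"
  proof
    assume "- s \<in> \<int>\<^sub>\<le>\<^sub>0"
    then obtain k where "- s = - of_nat k" by (auto elim: nonpos_Ints_cases')
    then show False using assms by auto
  qed
  then have "Gamma (- s) \<noteq> 0" by (simp add: Gamma_eq_zero_iff)
  moreover have "0 < Gamma (real n / 2 + s)" using assms by (intro Gamma_real_pos) simp
  ultimately show ?thesis unfolding frac_const_def by (intro divide_pos_pos mult_pos_pos) auto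
qed

text \<open>The coefficient of \<open>u x - u y\<close> in the inner product of \<open>A\<close>
  with the fractional gradient of \<open>u\<close>.\<close>

definition radial :: "real \<Rightarrow> ('a \<times> 'a \<Rightarrow> 'a::euclidean_space) \<Rightarrow> 'a \<times> 'a \<Rightarrow> real" where
  "radial s A = (\<lambda>(x, y). sqrt (frac_const DIM('a) s / 2) * (A (x, y) \<bullet> (y - x))
     / norm (y - x) powr (real DIM('a) / 2 + s + 1))"

lemma inner_frac_grad: "A (x, y) \<bullet> frac_grad s u (x, y) = radial s A (x, y) * (u x - u y)"
  by (simp add: frac_grad_def radial_def)

text \<open>The fractional gradient points along \<open>y - x\<close>, so it sees only the parallel
  component; on the diagonal both sides vanish.\<close>

lemma radial_par_part: "radial s (par_part A) = radial s A"
proof (rule ext)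
  fix p :: "'a \<times> 'a"
  obtain x y where p: "p = (x, y)" by (cases p)
  show "radial s (par_part A) p = radial s A p"
  proof (cases "x = y")
    case False
    define d where "d = x - y"
    have d: "y - x = - d" "d \<bullet> d = (norm d)\<^sup>2" "(norm d)\<^sup>2 \<noteq> 0"
      using False by (auto simp: d_def power2_norm_eq_inner)
    have "par_part A (x, y) \<bullet> (y - x) = A (x, y) \<bullet> (y - x)"
      using False d(2,3) unfolding d(1) by (simp add: par_part_def d_def[symmetric])
    then show ?thesis by (simp add: radial_def p)
  qed (simp add: radial_def p)
qed

text \<open>The direction \<open>y - x\<close> changes sign under the swap. Hence the symmetric part
  of \<open>A\<close> yields the antisymmetric part of its radial coefficient, and
  conversely.\<close>

lemma radial_parts:
  "radial s (sym_part A) (x, y) = (radial s A (x, y) - radial s A (y, x)) / 2"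
  "radial s (antisym_part A) (x, y) = (radial s A (x, y) + radial s A (y, x)) / 2"
  for A :: "'a \<times> 'a \<Rightarrow> 'a::euclidean_space"
proof -
  define k where "k = sqrt (frac_const DIM('a) s / 2) / norm (y - x) powr (real DIM('a) / 2 + s + 1)"
  have r: "radial s B (x, y) = k * (B (x, y) \<bullet> (y - x))" for B :: "'a \<times> 'a \<Rightarrow> 'a"
    by (simp add: radial_def k_def)
  have r': "radial s A (y, x) = - (k * (A (y, x) \<bullet> (y - x)))"
    by (simp add: radial_def k_def norm_minus_commute[of x y] inner_diff_right right_diff_distrib diff_divide_distrib)
  have e: "sym_part A (x, y) \<bullet> (y - x) = (A (x, y) \<bullet> (y - x) + A (y, x) \<bullet> (y - x)) / 2"
    "antisym_part A (x, y) \<bullet> (y - x) = (A (x, y) \<bullet> (y - x) - A (y, x) \<bullet> (y - x)) / 2"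
    unfolding sym_part_def antisym_part_def by (simp_all add: inner_add_left inner_diff_left[of "A (x, y)"] scaleR_left.diff[symmetric])
  show "radial s (sym_part A) (x, y) = (radial s A (x, y) - radial s A (y, x)) / 2"
    "radial s (antisym_part A) (x, y) = (radial s A (x, y) + radial s A (y, x)) / 2"
    unfolding r r' e by (simp_all add: distrib_left right_diff_distrib)
qed

lemma sqrt_riesz: "sqrt (riesz s x y) = 1 / norm (x - y) powr (real DIM('a) / 2 + s)" for x y :: "'a::euclidean_space"
proof -
  have "norm (x - y) powr (real DIM('a) + 2 * s) = (norm (x - y) powr (real DIM('a) / 2 + s))\<^sup>2"
    by (simp add: power2_eq_square flip: powr_add)
  then show ?thesis by (simp add: riesz_def real_sqrt_divide)
qed

text \<open>Against a bounded \<open>A\<close> the radial coefficient costs only the square root of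
  the kernel; the other square root stays with the increment it multiplies.\<close>

lemma radial_bound:
  fixes A :: "'a \<times> 'a \<Rightarrow> 'a::euclidean_space"
  assumes "0 \<le> frac_const DIM('a) s"
  shows "\<bar>radial s A (x, y)\<bar> \<le> sqrt (frac_const DIM('a) s / 2) * (norm (A (x, y)) * sqrt (riesz s x y))"
proof (cases "x = y")
  case False
  define r where "r = norm (y - x)"
  define q where "q = real DIM('a) / 2 + s"
  have r: "0 < r" using False by (simp add: r_def)
  have "\<bar>radial s A (x, y)\<bar> = sqrt (frac_const DIM('a) s / 2) * \<bar>A (x, y) \<bullet> (y - x)\<bar> / r powr (q + 1)"
    using assms by (simp add: radial_def r_def q_def abs_mult)
  also have "\<dots> \<le> sqrt (frac_const DIM('a) s / 2) * (norm (A (x, y)) * r) / r powr (q + 1)"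
    unfolding r_def using assms Cauchy_Schwarz_ineq2 by (intro divide_right_mono mult_left_mono) auto
  also have "\<dots> = sqrt (frac_const DIM('a) s / 2) * (norm (A (x, y)) * (1 / r powr q))"
    using r by (simp add: powr_add)
  also have "1 / r powr q = sqrt (riesz s x y)"
    by (simp add: sqrt_riesz r_def q_def norm_minus_commute)
  finally show ?thesis .
qed (simp add: radial_def)

lemma inner_frac_grad_frac_grad:
  fixes x y :: "'a::euclidean_space"
  assumes "0 \<le> frac_const DIM('a) s"
  shows "frac_grad s u (x, y) \<bullet> frac_grad s v (x, y)
    = frac_const DIM('a) s / 2 * ((u x - u y) * (v x - v y) * riesz s x y)"
proof (cases "x = y")
  case False
  define r where "r = norm (y - x)"
  define q where "q = real DIM('a) / 2 + s"
  have r: "0 < r" using False by (simp add: r_def)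
  define k where "k = sqrt (frac_const DIM('a) s / 2)"
  have k: "k * k = frac_const DIM('a) s / 2" unfolding k_def using assms by (intro real_sqrt_mult_self[THEN trans]) simp
  have "(y - x) \<bullet> (y - x) = r * r" by (simp add: r_def power2_norm_eq_inner[symmetric] power2_eq_square)
  then have "frac_grad s u (x, y) \<bullet> frac_grad s v (x, y)
     = (k * k) * ((u x - u y) * (v x - v y) * (r * r / (r powr (q + 1) * r powr (q + 1))))"
    unfolding frac_grad_def by (simp add: r_def[symmetric] q_def[symmetric] k_def[symmetric] mult_ac)
  also have "r * r / (r powr (q + 1) * r powr (q + 1)) = 1 / (r powr q * r powr q)"
    using r by (simp add: powr_add)
  also have "1 / (r powr q * r powr q) = riesz s x y"
    by (simp add: riesz_def r_def q_def norm_minus_commute flip: powr_add)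
  finally show ?thesis unfolding k .
qed (simp add: frac_grad_def)

lemma integrable_fst_cball:
  fixes f :: "'a::euclidean_space \<Rightarrow> real"
  assumes f: "integrable lborel f" and f0: "\<And>x. 0 \<le> f x"
  shows "has_bochner_integral lborel (\<lambda>p :: 'a \<times> 'a. f (fst p) * indicator (cball 0 R) (snd p))
    (integral\<^sup>L lborel f * measure lborel (cball (0::'a) R))"
proof -
  have [measurable]: "f \<in> borel_measurable borel" using borel_measurable_integrable[OF f] by simp
  have [measurable]: "cball (0::'a) R \<in> sets borel" by simp
  have m: "(\<lambda>p :: 'a \<times> 'a. f (fst p) * indicator (cball 0 R) (snd p)) \<in> borel_measurable borel"
    unfolding borel_prod[symmetric] by measurable
  have fin: "emeasure lborel (cball (0::'a) R) = ennreal (measure lborel (cball (0::'a) R))"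
    using emeasure_lborel_cball_finite[of "0::'a" R] by (intro emeasure_eq_ennreal_measure) auto
  have "(\<integral>\<^sup>+p. ennreal (f (fst p) * indicator (cball (0::'a) R) (snd p)) \<partial>lborel)
     = (\<integral>\<^sup>+x. \<integral>\<^sup>+y. ennreal (f x) * indicator (cball (0::'a) R) y \<partial>lborel \<partial>lborel)"
    using m by (subst nn_integral_lborel_pair) (auto simp: f0 ennreal_mult ennreal_indicator)
  also have "\<dots> = (\<integral>\<^sup>+x. ennreal (f x) \<partial>lborel) * ennreal (measure lborel (cball (0::'a) R))"
    by (simp add: nn_integral_cmult_indicator nn_integral_multc fin)
  also have "(\<integral>\<^sup>+x. ennreal (f x) \<partial>lborel) = ennreal (integral\<^sup>L lborel f)"
    using f f0 by (intro nn_integral_eq_integral) auto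
  finally have "(\<integral>\<^sup>+p. ennreal (f (fst p) * indicator (cball (0::'a) R) (snd p)) \<partial>lborel)
      = ennreal (integral\<^sup>L lborel f * measure lborel (cball (0::'a) R))"
    using f0 by (simp add: ennreal_mult integral_nonneg_AE)
  then show ?thesis using m f0 by (intro has_bochner_integral_nn_integral) (auto simp: integral_nonneg_AE)
qed

lemma gagliardo_riesz: "gagliardo s f (x, y) = (f x - f y)\<^sup>2 * riesz s x y" for f :: "'a::euclidean_space \<Rightarrow> real"
  by (simp add: gagliardo_def riesz_def)

lemma Holder_c_bounds:
  fixes A :: "'a::euclidean_space \<Rightarrow> 'b::euclidean_space"
  assumes s: "0 < s" and A: "A \<in> Holder_c s"
  obtains M R where "A \<in> borel_measurable borel" "0 \<le> M" "\<And>p. norm (A p) \<le> M" "\<And>p. A p \<noteq> 0 \<Longrightarrow> norm p \<le> R"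
proof -
  obtain C where C: "\<And>p q. norm (A p - A q) \<le> C * norm (p - q) powr s" and cpt: "compact (closure {p. A p \<noteq> 0})"
    using A by (auto simp: Holder_c_def)
  have "isCont A p" for p
  proof -
    have "((\<lambda>q. norm (q - p) powr s) \<longlongrightarrow> 0) (at p)"
      using s by (intro tendsto_zero_powrI[where b = s] tendsto_norm_zero LIM_zero tendsto_ident_at tendsto_const) auto
    then have "((\<lambda>q. C * norm (q - p) powr s) \<longlongrightarrow> C * 0) (at p)" by (intro tendsto_intros)
    then have lim: "((\<lambda>q. C * norm (q - p) powr s) \<longlongrightarrow> 0) (at p)" by simp
    have "((\<lambda>q. A q - A p) \<longlongrightarrow> 0) (at p)"
      by (rule Lim_null_comparison[OF _ lim]) (rule always_eventually, rule allI, rule C)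
    then show ?thesis unfolding isCont_def by (rule LIM_zero_cancel)
  qed
  then have cont: "continuous_on UNIV A" by (simp add: continuous_at_imp_continuous_on)
  have "compact (A ` closure {p. A p \<noteq> 0})"
    by (intro compact_continuous_image cpt continuous_on_subset[OF cont]) auto
  then have "bounded (A ` closure {p. A p \<noteq> 0})" by (rule compact_imp_bounded)
  then obtain M where M: "\<And>p. p \<in> closure {p. A p \<noteq> 0} \<Longrightarrow> norm (A p) \<le> M"
    unfolding bounded_iff by blast
  obtain R where R: "\<And>p. p \<in> closure {p. A p \<noteq> 0} \<Longrightarrow> norm p \<le> R"
    using compact_imp_bounded[OF cpt] unfolding bounded_iff by auto
  have mem: "p \<in> closure {p. A p \<noteq> 0}" if "A p \<noteq> 0" for p
    using that closure_subset[of "{p. A p \<noteq> 0}"] by auto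
  show ?thesis
  proof (rule that[of "max 0 M" R])
    show "A \<in> borel_measurable borel" by (rule borel_measurable_continuous_onI[OF cont])
    show "norm (A p) \<le> max 0 M" for p using M[OF mem, of p] by (cases "A p = 0") auto
    show "norm p \<le> R" if "A p \<noteq> 0" for p using R[OF mem[OF that]] .
  qed simp
qed

section \<open>The lower-order part of the magnetic form: bounds and sign\<close>

locale bounded_potential =
  fixes s :: real and A :: "'a \<times> 'a \<Rightarrow> 'a::euclidean_space" and M R :: real
  assumes s: "0 < s" "s < 1"
    and A_meas [measurable]: "A \<in> borel_measurable borel"
    and M: "0 \<le> M" "\<And>p. norm (A p) \<le> M" and R: "\<And>p. A p \<noteq> 0 \<Longrightarrow> norm p \<le> R"
begin

definition "c = frac_const DIM('a) s / 2"

lemma c_pos: "0 < c" using frac_const_pos[OF s] by (simp add: c_def)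

text \<open>A majorant of \<open>|A|\<close> that is invariant under the swap, so one bound serves
  both orders of the variables.\<close>

definition "\<beta> p = norm (A p) + norm (A (snd p, fst p))"

lemma swap_measurable [measurable]: "(\<lambda>p :: 'a \<times> 'a. (snd p, fst p)) \<in> borel_measurable borel"
  by (intro borel_measurable_continuous_onI continuous_intros)

lemma \<beta>_measurable [measurable]: "\<beta> \<in> borel_measurable borel"
  unfolding \<beta>_def by measurable

lemma \<beta>_nonneg: "0 \<le> \<beta> p" by (simp add: \<beta>_def)

lemma \<beta>_le: "\<beta> p \<le> 2 * M" using M(2)[of p] M(2)[of "(snd p, fst p)"] by (simp add: \<beta>_def)

lemma \<beta>_support:
  assumes "\<beta> p \<noteq> 0"
  shows "snd p \<in> cball 0 R" "fst p \<in> cball 0 R"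
proof -
  have "A p \<noteq> 0 \<or> A (snd p, fst p) \<noteq> 0" using assms by (auto simp: \<beta>_def)
  then have "norm p \<le> R \<or> norm (snd p, fst p) \<le> R" using R by blast
  then show "snd p \<in> cball 0 R" "fst p \<in> cball 0 R"
    using norm_fst_le[of "fst p" "snd p"] norm_snd_le[of "snd p" "fst p"] norm_fst_le[of "snd p" "fst p"] norm_snd_le[of "fst p" "snd p"]
    by auto
qed

lemma radial_measurable [measurable]: "radial s A \<in> borel_measurable borel"
proof -
  have "radial s A = (\<lambda>p. sqrt (frac_const DIM('a) s / 2) * (A p \<bullet> (snd p - fst p))
     / norm (snd p - fst p) powr (real DIM('a) / 2 + s + 1))"
    by (auto simp: radial_def)
  moreover have [measurable]: "(\<lambda>p :: 'a \<times> 'a. snd p - fst p) \<in> borel_measurable borel"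
    by (intro borel_measurable_continuous_onI continuous_intros)
  ultimately show ?thesis by simp
qed

lemma radial_sym_measurable [measurable]: "radial s (sym_part A) \<in> borel_measurable borel"
    "radial s (antisym_part A) \<in> borel_measurable borel"
proof -
  have "radial s (sym_part A) = (\<lambda>p. (radial s A p - radial s A (snd p, fst p)) / 2)"
    "radial s (antisym_part A) = (\<lambda>p. (radial s A p + radial s A (snd p, fst p)) / 2)"
    by (auto simp: radial_parts)
  then show "radial s (sym_part A) \<in> borel_measurable borel" "radial s (antisym_part A) \<in> borel_measurable borel"
    by (simp_all del: measurable_lborel1)
qed

lemma radial_parts_bound:
  "\<bar>radial s (sym_part A) (x, y)\<bar> \<le> sqrt c * (\<beta> (x, y) * sqrt (riesz s x y))"
  "\<bar>radial s (antisym_part A) (x, y)\<bar> \<le> sqrt c * (\<beta> (x, y) * sqrt (riesz s x y))"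
proof -
  have 0: "0 \<le> frac_const DIM('a) s" using frac_const_pos[OF s] by (simp add: less_imp_le)
  have 1: "\<bar>radial s A (x, y)\<bar> \<le> sqrt c * (norm (A (x, y)) * sqrt (riesz s x y))"
    "\<bar>radial s A (y, x)\<bar> \<le> sqrt c * (norm (A (y, x)) * sqrt (riesz s x y))"
    using radial_bound[OF 0, of A x y] radial_bound[OF 0, of A y x] by (simp_all add: c_def riesz_commute[of s y x])
  have "sqrt c * (\<beta> (x, y) * sqrt (riesz s x y)) = sqrt c * (norm (A (x, y)) * sqrt (riesz s x y)) + sqrt c * (norm (A (y, x)) * sqrt (riesz s x y))"
    by (simp add: \<beta>_def algebra_simps)
  note 2 = this
  have "\<bar>(a - b) / 2\<bar> \<le> T" "\<bar>(a + b) / 2\<bar> \<le> T" if "\<bar>a\<bar> \<le> X" "\<bar>b\<bar> \<le> Y" "T = X + Y" for a b X Y T :: real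
    using that by (auto simp: abs_le_iff)
  from this[OF 1 2]
  show "\<bar>radial s (sym_part A) (x, y)\<bar> \<le> sqrt c * (\<beta> (x, y) * sqrt (riesz s x y))"
    "\<bar>radial s (antisym_part A) (x, y)\<bar> \<le> sqrt c * (\<beta> (x, y) * sqrt (riesz s x y))"
    unfolding radial_parts by this
qed

text \<open>A density that dominates every lower-order term after Young's inequality: one factor
  contributes the Gagliardo density, the other \<beta> times a value of the function.\<close>

definition S :: "('a \<Rightarrow> real) \<Rightarrow> 'a \<times> 'a \<Rightarrow> real" where
  "S v p = gagliardo s v p + (\<beta> p)\<^sup>2 * ((v (fst p))\<^sup>2 + (v (snd p))\<^sup>2)"

text \<open>From \<open>\<beta>^2 \<le> 4 M^2\<close>, once for each of the two variables, times the
  volume of the ball containing the support; the 1 pays for the Gagliardo part.\<close>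

definition CS :: real where "CS = 1 + 8 * M\<^sup>2 * measure lborel (cball (0::'a) R)"

lemma S_nonneg: "0 \<le> S v p"
  unfolding S_def by (cases p) (auto simp: gagliardo_riesz intro!: add_nonneg_nonneg mult_nonneg_nonneg)

lemma S_integral:
  assumes [measurable]: "v \<in> borel_measurable borel" and v: "v \<in> Hs s"
  shows "integrable lborel (S v)" "integral\<^sup>L lborel (S v) \<le> CS * (Hs_norm s v)\<^sup>2"
proof -
  have v2: "integrable lborel (\<lambda>x. (v x)\<^sup>2)" and g: "integrable lborel (gagliardo s v)"
    using v Hs_borel_iff(2)[of v s] by auto
  let ?f = "\<lambda>p :: 'a \<times> 'a. (v (fst p))\<^sup>2 * indicator (cball 0 R) (snd p)"
  let ?V = "measure lborel (cball (0::'a) R)"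
  have f: "integrable lborel ?f" "integral\<^sup>L lborel ?f = integral\<^sup>L lborel (\<lambda>x. (v x)\<^sup>2) * ?V"
    using integrable_fst_cball[OF v2, of R] by (auto simp: has_bochner_integral_iff)
  note f' = lborel_swap[OF f(1)]
  let ?G = "\<lambda>p. gagliardo s v p + 4 * M\<^sup>2 * (?f p + ?f (snd p, fst p))"
  have le: "S v p \<le> ?G p" for p
  proof -
    have b: "(\<beta> p)\<^sup>2 \<le> 4 * M\<^sup>2"
      using power_mono[OF \<beta>_le[of p] \<beta>_nonneg, of 2] by (simp add: power_mult_distrib)
    have "(\<beta> p)\<^sup>2 * (v (fst p))\<^sup>2 \<le> 4 * M\<^sup>2 * ?f p"
      using \<beta>_support[of p] b by (cases "\<beta> p = 0") (auto intro!: mult_right_mono)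
    moreover have "(\<beta> p)\<^sup>2 * (v (snd p))\<^sup>2 \<le> 4 * M\<^sup>2 * ?f (snd p, fst p)"
      using \<beta>_support[of p] b by (cases "\<beta> p = 0") (auto intro!: mult_right_mono)
    ultimately show ?thesis by (simp add: S_def algebra_simps)
  qed
  have G: "integrable lborel ?G" using g f f' by simp
  have [measurable]: "gagliardo s v \<in> borel_measurable borel" by (rule Hs_borel_iff(1)) simp
  have [measurable]: "S v \<in> borel_measurable borel" unfolding S_def by measurable
  show i: "integrable lborel (S v)"
    by (rule Bochner_Integration.integrable_bound[OF G]) (use le S_nonneg in \<open>auto intro!: AE_I2 order_trans[OF _ abs_ge_self]\<close>)
  have "integral\<^sup>L lborel (S v) \<le> integral\<^sup>L lborel ?G" using i G le by (rule integral_mono)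
  also have "\<dots> = integral\<^sup>L lborel (gagliardo s v) + (8 * M\<^sup>2 * ?V) * integral\<^sup>L lborel (\<lambda>x. (v x)\<^sup>2)"
    using g f f' by simp
  also have "\<dots> \<le> CS * integral\<^sup>L lborel (gagliardo s v) + CS * integral\<^sup>L lborel (\<lambda>x. (v x)\<^sup>2)"
  proof (rule add_mono)
    have "0 \<le> 8 * M\<^sup>2 * ?V" by simp
    then show "integral\<^sup>L lborel (gagliardo s v) \<le> CS * integral\<^sup>L lborel (gagliardo s v)"
      using mult_right_mono[of 1 CS "integral\<^sup>L lborel (gagliardo s v)"] Bochner_Integration.integral_nonneg[of lborel "gagliardo s v"]
      by (simp add: CS_def gagliardo_riesz split_paired_all)
    show "(8 * M\<^sup>2 * ?V) * integral\<^sup>L lborel (\<lambda>x. (v x)\<^sup>2) \<le> CS * integral\<^sup>L lborel (\<lambda>x. (v x)\<^sup>2)"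
      by (intro mult_right_mono) (auto simp: CS_def)
  qed
  also have "\<dots> = CS * (Hs_norm s v)\<^sup>2"
  proof -
    have "0 \<le> integral\<^sup>L lborel (\<lambda>x. (v x)\<^sup>2) + integral\<^sup>L lborel (gagliardo s v)"
      by (intro add_nonneg_nonneg Bochner_Integration.integral_nonneg) (auto simp: gagliardo_riesz split_paired_all)
    then show ?thesis using Hs_borel_iff(3)[of v s] v by (simp add: algebra_simps)
  qed
  finally show "integral\<^sup>L lborel (S v) \<le> CS * (Hs_norm s v)\<^sup>2" .
qed

text \<open>For \<open>v = w\<close> this is the density of the divergence of the symmetric part
  plus the potential, tested with \<open>w^2\<close>. Writing the difference of squares as
  \<open>(v + v') (w - w')\<close> makes it bilinear, which perturbation requires.\<close>

definition Z :: "('a \<Rightarrow> real) \<Rightarrow> ('a \<Rightarrow> real) \<Rightarrow> 'a \<times> 'a \<Rightarrow> real" where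
  "Z v w p = radial s (sym_part A) p * ((v (fst p) + v (snd p)) * (w (fst p) - w (snd p)))
     + v (fst p) * w (fst p) * (norm (A p))\<^sup>2"

definition CZ :: real where "CZ = sqrt c + 1"

lemma young_product:
  fixes a b t :: real
  assumes "0 < t"
  shows "\<bar>a\<bar> * \<bar>b\<bar> \<le> t / 2 * a\<^sup>2 + 1 / (2 * t) * b\<^sup>2"
  using young_scaled[OF assms, of "\<bar>a\<bar>" "- \<bar>b\<bar>"] by simp

text \<open>The radial factor is split between the two arguments: \<beta> goes to the values of
  \<open>v\<close>, the root of the kernel to the increment of \<open>w\<close>. The free weight
  \<open>t\<close> matters for cross terms with one small argument.\<close>

lemma Z_bound:
  assumes t: "0 < t"
  shows "\<bar>Z v w p\<bar> \<le> CZ * (t * S v p + 1 / t * S w p)"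
proof -
  obtain x y where p: "p = (x, y)" by (cases p)
  let ?g = "(w x - w y) * sqrt (riesz s x y)"
  define X where "X = t * S v p + 1 / t * S w p"
  have g2: "?g\<^sup>2 = gagliardo s w p" by (simp add: p gagliardo_riesz power_mult_distrib)
  have parts: "0 \<le> gagliardo s v p" "0 \<le> gagliardo s w p" "0 \<le> (\<beta> p)\<^sup>2 * (v x)\<^sup>2" "0 \<le> (\<beta> p)\<^sup>2 * (v y)\<^sup>2"
    "0 \<le> (\<beta> p)\<^sup>2 * (w x)\<^sup>2" "0 \<le> (\<beta> p)\<^sup>2 * (w y)\<^sup>2" by (auto simp: p gagliardo_riesz)
  define P1 P2 P3 where "P1 = t * gagliardo s v p" and "P2 = t * ((\<beta> p)\<^sup>2 * (v x)\<^sup>2)" and "P3 = t * ((\<beta> p)\<^sup>2 * (v y)\<^sup>2)"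
  define P4 P5 P6 where "P4 = 1 / t * gagliardo s w p" and "P5 = 1 / t * ((\<beta> p)\<^sup>2 * (w x)\<^sup>2)" and "P6 = 1 / t * ((\<beta> p)\<^sup>2 * (w y)\<^sup>2)"
  note P_defs = P1_def P2_def P3_def P4_def P5_def P6_def
  have X_eq: "X = P1 + P2 + P3 + P4 + P5 + P6"
    by (simp add: X_def S_def P_defs p algebra_simps add_divide_distrib)
  have parts': "0 \<le> P1" "0 \<le> P2" "0 \<le> P3" "0 \<le> P4" "0 \<le> P5" "0 \<le> P6"
    unfolding P_defs using parts t by (auto intro!: mult_nonneg_nonneg)
  have 1: "\<bar>radial s (sym_part A) p * ((v x + v y) * (w x - w y))\<bar> \<le> sqrt c * X"
  proof -
    have "\<bar>radial s (sym_part A) p\<bar> * (\<bar>v x + v y\<bar> * \<bar>w x - w y\<bar>)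
      \<le> (sqrt c * (\<beta> p * sqrt (riesz s x y))) * (\<bar>v x + v y\<bar> * \<bar>w x - w y\<bar>)"
      unfolding p by (intro mult_right_mono radial_parts_bound(1)) auto
    also have "\<dots> = sqrt c * (\<bar>\<beta> p * (v x + v y)\<bar> * \<bar>?g\<bar>)"
      using \<beta>_nonneg[of p] by (simp add: abs_mult mult_ac)
    also have "\<bar>\<beta> p * (v x + v y)\<bar> * \<bar>?g\<bar> \<le> t / 2 * (\<beta> p * (v x + v y))\<^sup>2 + 1 / (2 * t) * ?g\<^sup>2"
      by (rule young_product[OF t])
    also have "(\<beta> p * (v x + v y))\<^sup>2 \<le> 2 * ((\<beta> p)\<^sup>2 * (v x)\<^sup>2) + 2 * ((\<beta> p)\<^sup>2 * (v y)\<^sup>2)"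
    proof -
      have "(v x + v y)\<^sup>2 \<le> 2 * (v x)\<^sup>2 + 2 * (v y)\<^sup>2"
        using zero_le_power2[of "v x - v y"] by (simp add: power2_eq_square algebra_simps)
      then have "(\<beta> p)\<^sup>2 * (v x + v y)\<^sup>2 \<le> (\<beta> p)\<^sup>2 * (2 * (v x)\<^sup>2 + 2 * (v y)\<^sup>2)" by (rule mult_left_mono) simp
      then show ?thesis unfolding power_mult_distrib by (simp add: distrib_left)
    qed
    also have "t / 2 * (2 * ((\<beta> p)\<^sup>2 * (v x)\<^sup>2) + 2 * ((\<beta> p)\<^sup>2 * (v y)\<^sup>2)) + 1 / (2 * t) * ?g\<^sup>2
        = P2 + P3 + P4 / 2"
      unfolding g2 P_defs using t by (simp add: field_simps)
    also have "\<dots> \<le> X" using parts' unfolding X_eq by linarith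
    finally show ?thesis using t c_pos by (simp add: abs_mult mult_left_mono)
  qed
  have 2: "\<bar>v x * w x * (norm (A p))\<^sup>2\<bar> \<le> X"
  proof -
    have "norm (A p) \<le> \<beta> p" by (simp add: \<beta>_def)
    then have "(norm (A p))\<^sup>2 \<le> (\<beta> p)\<^sup>2" by (intro power_mono) auto
    then have "\<bar>v x * w x\<bar> * (norm (A p))\<^sup>2 \<le> \<bar>v x * w x\<bar> * (\<beta> p)\<^sup>2" by (intro mult_left_mono) auto
    also have "\<dots> = \<bar>\<beta> p * v x\<bar> * \<bar>\<beta> p * w x\<bar>" by (simp add: abs_mult power2_eq_square mult_ac)
    also have "\<dots> \<le> t / 2 * (\<beta> p * v x)\<^sup>2 + 1 / (2 * t) * (\<beta> p * w x)\<^sup>2" by (rule young_product[OF t])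
    also have "\<dots> = P2 / 2 + P5 / 2"
      using t by (simp add: P_defs power_mult_distrib)
    also have "\<dots> \<le> X" using parts' unfolding X_eq by linarith
    finally show ?thesis by (simp add: abs_mult)
  qed
  have "\<bar>Z v w p\<bar> \<le> sqrt c * X + X" using 1 2 by (simp add: Z_def p)
  also have "\<dots> = CZ * X" by (simp add: CZ_def distrib_right)
  finally show ?thesis by (simp only: X_def)
qed

lemma Z_measurable [measurable]:
  assumes [measurable]: "v \<in> borel_measurable borel" "w \<in> borel_measurable borel"
  shows "Z v w \<in> borel_measurable borel"
  unfolding Z_def by measurable

lemma Z_integrable:
  assumes [measurable]: "v \<in> borel_measurable borel" "w \<in> borel_measurable borel" and "v \<in> Hs s" "w \<in> Hs s"
  shows "integrable lborel (Z v w)"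
proof (rule Bochner_Integration.integrable_bound)
  show "integrable lborel (\<lambda>p. CZ * (1 * S v p + 1 / 1 * S w p))"
    using S_integral(1) assms by simp
  show "AE p in lborel. norm (Z v w p) \<le> norm (CZ * (1 * S v p + 1 / 1 * S w p))"
  proof (rule AE_I2)
    fix p show "norm (Z v w p) \<le> norm (CZ * (1 * S v p + 1 / 1 * S w p))"
      using Z_bound[of 1 v w p] by simp
  qed
qed simp

text \<open>The number \<open>t\<close> plays two roles, tolerance for \<open>h\<close> and weight
  in Young's inequality. The factor \<open>1 / t\<close> in the cross terms meets \<open>t^2\<close>
  from the squared norm of \<open>h\<close>, so the total error is of order
  \<open>t\<close>.\<close>

lemma Z_perturb:
  assumes [measurable]: "w \<in> borel_measurable borel" "h \<in> borel_measurable borel" and w: "w \<in> Hs s" and h: "h \<in> Hs s"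
    and \<psi>: "\<psi> = (\<lambda>x. w x + h x)" and t: "0 < t" "t \<le> 1" and small: "Hs_norm s h < t"
  shows "integral\<^sup>L lborel (Z \<psi> \<psi>) \<le> integral\<^sup>L lborel (Z w w) + t * (CZ * (2 * integral\<^sup>L lborel (S w) + 4 * CS))"
proof -
  have CZ: "0 \<le> CZ" using c_pos by (simp add: CZ_def)
  have CS: "0 \<le> CS" by (simp add: CS_def)
  have decomp: "Z \<psi> \<psi> p = Z w w p + (Z w h p + Z h w p + Z h h p)" for p
    by (simp add: Z_def \<psi> algebra_simps)
  note zi = Z_integrable
  have Si: "integrable lborel (S w)" "integrable lborel (S h)"
    using S_integral(1)[of w] S_integral(1)[of h] w h by simp_all
  have lin: "(LINT p|lborel. CZ * (a * S w p + b * S h p)) = CZ * (a * integral\<^sup>L lborel (S w) + b * integral\<^sup>L lborel (S h))" for a b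
    using Si by simp
  have split: "integral\<^sup>L lborel (Z \<psi> \<psi>) = integral\<^sup>L lborel (Z w w) + (LINT p|lborel. Z w h p + Z h w p + Z h h p)"
    unfolding decomp[abs_def] using w h by (simp add: zi)
  have "(LINT p|lborel. Z w h p + Z h w p + Z h h p) \<le> (LINT p|lborel. CZ * (2 * t * S w p + (2 / t + 2) * S h p))"
  proof (rule integral_mono)
    show "integrable lborel (\<lambda>p. Z w h p + Z h w p + Z h h p)" using w h by (simp add: zi)
    show "integrable lborel (\<lambda>p. CZ * (2 * t * S w p + (2 / t + 2) * S h p))" using Si by simp
    fix p
    have "Z w h p \<le> CZ * (t * S w p + 1 / t * S h p)" using Z_bound[OF t(1), of w h p] by linarith
    \<comment> \<open>Weight \<open>1 / t\<close> here: the small function stands in the first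
      argument, and it must again receive the large factor.\<close>
    moreover have "Z h w p \<le> CZ * (1 / t * S h p + t * S w p)" using Z_bound[of "1 / t" h w p] t(1) by simp
    moreover have "Z h h p \<le> CZ * (1 * S h p + 1 / 1 * S h p)" using Z_bound[of 1 h h p] by simp
    ultimately have "Z w h p + Z h w p + Z h h p \<le> CZ * (t * S w p + 1 / t * S h p) + CZ * (1 / t * S h p + t * S w p)
        + CZ * (1 * S h p + 1 / 1 * S h p)" by linarith
    also have "\<dots> = CZ * (2 * t * S w p + (2 / t + 2) * S h p)" using t by (simp add: field_simps)
    finally show "Z w h p + Z h w p + Z h h p \<le> CZ * (2 * t * S w p + (2 / t + 2) * S h p)" .
  qed
  also have "\<dots> = CZ * (2 * t * integral\<^sup>L lborel (S w) + (2 / t + 2) * integral\<^sup>L lborel (S h))"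
    by (rule lin)
  also have "\<dots> \<le> t * (CZ * (2 * integral\<^sup>L lborel (S w) + 4 * CS))"
  proof -
    have "(Hs_norm s h)\<^sup>2 \<le> t\<^sup>2"
    proof (rule power_mono)
      have "0 \<le> integral\<^sup>L lborel (\<lambda>x. (h x)\<^sup>2) + integral\<^sup>L lborel (gagliardo s h)"
        by (intro add_nonneg_nonneg Bochner_Integration.integral_nonneg) (auto simp: gagliardo_riesz split_paired_all)
      then show "0 \<le> Hs_norm s h" using Hs_borel_iff(3)[of h s] h by simp
    qed (use small in simp)
    then have "CS * (Hs_norm s h)\<^sup>2 \<le> CS * t\<^sup>2" using CS by (rule mult_left_mono)
    then have "integral\<^sup>L lborel (S h) \<le> CS * t\<^sup>2" using S_integral(2)[of h] h by simp
    then have "(2 / t + 2) * integral\<^sup>L lborel (S h) \<le> (2 / t + 2) * (CS * t\<^sup>2)" using t by (intro mult_left_mono) auto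
    also have "\<dots> = t * ((2 + 2 * t) * CS)" using t by (simp add: field_simps power2_eq_square)
    also have "\<dots> \<le> t * (4 * CS)" using t CS by (intro mult_left_mono mult_right_mono) auto
    finally have "2 * t * integral\<^sup>L lborel (S w) + (2 / t + 2) * integral\<^sup>L lborel (S h)
        \<le> t * (2 * integral\<^sup>L lborel (S w) + 4 * CS)" by (simp add: algebra_simps)
    then have "CZ * (2 * t * integral\<^sup>L lborel (S w) + (2 / t + 2) * integral\<^sup>L lborel (S h))
        \<le> CZ * (t * (2 * integral\<^sup>L lborel (S w) + 4 * CS))" using CZ by (rule mult_left_mono)
    then show ?thesis by (simp add: mult.left_commute)
  qed
  finally show ?thesis using split by simp
qed

text \<open>The square of a test function is a nonnegative test function, so the hypothesis applies
  to it. Fubini brings the potential into the double integral, and the radial identity does so for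
  the divergence.\<close>

lemma Z_test_function:
  assumes nn: "nonneg_distr_on \<Omega> (\<lambda>\<phi>. frac_div s (par_part (sym_part A)) \<phi>
           + fun_distr (\<lambda>x. LINT y|lebesgue. (norm (A (x, y)))\<^sup>2) \<phi>)"
    and \<psi>: "\<psi> \<in> test_functions \<Omega>" "\<And>x. 0 \<le> \<psi> x" and [measurable]: "\<psi> \<in> borel_measurable borel" and \<psi>H: "\<psi> \<in> Hs s"
  shows "0 \<le> integral\<^sup>L lborel (Z \<psi> \<psi>)"
proof -
  define v where "v x = (\<psi> x)\<^sup>2" for x
  have [measurable]: "v \<in> borel_measurable borel" unfolding v_def by measurable
  have i2: "integrable lborel (\<lambda>p. v (fst p) * (norm (A p))\<^sup>2)"
  proof (rule Bochner_Integration.integrable_bound[OF S_integral(1)[of \<psi>]])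
    show "AE p in lborel. norm (v (fst p) * (norm (A p))\<^sup>2) \<le> norm (S \<psi> p)"
    proof (rule AE_I2)
      fix p :: "'a \<times> 'a"
      have "norm (A p) \<le> \<beta> p" by (simp add: \<beta>_def)
      then have "(norm (A p))\<^sup>2 \<le> (\<beta> p)\<^sup>2" by (intro power_mono) auto
      then have "v (fst p) * (norm (A p))\<^sup>2 \<le> (\<psi> (fst p))\<^sup>2 * (\<beta> p)\<^sup>2" unfolding v_def by (intro mult_left_mono) auto
      also have "\<dots> \<le> S \<psi> p"
        by (cases p) (auto simp: S_def gagliardo_riesz algebra_simps intro!: add_nonneg_nonneg)
      finally show "norm (v (fst p) * (norm (A p))\<^sup>2) \<le> norm (S \<psi> p)" by (simp add: v_def)
    qed
  qed (use \<psi>H in auto)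
  have "{x. v x \<noteq> 0} = {x. \<psi> x \<noteq> 0}" by (auto simp: v_def)
  then have "v \<in> test_functions \<Omega>"
    using \<psi>(1) by (auto simp: test_functions_def v_def[abs_def] power2_eq_square intro!: C_k_mult)
  then have "0 \<le> frac_div s (par_part (sym_part A)) v + fun_distr (\<lambda>x. LINT y|lebesgue. (norm (A (x, y)))\<^sup>2) v"
    using nn unfolding nonneg_distr_on_def by (auto simp: v_def)
  also have "frac_div s (par_part (sym_part A)) v = (LINT p|lborel. radial s (sym_part A) p * (v (fst p) - v (snd p)))"
  proof -
    have "par_part (sym_part A) p \<bullet> frac_grad s v p = radial s (sym_part A) p * (v (fst p) - v (snd p))" for p
      using inner_frac_grad[of "par_part (sym_part A)" "fst p" "snd p" s v] by (simp add: radial_par_part)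
    then show ?thesis unfolding frac_div_def by (simp add: integral_completion)
  qed
  also have "fun_distr (\<lambda>x. LINT y|lebesgue. (norm (A (x, y)))\<^sup>2) v = (LINT p|lborel. v (fst p) * (norm (A p))\<^sup>2)"
  proof -
    have [measurable]: "A \<in> borel_measurable (borel \<Otimes>\<^sub>M borel)" by (simp add: borel_prod)
    have sec: "(LINT y|lebesgue. (norm (A (x, y)))\<^sup>2) = (LINT y|lborel. (norm (A (x, y)))\<^sup>2)" for x
      by (rule integral_completion) measurable
    have m: "(\<lambda>x. LINT y|lborel. (norm (A (x, y)))\<^sup>2) \<in> borel_measurable borel" by measurable
    have i: "integrable (lborel \<Otimes>\<^sub>M lborel) (\<lambda>p. v (fst p) * (norm (A p))\<^sup>2)" using i2 by (simp add: lborel_prod)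
    have "fun_distr (\<lambda>x. LINT y|lebesgue. (norm (A (x, y)))\<^sup>2) v = (LINT x|lborel. (LINT y|lborel. (norm (A (x, y)))\<^sup>2) * v x)"
      unfolding fun_distr_def sec using m by (intro integral_completion) simp
    also have "\<dots> = (LINT x|lborel. LINT y|lborel. v x * (norm (A (x, y)))\<^sup>2)" by (simp add: mult.commute)
    also have "\<dots> = (LINT p|lborel. v (fst p) * (norm (A p))\<^sup>2)"
      using lborel_pair.integral_fst'[OF i] by (simp add: lborel_prod)
    finally show ?thesis .
  qed
  also have "(LINT p|lborel. radial s (sym_part A) p * (v (fst p) - v (snd p))) + (LINT p|lborel. v (fst p) * (norm (A p))\<^sup>2)
      = integral\<^sup>L lborel (Z \<psi> \<psi>)"
  proof -
    have eq: "Z \<psi> \<psi> p = radial s (sym_part A) p * (v (fst p) - v (snd p)) + v (fst p) * (norm (A p))\<^sup>2" for p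
      by (simp add: Z_def v_def power2_eq_square algebra_simps)
    have "integrable lborel (\<lambda>p. Z \<psi> \<psi> p - v (fst p) * (norm (A p))\<^sup>2)" using Z_integrable[of \<psi> \<psi>] \<psi>H i2 by simp
    then have i1: "integrable lborel (\<lambda>p. radial s (sym_part A) p * (v (fst p) - v (snd p)))" by (simp add: eq)
    show ?thesis unfolding eq[abs_def] using i1 i2 by simp
  qed
  finally show ?thesis .
qed

text \<open>Since \<open>w^2\<close> need not lie in \<open>H^s\<close>, the divergence is not
  paired with it directly. Smooth \<psi> close to \<open>w\<close> give the sign for
  \<open>Z \<psi> \<psi>\<close>, and the perturbation bound lets the tolerance \<open>t\<close>
  tend to 0.\<close>

lemma Z_nonneg:
  assumes nn: "nonneg_distr_on \<Omega> (\<lambda>\<phi>. frac_div s (par_part (sym_part A)) \<phi>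
           + fun_distr (\<lambda>x. LINT y|lebesgue. (norm (A (x, y)))\<^sup>2) \<phi>)"
    and w_meas [measurable]: "w \<in> borel_measurable borel" and w: "w \<in> Hs s" and \<Omega>: "open \<Omega>"
    and K: "compact K" "K \<subseteq> \<Omega>" "\<And>x. x \<notin> K \<Longrightarrow> w x = 0" and pos: "\<And>x. 0 \<le> w x"
  shows "0 \<le> integral\<^sup>L lborel (Z w w)"
proof -
  define B where "B = CZ * (2 * integral\<^sup>L lborel (S w) + 4 * CS)"
  have lower: "0 \<le> integral\<^sup>L lborel (Z w w) + t * B" if t: "0 < t" "t \<le> 1" for t
  proof -
    obtain \<psi> where \<psi>: "\<psi> \<in> test_functions \<Omega>" "\<And>x. 0 \<le> \<psi> x" "\<psi> \<in> borel_measurable borel"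
      "(\<lambda>x. \<psi> x - w x) \<in> Hs s" "Hs_norm s (\<lambda>x. \<psi> x - w x) < t"
      using Hs_test_function_approx[OF w_meas w \<Omega> K pos t(1)] by blast
    note [measurable] = \<psi>(3)
    have \<psi>H: "\<psi> \<in> Hs s"
    proof -
      define h where "h x = \<psi> x - w x" for x
      have [measurable]: "h \<in> borel_measurable borel" unfolding h_def by measurable
      have h: "h \<in> Hs s" using \<psi>(4) by (simp add: h_def[abs_def])
      have sq: "(a + b)\<^sup>2 \<le> 2 * a\<^sup>2 + 2 * b\<^sup>2" for a b :: real
        using zero_le_power2[of "a - b"] by (simp add: power2_eq_square algebra_simps)
      have ih: "integrable lborel (\<lambda>x. (h x)\<^sup>2)" "integrable lborel (gagliardo s h)"
        and iw: "integrable lborel (\<lambda>x. (w x)\<^sup>2)" "integrable lborel (gagliardo s w)"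
        using h w Hs_borel_iff(2)[of h s] Hs_borel_iff(2)[of w s] by auto
      have [measurable]: "gagliardo s \<psi> \<in> borel_measurable borel" by (rule Hs_borel_iff(1)) simp
      have "integrable lborel (\<lambda>x. (\<psi> x)\<^sup>2)"
      proof (rule Bochner_Integration.integrable_bound)
        show "integrable lborel (\<lambda>x. 2 * (w x)\<^sup>2 + 2 * (h x)\<^sup>2)" using ih iw by simp
        show "AE x in lborel. norm ((\<psi> x)\<^sup>2) \<le> norm (2 * (w x)\<^sup>2 + 2 * (h x)\<^sup>2)"
        proof (rule AE_I2)
          fix x
          show "norm ((\<psi> x)\<^sup>2) \<le> norm (2 * (w x)\<^sup>2 + 2 * (h x)\<^sup>2)"
            using sq[of "w x" "h x"] by (simp add: h_def)
        qed
      qed simp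
      moreover have "integrable lborel (gagliardo s \<psi>)"
      proof (rule Bochner_Integration.integrable_bound)
        show "integrable lborel (\<lambda>p. 2 * gagliardo s w p + 2 * gagliardo s h p)" using ih iw by simp
        show "AE p in lborel. norm (gagliardo s \<psi> p) \<le> norm (2 * gagliardo s w p + 2 * gagliardo s h p)"
        proof (rule AE_I2)
          fix p :: "'a \<times> 'a"
          obtain x y where p: "p = (x, y)" by (cases p)
          have "(\<psi> x - \<psi> y)\<^sup>2 \<le> 2 * (w x - w y)\<^sup>2 + 2 * (h x - h y)\<^sup>2"
            using sq[of "w x - w y" "h x - h y"] by (simp add: h_def)
          then have "(\<psi> x - \<psi> y)\<^sup>2 * riesz s x y \<le> (2 * (w x - w y)\<^sup>2 + 2 * (h x - h y)\<^sup>2) * riesz s x y"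
            by (rule mult_right_mono) simp
          then show "norm (gagliardo s \<psi> p) \<le> norm (2 * gagliardo s w p + 2 * gagliardo s h p)"
            by (simp add: p gagliardo_riesz algebra_simps)
        qed
      qed simp
      ultimately show ?thesis using Hs_borel_iff(2)[of \<psi> s] by simp
    qed
    have "0 \<le> integral\<^sup>L lborel (Z \<psi> \<psi>)" by (rule Z_test_function[OF nn \<psi>(1-3) \<psi>H])
    also have "\<dots> \<le> integral\<^sup>L lborel (Z w w) + t * B"
      unfolding B_def by (rule Z_perturb[OF w_meas _ w \<psi>(4) _ t \<psi>(5)]) auto
    finally show ?thesis .
  qed
  have "((\<lambda>t. integral\<^sup>L lborel (Z w w) + t * B) \<longlongrightarrow> integral\<^sup>L lborel (Z w w) + 0 * B) (at_right 0)"
    by (intro tendsto_intros)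
  moreover have "eventually (\<lambda>t. 0 \<le> integral\<^sup>L lborel (Z w w) + t * B) (at_right 0)"
    using lower by (intro eventually_at_rightI[of 0 1]) auto
  ultimately show ?thesis by (intro tendsto_lowerbound[of _ _ "at_right 0"]) auto
qed

end

section \<open>Null sets on the product space, and operations preserving \<open>H^s\<close>\<close>

lemma AE_lebesgue_pair:
  fixes P :: "'a::euclidean_space \<Rightarrow> bool"
  assumes "AE x in lebesgue. P x"
  shows "AE p in (lebesgue :: ('a \<times> 'a) measure). P (fst p) \<and> P (snd p)"
proof -
  have "AE x in lborel. P x" using assms by (simp add: AE_completion_iff)
  then obtain N where N: "N \<in> null_sets lborel" "{x. \<not> P x} \<subseteq> N" unfolding eventually_ae_filter by auto
  have "N \<times> UNIV \<in> null_sets (lborel \<Otimes>\<^sub>M (lborel :: 'a measure))"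
    using N by (intro lborel.times_in_null_sets1) auto
  moreover have "UNIV \<times> N \<in> null_sets ((lborel :: 'a measure) \<Otimes>\<^sub>M lborel)"
    using N by (intro lborel.times_in_null_sets2) auto
  ultimately have "N \<times> UNIV \<union> UNIV \<times> N \<in> null_sets (lborel :: ('a \<times> 'a) measure)"
    unfolding lborel_prod by (rule null_sets.Un)
  then have "AE p in (lborel :: ('a \<times> 'a) measure). p \<notin> N \<times> UNIV \<union> UNIV \<times> N" by (rule AE_not_in)
  then have "AE p in (lborel :: ('a \<times> 'a) measure). P (fst p) \<and> P (snd p)"
    by (rule eventually_mono) (use N(2) in auto)
  then show ?thesis by (simp add: AE_completion_iff)
qed

text \<open>The weak pairing is known only to be Lebesgue integrable, and the completed measure is
  not handled as a product. A Borel modification is swapped instead; the exceptional null set stays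
  null under the swap.\<close>

lemma lebesgue_swap:
  fixes f :: "'a::euclidean_space \<times> 'a \<Rightarrow> real"
  assumes f: "integrable lebesgue f"
  shows "integrable lebesgue (\<lambda>p. f (snd p, fst p))" "(LINT p|lebesgue. f (snd p, fst p)) = integral\<^sup>L lebesgue f"
proof -
  obtain f' where f' [measurable]: "f' \<in> borel_measurable lborel" and eq: "AE p in lborel. f p = f' p"
    using completion_ex_borel_measurable_real[OF borel_measurable_integrable[OF f]] by blast
  have f'm: "f' \<in> borel_measurable lebesgue" by (rule measurable_completion) simp
  have eqc: "AE p in lebesgue. f p = f' p" using eq by (simp add: AE_completion_iff)
  have if': "integrable lborel f'"
    using integrable_cong_AE[OF borel_measurable_integrable[OF f] f'm eqc] f integrable_completion[OF f'] by simp
  have sw: "distr lborel lborel (\<lambda>(x, y). (y, x) :: 'a \<times> 'a) = lborel"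
    using lborel_pair.distr_pair_swap[where 'a = 'a and 'b = 'a] by (simp add: lborel_prod)
  have swm: "(\<lambda>(x, y). (y, x) :: 'a \<times> 'a) \<in> measurable lborel lborel"
    using measurable_pair_swap'[of "lborel :: 'a measure" "lborel :: 'a measure"] unfolding lborel_prod .
  have "AE p in distr lborel lborel (\<lambda>(x, y). (y, x) :: 'a \<times> 'a). f p = f' p" unfolding sw by (rule eq)
  then have "AE p in lborel. f (case p of (x, y) \<Rightarrow> (y, x)) = f' (case p of (x, y) \<Rightarrow> (y, x))"
    by (rule AE_distrD[OF swm])
  then have eqs: "AE p in lebesgue. f' (snd p, fst p) = f (snd p, fst p)"
    by (auto simp: AE_completion_iff case_prod_unfold elim!: eventually_mono)
  have m: "(\<lambda>p. f' (snd p, fst p)) \<in> borel_measurable lebesgue"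
    using borel_measurable_integrable[OF lborel_swap(1)[OF if']] by (rule measurable_completion)
  have m2: "(\<lambda>p. f (snd p, fst p)) \<in> borel_measurable lebesgue"
    using m eqs by (rule borel_measurable_AE)
  have ml: "(\<lambda>p. f' (snd p, fst p)) \<in> borel_measurable lborel"
    using borel_measurable_integrable[OF lborel_swap(1)[OF if']] .
  show "integrable lebesgue (\<lambda>p. f (snd p, fst p))"
    using integrable_cong_AE[OF m m2 eqs] integrable_completion[OF ml] lborel_swap(1)[OF if'] by simp
  have "(LINT p|lebesgue. f (snd p, fst p)) = (LINT p|lebesgue. f' (snd p, fst p))"
    using integral_cong_AE[OF m m2 eqs] by simp
  also have "\<dots> = (LINT p|lborel. f' (snd p, fst p))" by (rule integral_completion[OF ml])
  also have "\<dots> = integral\<^sup>L lborel f'" by (rule lborel_swap(2)[OF if'])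
  also have "\<dots> = integral\<^sup>L lebesgue f'" by (rule integral_completion[OF f', symmetric])
  also have "\<dots> = integral\<^sup>L lebesgue f"
    using integral_cong_AE[OF borel_measurable_integrable[OF f] f'm eqc] by simp
  finally show "(LINT p|lebesgue. f (snd p, fst p)) = integral\<^sup>L lebesgue f" .
qed

text \<open>The product rule leaves \<open>b\<close> times an increment of the cutoff. Its square is
  integrable against the kernel, since the Lipschitz bound near the diagonal and the bound 1 far
  away give the truncated kernel of radius \<epsilon>.\<close>

lemma Hs_cutoff_mult:
  fixes b :: "'a::euclidean_space \<Rightarrow> real"
  assumes s: "0 < s" "s < 1" and [measurable]: "b \<in> borel_measurable borel" and b: "b \<in> Hs s" and \<epsilon>: "0 < \<epsilon>"
  shows "(\<lambda>x. b x * cutoff \<Omega> \<epsilon> x) \<in> Hs s"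
proof -
  let ?\<eta> = "cutoff \<Omega> \<epsilon>" and ?w = "\<lambda>x. b x * cutoff \<Omega> \<epsilon> x"
  have b2: "integrable lborel (\<lambda>x. (b x)\<^sup>2)" and g: "integrable lborel (gagliardo s b)"
    using b Hs_borel_iff(2)[of b s] by auto
  have [measurable]: "?w \<in> borel_measurable borel" by measurable
  have [measurable]: "gagliardo s ?w \<in> borel_measurable borel" by (rule Hs_borel_iff(1)) simp
  have "integrable lborel (\<lambda>x. (?w x)\<^sup>2)"
  proof (rule Bochner_Integration.integrable_bound[OF b2])
    show "AE x in lborel. norm ((?w x)\<^sup>2) \<le> norm ((b x)\<^sup>2)"
    proof (rule AE_I2)
      fix x
      have "(b x)\<^sup>2 * (?\<eta> x)\<^sup>2 \<le> (b x)\<^sup>2 * 1" by (intro mult_left_mono) (auto simp: power_le_one)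
      then show "norm ((?w x)\<^sup>2) \<le> norm ((b x)\<^sup>2)" by (simp add: power_mult_distrib)
    qed
  qed simp
  moreover have "integrable lborel (gagliardo s ?w)"
  proof (rule Bochner_Integration.integrable_bound)
    let ?k = "\<lambda>p :: 'a \<times> 'a. (b (fst p))\<^sup>2 * (min 1 ((norm (fst p - snd p))\<^sup>2 / \<epsilon>\<^sup>2) * riesz s (fst p) (snd p))"
    have "integrable lborel ?k"
      by (rule integrable_truncated_kernel[OF s _ b2 \<epsilon>]) simp
    then show "integrable lborel (\<lambda>p. 2 * gagliardo s b p + 2 * ?k p)" using g by simp
    show "AE p in lborel. norm (gagliardo s ?w p) \<le> norm (2 * gagliardo s b p + 2 * ?k p)"
    proof (rule AE_I2)
      fix p :: "'a \<times> 'a"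
      obtain x y where p: "p = (x, y)" by (cases p)
      define X Y where "X = (b x - b y) * ?\<eta> y" and "Y = b x * (?\<eta> x - ?\<eta> y)"
      have "?w x - ?w y = X + Y" by (simp add: X_def Y_def algebra_simps)
      moreover have "(X + Y)\<^sup>2 \<le> 2 * X\<^sup>2 + 2 * Y\<^sup>2"
        using zero_le_power2[of "X - Y"] by (simp add: power2_eq_square algebra_simps)
      moreover have "X\<^sup>2 \<le> (b x - b y)\<^sup>2"
      proof -
        have "(b x - b y)\<^sup>2 * (?\<eta> y)\<^sup>2 \<le> (b x - b y)\<^sup>2 * 1" by (intro mult_left_mono) (auto simp: power_le_one)
        then show ?thesis by (simp add: X_def power_mult_distrib)
      qed
      moreover have "Y\<^sup>2 \<le> (b x)\<^sup>2 * min 1 ((norm (x - y))\<^sup>2 / \<epsilon>\<^sup>2)"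
        unfolding Y_def power_mult_distrib by (intro mult_left_mono cutoff_increment_sq[OF \<epsilon>]) auto
      ultimately have "(?w x - ?w y)\<^sup>2 \<le> 2 * (b x - b y)\<^sup>2 + 2 * ((b x)\<^sup>2 * min 1 ((norm (x - y))\<^sup>2 / \<epsilon>\<^sup>2))" by simp
      then have "(?w x - ?w y)\<^sup>2 * riesz s x y
          \<le> (2 * (b x - b y)\<^sup>2 + 2 * ((b x)\<^sup>2 * min 1 ((norm (x - y))\<^sup>2 / \<epsilon>\<^sup>2))) * riesz s x y" by (rule mult_right_mono) simp
      then show "norm (gagliardo s ?w p) \<le> norm (2 * gagliardo s b p + 2 * ?k p)"
        by (simp add: p gagliardo_riesz distrib_right mult.assoc)
    qed
  qed simp
  ultimately show ?thesis using Hs_borel_iff(2)[of ?w s] by simp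
qed

lemma Hs_negative_part:
  fixes W :: "'a::euclidean_space \<Rightarrow> real"
  assumes [measurable]: "W \<in> borel_measurable borel" and W: "W \<in> Hs s"
  shows "(\<lambda>x. max 0 (- W x)) \<in> Hs s"
proof -
  let ?b = "\<lambda>x. max 0 (- W x)"
  have W2: "integrable lborel (\<lambda>x. (W x)\<^sup>2)" and g: "integrable lborel (gagliardo s W)"
    using W Hs_borel_iff(2)[of W s] by auto
  have [measurable]: "gagliardo s ?b \<in> borel_measurable borel" by (rule Hs_borel_iff(1)) simp
  have "integrable lborel (\<lambda>x. (?b x)\<^sup>2)"
    by (rule Bochner_Integration.integrable_bound[OF W2]) (auto simp: max_def)
  moreover have "integrable lborel (gagliardo s ?b)"
  proof (rule Bochner_Integration.integrable_bound[OF g])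
    show "AE p in lborel. norm (gagliardo s ?b p) \<le> norm (gagliardo s W p)"
    proof (rule AE_I2)
      fix p :: "'a \<times> 'a"
      obtain x y where p: "p = (x, y)" by (cases p)
      have "\<bar>?b x - ?b y\<bar> \<le> \<bar>W x - W y\<bar>" by linarith
      then have "(?b x - ?b y)\<^sup>2 \<le> (W x - W y)\<^sup>2" by (simp only: abs_le_square_iff)
      then have "(?b x - ?b y)\<^sup>2 * riesz s x y \<le> (W x - W y)\<^sup>2 * riesz s x y" by (rule mult_right_mono) simp
      then show "norm (gagliardo s ?b p) \<le> norm (gagliardo s W p)" by (simp add: p gagliardo_riesz)
    qed
  qed simp
  ultimately show ?thesis using Hs_borel_iff(2)[of ?b s] by simp
qed

text \<open>An extension of \<open>u\<close> is only Lebesgue measurable, while the lemmas above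
  work with Borel functions; neither norm notices the change on a null set.\<close>

lemma Hs_borel_representative:
  fixes W0 :: "'a::euclidean_space \<Rightarrow> real"
  assumes "W0 \<in> Hs s"
  obtains W where "W \<in> borel_measurable borel" "W \<in> Hs s" "AE x in lebesgue. W0 x = W x"
proof -
  have W0: "W0 \<in> borel_measurable lebesgue" "integrable lebesgue (\<lambda>x. (W0 x)\<^sup>2)" "integrable lebesgue (gagliardo s W0)"
    using assms by (auto simp: Hs_def)
  obtain W where W': "W \<in> borel_measurable lborel" "AE x in lborel. W0 x = W x"
    using completion_ex_borel_measurable_real[OF W0(1)] by blast
  have [measurable]: "W \<in> borel_measurable borel" using W'(1) by simp
  have Wl: "W \<in> borel_measurable lebesgue" using W'(1) by (rule measurable_completion)
  have ae: "AE x in lebesgue. W0 x = W x" using W'(2) by (simp add: AE_completion_iff)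
  have ae2: "AE x in lebesgue. (W0 x)\<^sup>2 = (W x)\<^sup>2" using ae by eventually_elim simp
  have ae3: "AE p in lebesgue. gagliardo s W0 p = gagliardo s W p"
    using AE_lebesgue_pair[OF ae] by eventually_elim (auto simp: gagliardo_def case_prod_unfold)
  have m2: "(\<lambda>x. (W x)\<^sup>2) \<in> borel_measurable lebesgue" using Wl by measurable
  have "gagliardo s W \<in> borel_measurable lborel" using Hs_borel_iff(1)[of W s] by simp
  then have m3: "gagliardo s W \<in> borel_measurable lebesgue" by (rule measurable_completion)
  have "integrable lebesgue (\<lambda>x. (W x)\<^sup>2)"
    using integrable_cong_AE[OF borel_measurable_integrable[OF W0(2)] m2 ae2] W0(2) by simp
  moreover have "integrable lebesgue (gagliardo s W)"
    using integrable_cong_AE[OF borel_measurable_integrable[OF W0(3)] m3 ae3] W0(3) by simp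
  ultimately have "W \<in> Hs s" using Wl by (simp add: Hs_def)
  with ae show ?thesis using that[of W] by simp
qed

section \<open>The energy inequality for the negative part of the solution\<close>

context bounded_potential
begin

text \<open>The radial coefficient of the antisymmetric part is invariant under the swap, and after
  symmetrisation it multiplies the same product of increments as the kernel; so the two are
  merged.\<close>

definition kern :: "'a \<times> 'a \<Rightarrow> real" where
  "kern p = c * riesz s (fst p) (snd p) + radial s (antisym_part A) p"

lemma kern_measurable [measurable]: "kern \<in> borel_measurable borel"
proof -
  have "(\<lambda>p :: 'a \<times> 'a. riesz s (fst p) (snd p)) \<in> borel_measurable borel"
    unfolding borel_prod[symmetric] by measurable
  then show ?thesis unfolding kern_def by simp
qed

lemma kern_lower:
  assumes "\<And>x y. 0 \<le> par_part (antisym_part A) (x, y) \<bullet> (y - x)"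
  shows "c * riesz s x y \<le> kern (x, y)"
proof -
  have "0 \<le> radial s (par_part (antisym_part A)) (x, y)"
    using assms[of x y] frac_const_pos[OF s] by (simp add: radial_def less_imp_le)
  then show ?thesis by (simp add: kern_def radial_par_part)
qed

text \<open>The root of the kernel equals the kernel times \<open>|x - y| powr (n/2 + s)\<close>,
  and on a bounded set that factor is at most a power of the diameter bound. This is where
  restriction to \<Omega> enters.\<close>

lemma kern_upper:
  assumes "bounded \<Omega>"
  shows "\<exists>C\<ge>0. \<forall>x\<in>\<Omega>. \<forall>y\<in>\<Omega>. kern (x, y) \<le> C * riesz s x y"
proof -
  obtain D where D: "\<And>x y. x \<in> \<Omega> \<Longrightarrow> y \<in> \<Omega> \<Longrightarrow> dist x y \<le> D"
    using bounded_two_points[of \<Omega>] assms by blast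
  define q where "q = real DIM('a) / 2 + s"
  have q: "0 < q" using s by (simp add: q_def add_nonneg_pos)
  have root: "sqrt (riesz s x y) \<le> \<bar>D\<bar> powr q * riesz s x y" if "x \<in> \<Omega>" "y \<in> \<Omega>" for x y
  proof (cases "x = y")
    case False
    then have r: "0 < norm (x - y)" by simp
    have "riesz s x y = sqrt (riesz s x y) * sqrt (riesz s x y)" by simp
    moreover have "norm (x - y) powr q * sqrt (riesz s x y) = 1" using r by (simp add: sqrt_riesz q_def)
    ultimately have "sqrt (riesz s x y) = norm (x - y) powr q * riesz s x y" by (metis mult.assoc mult.left_neutral)
    also have "\<dots> \<le> \<bar>D\<bar> powr q * riesz s x y"
      using D[OF that] q by (intro mult_right_mono powr_mono2) (auto simp: dist_norm)
    finally show ?thesis .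
  qed simp
  have "kern (x, y) \<le> (c + sqrt c * (2 * M * \<bar>D\<bar> powr q)) * riesz s x y" if "x \<in> \<Omega>" "y \<in> \<Omega>" for x y
  proof -
    have "radial s (antisym_part A) (x, y) \<le> sqrt c * (\<beta> (x, y) * sqrt (riesz s x y))"
      using radial_parts_bound(2)[of x y] by linarith
    also have "\<dots> \<le> sqrt c * (2 * M * (\<bar>D\<bar> powr q * riesz s x y))"
      using \<beta>_le[of "(x, y)"] \<beta>_nonneg[of "(x, y)"] root[OF that] M c_pos by (intro mult_left_mono mult_mono) auto
    finally show ?thesis by (simp add: kern_def algebra_simps)
  qed
  moreover have "0 \<le> c + sqrt c * (2 * M * \<bar>D\<bar> powr q)" using c_pos M by simp
  ultimately show ?thesis by blast
qed

text \<open>In the sum over both orders the cross terms regroup by swap symmetry: the symmetric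
  coefficient collects the product of increments, the antisymmetric one the difference
  \<open>u x * v x - u y * v y\<close>.\<close>

lemma mag_grad_symmetrized:
  "mag_grad s A u (x, y) \<bullet> mag_grad s A v (x, y) + mag_grad s A u (y, x) \<bullet> mag_grad s A v (y, x)
   = 2 * (kern (x, y) * ((u x - u y) * (v x - v y)))
     + 2 * (radial s (sym_part A) (x, y) * (u x * v x - u y * v y))
     + u x * v x * (norm (A (x, y)))\<^sup>2 + u y * v y * (norm (A (y, x)))\<^sup>2"
proof -
  have 0: "0 \<le> frac_const DIM('a) s" using frac_const_pos[OF s] by (simp add: less_imp_le)
  have expand: "mag_grad s A u (x, y) \<bullet> mag_grad s A v (x, y) = c * ((u x - u y) * (v x - v y) * riesz s x y)
     + radial s A (x, y) * (v x * (u x - u y) + u x * (v x - v y)) + u x * v x * (norm (A (x, y)))\<^sup>2" for x y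
  proof -
    have "mag_grad s A u (x, y) \<bullet> mag_grad s A v (x, y) = frac_grad s u (x, y) \<bullet> frac_grad s v (x, y)
       + v x * (A (x, y) \<bullet> frac_grad s u (x, y)) + u x * (A (x, y) \<bullet> frac_grad s v (x, y)) + u x * v x * (A (x, y) \<bullet> A (x, y))"
      by (simp add: mag_grad_def inner_add_left inner_add_right inner_commute algebra_simps)
    then show ?thesis
      unfolding inner_frac_grad_frac_grad[OF 0] inner_frac_grad[of A] c_def power2_norm_eq_inner
      by (simp add: algebra_simps)
  qed
  show ?thesis
    unfolding expand[of x y] expand[of y x] kern_def radial_parts riesz_commute[of s y x] fst_conv snd_conv
    by (simp add: field_simps)
qed

text \<open>The exact identity splits the density in two. The square of the increment of
  \<open>a \<eta>\<close> is dominated on the whole space by \<open>S\<close>, through the support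
  of \<open>A\<close>; the other term lives on \<Omega> times \<Omega>, where the kernel bound and
  the truncation apply.\<close>

lemma energy_integrable:
  assumes anti: "\<And>x y. 0 \<le> par_part (antisym_part A) (x, y) \<bullet> (y - x)" and bd: "bounded \<Omega>"
    and [measurable]: "a \<in> borel_measurable borel" and a_nonneg: "\<And>x. 0 \<le> a x" and a_zero: "\<And>x. x \<notin> \<Omega> \<Longrightarrow> a x = 0"
    and a2: "integrable lborel (\<lambda>x. (a x)\<^sup>2)" and \<epsilon>: "0 < \<epsilon>" and w: "(\<lambda>x. a x * cutoff \<Omega> \<epsilon> x) \<in> Hs s"
  shows "integrable lborel (\<lambda>p. kern p * ((a (fst p) - a (snd p)) *
        (a (fst p) * (cutoff \<Omega> \<epsilon> (fst p))\<^sup>2 - a (snd p) * (cutoff \<Omega> \<epsilon> (snd p))\<^sup>2)))"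
proof -
  let ?\<eta> = "cutoff \<Omega> \<epsilon>" and ?w = "\<lambda>x. a x * cutoff \<Omega> \<epsilon> x"
  obtain C where C: "0 \<le> C" "\<And>x y. x \<in> \<Omega> \<Longrightarrow> y \<in> \<Omega> \<Longrightarrow> kern (x, y) \<le> C * riesz s x y"
    using kern_upper[OF bd] by blast
  let ?k = "\<lambda>p :: 'a \<times> 'a. (a (fst p))\<^sup>2 * (min 1 ((norm (fst p - snd p))\<^sup>2 / \<epsilon>\<^sup>2) * riesz s (fst p) (snd p))"
  have k: "integrable lborel ?k"
    by (rule integrable_truncated_kernel[OF s _ a2 \<epsilon>]) simp
  note k' = lborel_swap(1)[OF k]
  have [measurable]: "?w \<in> borel_measurable borel" by measurable
  have kern0: "0 \<le> kern (x, y)" for x y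
    using kern_lower[OF anti, of x y] c_pos riesz_nonneg[of s x y] by (meson less_imp_le mult_nonneg_nonneg order_trans)
  have 1: "integrable lborel (\<lambda>p. kern p * (?w (fst p) - ?w (snd p))\<^sup>2)"
  proof (rule Bochner_Integration.integrable_bound)
    show "integrable lborel (\<lambda>p. (c + sqrt c) * S ?w p)" using S_integral(1)[OF _ w] by simp
    show "AE p in lborel. norm (kern p * (?w (fst p) - ?w (snd p))\<^sup>2) \<le> norm ((c + sqrt c) * S ?w p)"
    proof (rule AE_I2)
      fix p :: "'a \<times> 'a"
      obtain x y where p: "p = (x, y)" by (cases p)
      define dw where "dw = ?w x - ?w y"
      have gS: "dw\<^sup>2 * riesz s x y \<le> S ?w p"
        by (simp add: S_def p gagliardo_riesz dw_def)
      have "radial s (antisym_part A) p * dw\<^sup>2 \<le> (sqrt c * (\<beta> p * sqrt (riesz s x y))) * dw\<^sup>2"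
        using radial_parts_bound(2)[of x y] p by (intro mult_right_mono) auto
      also have "\<dots> = sqrt c * (\<bar>\<beta> p * dw\<bar> * \<bar>dw * sqrt (riesz s x y)\<bar>)"
      proof -
        have "\<bar>\<beta> p * dw\<bar> * \<bar>dw * sqrt (riesz s x y)\<bar> = \<bar>\<beta> p * sqrt (riesz s x y) * dw\<^sup>2\<bar>"
          by (simp only: abs_mult[symmetric] power2_eq_square mult_ac)
        also have "\<dots> = \<beta> p * sqrt (riesz s x y) * dw\<^sup>2"
          using \<beta>_nonneg[of p] by (intro abs_of_nonneg mult_nonneg_nonneg) auto
        finally show ?thesis by simp
      qed
      also have "\<dots> \<le> sqrt c * S ?w p"
      proof (rule mult_left_mono)
        have "\<bar>\<beta> p * dw\<bar> * \<bar>dw * sqrt (riesz s x y)\<bar> \<le> 1 / 2 * (\<beta> p * dw)\<^sup>2 + 1 / (2 * 1) * (dw * sqrt (riesz s x y))\<^sup>2"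
          using young_product[of 1] by simp
        also have "\<dots> = ((\<beta> p)\<^sup>2 * dw\<^sup>2) / 2 + (dw\<^sup>2 * riesz s x y) / 2" by (simp add: power_mult_distrib)
        also have "\<dots> \<le> ((\<beta> p)\<^sup>2 * (2 * ((?w x)\<^sup>2 + (?w y)\<^sup>2))) / 2 + dw\<^sup>2 * riesz s x y"
        proof (rule add_mono)
          have "dw\<^sup>2 \<le> 2 * ((?w x)\<^sup>2 + (?w y)\<^sup>2)"
            unfolding dw_def using zero_le_power2[of "?w x + ?w y"] by (simp add: power2_eq_square algebra_simps)
          then show "((\<beta> p)\<^sup>2 * dw\<^sup>2) / 2 \<le> ((\<beta> p)\<^sup>2 * (2 * ((?w x)\<^sup>2 + (?w y)\<^sup>2))) / 2"
            by (intro divide_right_mono mult_left_mono) auto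
          have "0 \<le> dw\<^sup>2 * riesz s x y" by simp
          then show "(dw\<^sup>2 * riesz s x y) / 2 \<le> dw\<^sup>2 * riesz s x y" by linarith
        qed
        also have "\<dots> = S ?w p" by (simp add: S_def p gagliardo_riesz dw_def)
        finally show "\<bar>\<beta> p * dw\<bar> * \<bar>dw * sqrt (riesz s x y)\<bar> \<le> S ?w p" .
      qed (use c_pos in simp)
      finally have "radial s (antisym_part A) p * dw\<^sup>2 \<le> sqrt c * S ?w p" .
      moreover have "c * (dw\<^sup>2 * riesz s x y) \<le> c * S ?w p" using gS c_pos by (intro mult_left_mono) auto
      moreover have "kern p * dw\<^sup>2 = c * (dw\<^sup>2 * riesz s x y) + radial s (antisym_part A) p * dw\<^sup>2"
        by (simp add: kern_def p algebra_simps)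
      ultimately have "kern p * dw\<^sup>2 \<le> (c + sqrt c) * S ?w p" by (simp add: distrib_right)
      moreover have "0 \<le> kern p * dw\<^sup>2" using kern0 p by simp
      ultimately show "norm (kern p * (?w (fst p) - ?w (snd p))\<^sup>2) \<le> norm ((c + sqrt c) * S ?w p)"
        unfolding dw_def p by simp
    qed
  qed measurable
  have 2: "integrable lborel (\<lambda>p. kern p * (a (fst p) * a (snd p) * (?\<eta> (fst p) - ?\<eta> (snd p))\<^sup>2))"
  proof (rule Bochner_Integration.integrable_bound)
    show "integrable lborel (\<lambda>p. C * (?k p + ?k (snd p, fst p)))" using k k' by simp
    show "AE p in lborel. norm (kern p * (a (fst p) * a (snd p) * (?\<eta> (fst p) - ?\<eta> (snd p))\<^sup>2))
        \<le> norm (C * (?k p + ?k (snd p, fst p)))"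
    proof (rule AE_I2)
      fix p :: "'a \<times> 'a"
      obtain x y where p: "p = (x, y)" by (cases p)
      define d m where "d = (?\<eta> x - ?\<eta> y)\<^sup>2" and "m = min 1 ((norm (x - y))\<^sup>2 / \<epsilon>\<^sup>2)"
      have d: "0 \<le> d" "d \<le> m" "0 \<le> m" using cutoff_increment_sq[OF \<epsilon>, of \<Omega> x y] by (auto simp: d_def m_def)
      have "kern p * (a x * a y * d) \<le> C * (?k p + ?k (snd p, fst p))"
      proof (cases "x \<in> \<Omega> \<and> y \<in> \<Omega>")
        case True
        have "a x * a y \<le> (a x)\<^sup>2 + (a y)\<^sup>2"
        proof -
          have "0 \<le> (a x - a y)\<^sup>2" "0 \<le> (a x)\<^sup>2" "0 \<le> (a y)\<^sup>2" by simp_all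
          moreover have "(a x - a y)\<^sup>2 = (a x)\<^sup>2 - 2 * (a x * a y) + (a y)\<^sup>2" by (simp add: power2_eq_square algebra_simps)
          ultimately show ?thesis by linarith
        qed
        then have ad: "a x * a y * d \<le> ((a x)\<^sup>2 + (a y)\<^sup>2) * m" using d a_nonneg by (intro mult_mono) auto
        have "kern p * (a x * a y * d) \<le> (C * riesz s x y) * (((a x)\<^sup>2 + (a y)\<^sup>2) * m)"
          by (rule mult_mono[OF _ ad]) (use C True p d a_nonneg in auto)
        also have "\<dots> = C * (?k p + ?k (snd p, fst p))"
          by (simp add: p m_def riesz_commute[of s y x] norm_minus_commute[of y x] algebra_simps)
        finally show ?thesis .
      next
        case False
        then have 0: "kern p * (a x * a y * d) = 0" using a_zero by auto
        have "0 \<le> C * (?k p + ?k (snd p, fst p))"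
          using C(1) by (intro mult_nonneg_nonneg add_nonneg_nonneg) auto
        then show ?thesis unfolding 0 .
      qed
      moreover have "0 \<le> kern p * (a x * a y * d)" using kern0 p d a_nonneg by simp
      ultimately show "norm (kern p * (a (fst p) * a (snd p) * (?\<eta> (fst p) - ?\<eta> (snd p))\<^sup>2))
        \<le> norm (C * (?k p + ?k (snd p, fst p)))" unfolding d_def by (simp add: p)
    qed
  qed measurable
  have "kern p * ((a (fst p) - a (snd p)) * (a (fst p) * (?\<eta> (fst p))\<^sup>2 - a (snd p) * (?\<eta> (snd p))\<^sup>2))
    = kern p * (?w (fst p) - ?w (snd p))\<^sup>2 - kern p * (a (fst p) * a (snd p) * (?\<eta> (fst p) - ?\<eta> (snd p))\<^sup>2)" for p
    by (simp add: power2_eq_square algebra_simps)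
  then show ?thesis using Bochner_Integration.integrable_diff[OF 1 2] by simp
qed

text \<open>The weak equation, tested and symmetrised, has a nonnegative total. It is bounded above
  by minus twice the energy minus the lower-order form, and that form is nonnegative, so the energy
  cannot be positive.\<close>

lemma energy_nonpositive:
  assumes op: "open \<Omega>" and bd: "bounded \<Omega>"
    and anti: "\<And>x y. 0 \<le> par_part (antisym_part A) (x, y) \<bullet> (y - x)"
    and nn: "nonneg_distr_on \<Omega> (\<lambda>\<phi>. frac_div s (par_part (sym_part A)) \<phi>
           + fun_distr (\<lambda>x. LINT y|lebesgue. (norm (A (x, y)))\<^sup>2) \<phi>)"
    and W_meas [measurable]: "W \<in> borel_measurable borel" and W: "W \<in> Hs s"
    and a_def: "a = (\<lambda>x. if x \<in> \<Omega> then max 0 (- W x) else 0)"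
    and inside: "AE x in lebesgue. x \<in> \<Omega> \<longrightarrow> W x = u x" and outside: "AE x in lebesgue. x \<notin> \<Omega> \<longrightarrow> 0 \<le> u x"
    and weak: "weak_solution s \<Omega> A F g u" and F: "AE x in lebesgue_on \<Omega>. 0 \<le> F x" and \<epsilon>: "0 < \<epsilon>"
  shows "integrable lborel (\<lambda>p. kern p * ((a (fst p) - a (snd p)) *
        (a (fst p) * (cutoff \<Omega> \<epsilon> (fst p))\<^sup>2 - a (snd p) * (cutoff \<Omega> \<epsilon> (snd p))\<^sup>2)))" (is "integrable lborel ?P")
    and "(LINT p|lborel. kern p * ((a (fst p) - a (snd p)) *
        (a (fst p) * (cutoff \<Omega> \<epsilon> (fst p))\<^sup>2 - a (snd p) * (cutoff \<Omega> \<epsilon> (snd p))\<^sup>2))) \<le> 0"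
proof -
  let ?\<eta> = "cutoff \<Omega> \<epsilon>"
  \<comment> \<open>\<open>b\<close> is the negative part of an extension and lies in
    \<open>H^s\<close>; its restriction \<open>a\<close> to \<Omega> need not, but after the cutoff
    the two coincide.\<close>
  define b where "b x = max 0 (- W x)" for x
  define w where "w x = b x * ?\<eta> x" for x
  define \<phi> where "\<phi> x = w x * ?\<eta> x" for x
  have [measurable]: "\<Omega> \<in> sets borel" using op by auto
  have [measurable]: "b \<in> borel_measurable borel" unfolding b_def by measurable
  have w_meas [measurable]: "w \<in> borel_measurable borel" unfolding w_def by measurable
  have \<phi>_meas [measurable]: "\<phi> \<in> borel_measurable borel" unfolding \<phi>_def by measurable
  have [measurable]: "a \<in> borel_measurable borel" unfolding a_def by measurable
  have b: "b \<in> Hs s" using Hs_negative_part[OF W_meas W] by (simp add: b_def[abs_def])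
  have w: "w \<in> Hs s" using Hs_cutoff_mult[OF s _ b \<epsilon>] by (simp add: w_def[abs_def])
  have \<phi>: "\<phi> \<in> Hs s" using Hs_cutoff_mult[OF s _ w \<epsilon>] by (simp add: \<phi>_def[abs_def])
  have \<eta>0: "?\<eta> x = 0" if "x \<notin> \<Omega>" for x
    using cutoff_eq_0[OF \<epsilon>, of \<Omega> x] bdist_eq_0[OF that] \<epsilon> by simp
  have wa: "w x = a x * ?\<eta> x" for x using \<eta>0[of x] by (simp add: w_def b_def a_def)
  have \<phi>a: "\<phi> x = a x * (?\<eta> x)\<^sup>2" for x by (simp add: \<phi>_def wa power2_eq_square)
  have a0: "0 \<le> a x" for x by (simp add: a_def)
  have w0: "0 \<le> w x" and \<phi>0: "0 \<le> \<phi> x" for x by (simp_all add: wa \<phi>a a0)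
  have off: "w x = 0" "\<phi> x = 0" if "x \<notin> {x. \<epsilon> \<le> bdist \<Omega> x}" for x
    using that cutoff_eq_0[OF \<epsilon>, of \<Omega> x] by (simp_all add: wa \<phi>a)
  note K = cutoff_support[OF op bd \<epsilon>]
  have a2: "integrable lborel (\<lambda>x. (a x)\<^sup>2)"
  proof (rule Bochner_Integration.integrable_bound)
    show "integrable lborel (\<lambda>x. (b x)\<^sup>2)" using b Hs_borel_iff(2)[of b s] by simp
  qed (auto simp: a_def b_def)
  have w': "(\<lambda>x. a x * ?\<eta> x) \<in> Hs s" using w by (simp add: wa[abs_def])
  show P_int: "integrable lborel ?P"
    by (rule energy_integrable[OF anti bd _ a0 _ a2 \<epsilon> w']) (auto simp: a_def)
  have "\<phi> \<in> Hs0_on s \<Omega>" by (rule compact_supported_in_Hs0_on[OF \<phi>_meas \<phi> op K off(2) \<phi>0])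
  moreover have "(\<lambda>x. if x \<in> \<Omega> then \<phi> x else 0) = \<phi>" using \<eta>0 by (auto simp: \<phi>a)
  ultimately have f_int: "integrable lebesgue (\<lambda>p. mag_grad s A u p \<bullet> mag_grad s A \<phi> p)"
    and f_eq: "(LINT p|lebesgue. mag_grad s A u p \<bullet> mag_grad s A \<phi> p) = (LINT x:\<Omega>|lebesgue. F x * \<phi> x)"
    using weak unfolding weak_solution_def mag_laplacian_def Let_def by force+
  have rhs: "0 \<le> (LINT x:\<Omega>|lebesgue. F x * \<phi> x)"
    unfolding set_lebesgue_integral_def
  proof (rule integral_nonneg_AE)
    have "AE x in lebesgue. x \<in> \<Omega> \<longrightarrow> 0 \<le> F x"
      using F by (subst (asm) AE_restrict_space_iff) auto
    then show "AE x in lebesgue. 0 \<le> indicator \<Omega> x *\<^sub>R (F x * \<phi> x)"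
      by eventually_elim (auto simp: indicator_def \<phi>0)
  qed
  let ?f = "\<lambda>p. mag_grad s A u p \<bullet> mag_grad s A \<phi> p"
  let ?fs = "\<lambda>p. ?f p + ?f (snd p, fst p)"
  note f_swap = lebesgue_swap[OF f_int]
  have fs_int: "integrable lebesgue ?fs" by (rule Bochner_Integration.integrable_add[OF f_int f_swap(1)])
  have fs: "0 \<le> integral\<^sup>L lebesgue ?fs"
    using Bochner_Integration.integral_add[OF f_int f_swap(1)] f_swap(2) f_eq rhs by simp
  have Zw: "integrable lborel (Z w w)" by (rule Z_integrable[OF w_meas w_meas w w])
  note Z_swap = lborel_swap[OF Zw]
  define Y where "Y p = Z w w p + Z w w (snd p, fst p)" for p
  have Y_int: "integrable lborel Y" unfolding Y_def[abs_def] using Zw Z_swap(1) by simp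
  have Y: "0 \<le> integral\<^sup>L lborel Y"
    using Z_nonneg[OF nn w_meas w op K off(1) w0] Zw Z_swap by (simp add: Y_def[abs_def])
  \<comment> \<open>An integrable majorant of the symmetrised pairing, built from \<open>a\<close>
    and \<open>w\<close> alone, so that no part involving \<open>u\<close> is integrated
    separately.\<close>
  define H where "H p = - 2 * ?P p - Y p" for p
  have H_int: "integrable lborel H" unfolding H_def[abs_def] using P_int Y_int by simp
  have H_meas: "H \<in> borel_measurable lborel" by (rule borel_measurable_integrable[OF H_int])
  have neg: "AE x in lebesgue. max 0 (- u x) = a x"
    using inside outside by eventually_elim (auto simp: a_def)
  have "AE p in lebesgue. ?fs p \<le> H p"
    using AE_lebesgue_pair[OF neg]
  proof eventually_elim
    case (elim p)
    obtain x y where p: "p = (x, y)" by (cases p)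
    have ax: "max 0 (- u x) = a x" and ay: "max 0 (- u y) = a y" using elim p by auto
    have prod: "u z * \<phi> z = - (w z)\<^sup>2" and vphi: "max 0 (u z) * \<phi> z = 0" and split: "u z = max 0 (u z) - a z"
      if "max 0 (- u z) = a z" for z
    proof -
      show "u z = max 0 (u z) - a z" using that by linarith
      have "a z = - u z \<or> a z = 0" using that by linarith
      then show "u z * \<phi> z = - (w z)\<^sup>2" by (auto simp: \<phi>a wa power2_eq_square)
      have "max 0 (u z) = 0 \<or> a z = 0" using that by linarith
      then show "max 0 (u z) * \<phi> z = 0" by (auto simp: \<phi>a)
    qed
    \<comment> \<open>The positive part of \<open>u\<close> vanishes wherever \<phi> does not. Of
      its product with the increment of \<phi> only the two cross terms survive, and both are at
      most 0.\<close>
    have "(u x - u y) * (\<phi> x - \<phi> y) \<le> - ((a x - a y) * (\<phi> x - \<phi> y))"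
    proof -
      have "(u x - u y) * (\<phi> x - \<phi> y) = (max 0 (u x) - max 0 (u y)) * (\<phi> x - \<phi> y) - (a x - a y) * (\<phi> x - \<phi> y)"
        by (subst split[OF ax], subst split[OF ay]) (simp add: algebra_simps)
      moreover have "(max 0 (u x) - max 0 (u y)) * (\<phi> x - \<phi> y) = - (max 0 (u x) * \<phi> y) - max 0 (u y) * \<phi> x"
        by (simp only: left_diff_distrib right_diff_distrib vphi[OF ax] vphi[OF ay])
      moreover have "0 \<le> max 0 (u x) * \<phi> y" "0 \<le> max 0 (u y) * \<phi> x" using \<phi>0 by simp_all
      ultimately show ?thesis by linarith
    qed
    moreover have "0 \<le> kern (x, y)"
      using kern_lower[OF anti, of x y] c_pos riesz_nonneg[of s x y] by (meson less_imp_le mult_nonneg_nonneg order_trans)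
    ultimately have main: "kern (x, y) * ((u x - u y) * (\<phi> x - \<phi> y)) \<le> kern (x, y) * (- ((a x - a y) * (\<phi> x - \<phi> y)))"
      by (rule mult_left_mono)
    have "radial s (sym_part A) (y, x) = - radial s (sym_part A) (x, y)" by (simp add: radial_parts field_simps)
    then have "Y p = 2 * (radial s (sym_part A) (x, y) * ((w x)\<^sup>2 - (w y)\<^sup>2))
        + (w x)\<^sup>2 * (norm (A (x, y)))\<^sup>2 + (w y)\<^sup>2 * (norm (A (y, x)))\<^sup>2"
      by (simp add: Y_def Z_def p power2_eq_square algebra_simps)
    moreover have "?fs p = 2 * (kern (x, y) * ((u x - u y) * (\<phi> x - \<phi> y)))
     + 2 * (radial s (sym_part A) (x, y) * (u x * \<phi> x - u y * \<phi> y))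
     + u x * \<phi> x * (norm (A (x, y)))\<^sup>2 + u y * \<phi> y * (norm (A (y, x)))\<^sup>2"
      unfolding p fst_conv snd_conv by (rule mag_grad_symmetrized)
    ultimately have "?fs p = 2 * (kern (x, y) * ((u x - u y) * (\<phi> x - \<phi> y))) - Y p"
      \<comment> \<open>Both lower-order terms contain \<open>u\<close> only through
        \<open>u \<phi> = - w^2\<close>, which turns them into exactly \<open>- Y p\<close>.\<close>
      unfolding prod[OF ax] prod[OF ay] by (simp add: algebra_simps)
    also have "\<dots> \<le> 2 * (kern (x, y) * (- ((a x - a y) * (\<phi> x - \<phi> y)))) - Y p"
      by (rule diff_right_mono[OF mult_left_mono[OF main]]) simp
    also have "\<dots> = H p" by (simp add: H_def p \<phi>a)
    finally show ?case .
  qed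
  then have "integral\<^sup>L lebesgue ?fs \<le> integral\<^sup>L lebesgue H"
    using fs_int H_int integrable_completion[OF H_meas] by (intro integral_mono_AE) auto
  also have "\<dots> = integral\<^sup>L lborel H" by (rule integral_completion[OF H_meas])
  also have "\<dots> = - 2 * integral\<^sup>L lborel ?P - integral\<^sup>L lborel Y"
    unfolding H_def[abs_def] using P_int Y_int by simp
  finally show "integral\<^sup>L lborel ?P \<le> 0" using fs Y by simp
qed

end

theorem proposition2:
  fixes s :: real
    and \<Omega> :: "(real ^ 'n) set"
    and A :: "(real ^ 'n) \<times> (real ^ 'n) \<Rightarrow> real ^ 'n"
    and F g u :: "real ^ 'n \<Rightarrow> real"
  assumes "0 < s" and "s < 1"
    and "2 \<le> CARD('n)"
    and "bounded_Lipschitz_domain \<Omega>"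
    and "A \<in> Holder_c s"
    and "par_part (sym_part A) \<in> Hs s"
    and "\<And>x y. 0 \<le> par_part (antisym_part A) (x, y) \<bullet> (y - x)"
    and "nonneg_distr_on \<Omega> (\<lambda>\<phi>. frac_div s (par_part (sym_part A)) \<phi>
           + fun_distr (\<lambda>x. LINT y|lebesgue. (norm (A (x, y)))\<^sup>2) \<phi>)"
    and "weak_solution s \<Omega> A F g u"
    and "F \<in> Linfty_on \<Omega>" and "AE x in lebesgue_on \<Omega>. 0 \<le> F x"
    and "g \<in> Linfty_on (exterior \<Omega>)" and "AE x in lebesgue_on (exterior \<Omega>). 0 \<le> g x"
  shows "(AE x in lebesgue. x \<in> \<Omega> \<longrightarrow> 0 \<le> u x) \<and> (AE x in lebesgue. 0 \<le> u x)"
proof -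
  note s = assms(1,2) and dom = assms(4) and anti = assms(7) and nn = assms(8) and weak = assms(9)
    and F = assms(11) and g = assms(13)
  have op: "open \<Omega>" and bd: "bounded \<Omega>" using dom by (auto simp: bounded_Lipschitz_domain_def)
  have [measurable]: "\<Omega> \<in> sets borel" using op by auto
  obtain M R where A: "A \<in> borel_measurable borel" "0 \<le> M" "\<And>p. norm (A p) \<le> M" "\<And>p. A p \<noteq> 0 \<Longrightarrow> norm p \<le> R"
    using Holder_c_bounds[OF s(1) assms(5)] by blast
  interpret bounded_potential s A M R
    by unfold_locales (use s A in auto)
  obtain W0 where W0: "W0 \<in> Hs s" "AE x in lebesgue. x \<in> \<Omega> \<longrightarrow> W0 x = u x"
    using weak by (auto simp: weak_solution_def Hs_on_def Hs_extensions_def)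
  obtain W where W_meas [measurable]: "W \<in> borel_measurable borel" and W: "W \<in> Hs s" and W0W: "AE x in lebesgue. W0 x = W x"
    using Hs_borel_representative[OF W0(1)] by blast
  have inside: "AE x in lebesgue. x \<in> \<Omega> \<longrightarrow> W x = u x" using W0(2) W0W by eventually_elim simp
  have outside: "AE x in lebesgue. x \<notin> \<Omega> \<longrightarrow> 0 \<le> u x"
  proof -
    have "exterior \<Omega> \<in> sets lebesgue" by (simp add: exterior_def)
    then have 1: "AE x in lebesgue. x \<in> exterior \<Omega> \<longrightarrow> 0 \<le> g x"
      using g by (subst (asm) AE_restrict_space_iff) auto
    have 2: "AE x in lebesgue. x \<in> exterior \<Omega> \<longrightarrow> u x = g x" using weak by (simp add: weak_solution_def)
    \<comment> \<open>The equation \<open>u = g\<close> says nothing on the frontier; it has to be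
      discarded as a null set.\<close>
    have "frontier \<Omega> \<in> null_sets lebesgue"
      using bounded_Lipschitz_domain_negligible_frontier[OF dom] by (simp add: negligible_iff_null_sets)
    then have 3: "AE x in lebesgue. x \<notin> frontier \<Omega>" by (rule AE_not_in)
    from 1 2 3 show ?thesis
      by eventually_elim (use op in \<open>auto simp: exterior_def frontier_def interior_open\<close>)
  qed
  define a where "a = (\<lambda>x. if x \<in> \<Omega> then max 0 (- W x) else 0)"
  have [measurable]: "a \<in> borel_measurable borel" unfolding a_def by measurable
  note en = energy_nonpositive[OF op bd anti nn W_meas W a_def inside outside weak F]
  have b: "(\<lambda>x. max 0 (- W x)) \<in> Hs s" by (rule Hs_negative_part[OF W_meas W])
  then have b2: "integrable lborel (\<lambda>x. (max 0 (- W x))\<^sup>2)" and bg: "integrable lborel (gagliardo s (\<lambda>x. max 0 (- W x)))"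
    using Hs_borel_iff(2)[of "\<lambda>x. max 0 (- W x)" s] by auto
  obtain C where C: "0 \<le> C" "\<And>x y. x \<in> \<Omega> \<Longrightarrow> y \<in> \<Omega> \<Longrightarrow> kern (x, y) \<le> C * riesz s x y"
    using kern_upper[OF bd] by blast
  have "AE x in lborel. a x = 0"
  proof (rule energy_rigidity[OF dom s, of kern a c C])
    show "integrable lborel (\<lambda>x. (a x)\<^sup>2)"
      by (rule Bochner_Integration.integrable_bound[OF b2]) (auto simp: a_def)
    have [measurable]: "\<Omega> \<times> \<Omega> \<in> sets (borel :: ((real ^ 'n) \<times> (real ^ 'n)) measure)"
      using op by (intro borel_open open_Times)
    show "integrable lborel (\<lambda>p. indicator (\<Omega> \<times> \<Omega>) p * ((a (fst p) - a (snd p))\<^sup>2 * riesz s (fst p) (snd p)))"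
    \<comment> \<open>On \<Omega> times \<Omega> the function \<open>a\<close> is the negative part
      of \<open>W\<close>, whose Gagliardo density is integrable; a possible jump of
      \<open>a\<close> across the frontier is not seen here.\<close>
    proof (rule Bochner_Integration.integrable_bound[OF bg])
      have "(\<lambda>p. (a (fst p) - a (snd p))\<^sup>2 * riesz s (fst p) (snd p)) \<in> borel_measurable borel"
        unfolding borel_prod[symmetric] by measurable
      then show "(\<lambda>p. indicator (\<Omega> \<times> \<Omega>) p * ((a (fst p) - a (snd p))\<^sup>2 * riesz s (fst p) (snd p))) \<in> borel_measurable lborel"
        by simp
    qed (auto simp: a_def gagliardo_riesz indicator_def)
  qed (use kern_lower[OF anti] C c_pos en in \<open>auto simp: a_def\<close>)
  then have "AE x in lebesgue. a x = 0" by (simp add: AE_completion_iff)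
  with inside have "AE x in lebesgue. x \<in> \<Omega> \<longrightarrow> 0 \<le> u x"
    by eventually_elim (auto simp: a_def max_def split: if_splits)
  moreover from this outside have "AE x in lebesgue. 0 \<le> u x" by eventually_elim auto
  ultimately show ?thesis by blast
qed

end
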